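(* Let $\mathsf{k}$ be a field, let $S=\mathsf{k}[z_1,\dots,z_s]$ and $R=\mathsf{k}[x_1,\dots,x_n]$ be polynomial rings, and let $\psi\colon S\to R$ be a $\mathsf{k}$-algebra homomorphism sending monomials to monomials. Let $\mathcal{J}$ be an ideal in $S$ generated by monomials $u_1,\dots,u_q$, and let $J=\psi(\mathcal{J})R$. Suppose that $$\psi\big(\mathrm{lcm}(u_{i_1},\dots,u_{i_t})\big)=\mathrm{lcm}\big(\psi(u_{i_1}),\dots,\psi(u_{i_t})\big)$$ for all $1\le i_1<i_2<\dots<i_t\le q$. Then: (1) If $F_\bullet$ is a multigraded free resolution of $\mathcal{J}$ over $S$, then $\widetilde F_\bullet\otimes_{\widetilde S}R$ is a multigraded free resolution of $J$ over $R$, where $R$ is regarded as a graded $\widetilde S$-module via $\psi$. (2) If $\mathbf{m}\in\mathrm{LCM}(J)$ and $i\ge 0$, then $$\beta^R_{i,\mathbf{m}}(J)\le\sum_{\substack{\mathbf{u}\in\mathrm{LCM}(\mathcal{J})\\ \psi(\mathbf{u})=\mathbf{m}}}\beta^S_{i,\mathbf{u}}(\mathcal{J}).$$ (3) If $i\ge 0$, then $\beta_i^R(J)\le\beta_i^S(\mathcal{J})$. In particular, if $q$ and $r$ are positive integers, $I$ is an ideal of $R$ minimally generated by $q$ square-free monomials, $S=S_{[q]}$ and $\psi=\psi_I$, then statements (1)–(3) hold in each of the following cases: $$(\mathcal{J},J)=(\mathcal{E}_q^{\,r},I^r);\qquad(\mathcal{J},J)=(\overline{\mathcal{E}_q^{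\,r}},\overline{I^r});\qquad(\mathcal{J},J)=(\mathcal{E}_q^{(r)},I^{(r)}).$$
   Context: Gradings. $R$ has the standard $\mathbb{Z}^n$-multigrading, and $S$ the standard $\mathbb{Z}^s$-multigrading; multidegrees in $\mathbb{N}^s$ (or $\mathbb{N}^n$) are identified with monomials. $\widetilde S$ denotes the ring $S$ with the (non-standard) $\mathbb{Z}^n$-grading in which the degree of a monomial $\mathbf{m}$ of $S$ is the standard multidegree of $\psi(\mathbf{m})$ in $R$, so that $\psi$ is homogeneous. A $\mathbb{Z}^s$-graded $S$-module $M$ (or free resolution $F_\bullet$), regraded along the induced group homomorphism $\mathbb{Z}^s\to\mathbb{Z}^n$ (so that $M$ becomes a $\mathbb{Z}^n$-graded $\widetilde S$-module), is denoted $\widetilde M$ (resp. $\widetilde F_\bullet$). A free resolution of an ideal $J$ is an exact complex $\cdots\to F_1\xrightarrow{\partial_1}F_0$ of free modules with $J\cong F_0/\mathrm{im}(\partial_1)$; it is multigraded if all maps preserve multidegrees. $\beta_i^S(\mathcal{J})$ is the rank of the $i$-th free module in the minimal graded free resolution of $\mathcal{J}$, and the multigraded Betti number $\beta_{i,\mathbf{u}}^S(\mathcal{J})$ is the number of basis elements of multidegree $\mathbf{u}$ in the $i$-th free module of the minimal multigraded free resolution; similarly for $J$ over $R$. $\mathrm{LCM}(J)$ is the lcm-lattice of a monomial ideal $J$, i.e. the set of all least common multiples of subsets of its minimal monomial generators. Extremal ideals. $[q]=\{1,\dots,q\}$, $S_{[q]}=\mathsf{k}[y_A : \emptyset\neq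 A\subseteq[q]]$, $\epsilon_i=\prod_{A\subseteq[q],\, i\in A}y_A$, and $\mathcal{E}_q=(\epsilon_1,\dots,\epsilon_q)\subseteq S_{[q]}$. If $m_1,\dots,m_q$ are the minimal square-free monomial generators of $I\subseteq R$, then $\psi_I\colon S_{[q]}\to R$ is the $\mathsf{k}$-algebra homomorphism with $\psi_I(y_A)$ equal to the product of all variables $x_k$ such that for every $j\in[q]$: $x_k\mid m_j\iff j\in A$ (empty product $=1$). $\overline{J}$ denotes the integral closure of an ideal $J$ in its polynomial ring, and $J^{(r)}=\bigcap_{P\in\mathrm{Min}(J)}(J^rT_P\cap T)$ is the $r$-th symbolic power of an ideal $J$ of a polynomial ring $T$, with $\mathrm{Min}(J)$ the set of minimal primes of $J$. *)

theory Defs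
  imports Complex_Main "HOL-Library.Poly_Mapping"
begin

section \<open>Polynomial rings and ideals\<close>

text \<open>
  The polynomial ring over \<open>'k\<close> whose variables are indexed by the (finite) type \<open>'v\<close>.
  Exponent vectors \<open>'v \<Rightarrow>\<^sub>0 nat\<close> play the role of monomials.
\<close>

type_synonym 'v monom = "'v \<Rightarrow>\<^sub>0 nat"
type_synonym ('v, 'k) mpoly = "('v \<Rightarrow>\<^sub>0 nat) \<Rightarrow>\<^sub>0 'k"

definition monom :: "'v monom \<Rightarrow> ('v, 'k::comm_ring_1) mpoly" where
  "monom m = Poly_Mapping.single m 1"

definition Var :: "'v \<Rightarrow> ('v, 'k::comm_ring_1) mpoly" where
  "Var v = monom (Poly_Mapping.single v 1)"

definition Const :: "'k \<Rightarrow> ('v, 'k::comm_ring_1) mpoly" where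
  "Const c = Poly_Mapping.single 0 c"

definition mlcm :: "'v monom set \<Rightarrow> 'v monom" where
  "mlcm A = Abs_poly_mapping (\<lambda>v. Max (insert 0 ((\<lambda>m. Poly_Mapping.lookup m v) ` A)))"

definition squarefree_monom :: "'v monom \<Rightarrow> bool" where
  "squarefree_monom m \<longleftrightarrow> (\<forall>v. Poly_Mapping.lookup m v \<le> 1)"

text \<open>Ideals of a commutative ring are its submodules: \<open>ideal.subspace\<close> is ``is an ideal'' and
  \<open>ideal.span\<close> is ``ideal generated by''.\<close>

global_interpretation ideal: module "(*) :: 'a::comm_ring_1 \<Rightarrow> 'a \<Rightarrow> 'a"
  by standard (simp_all add: algebra_simps)

declare ideal.scale_scale [simp del] (* loops with mult.assoc *)

primrec ideal_power :: "'a::comm_ring_1 set \<Rightarrow> nat \<Rightarrow> 'a set" where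
  "ideal_power J 0 = UNIV"
| "ideal_power J (Suc r) = ideal.span {a * b |a b. a \<in> J \<and> b \<in> ideal_power J r}"

definition integral_closure :: "'a::comm_ring_1 set \<Rightarrow> 'a set" where
  "integral_closure J = {f. \<exists>n\<ge>1. \<exists>a. (\<forall>i\<in>{1..n}. a i \<in> ideal_power J i) \<and>
     f ^ n + (\<Sum>i=1..n. a i * f ^ (n - i)) = 0}"

definition prime_ideal :: "'a::comm_ring_1 set \<Rightarrow> bool" where
  "prime_ideal P \<longleftrightarrow> ideal.subspace P \<and> P \<noteq> UNIV \<and> (\<forall>a b. a * b \<in> P \<longrightarrow> a \<in> P \<or> b \<in> P)"

definition minimal_primes :: "'a::comm_ring_1 set \<Rightarrow> 'a set set" where
  "minimal_primes J =
     {P. prime_ideal P \<and> J \<subseteq> P \<and> (\<forall>Q. prime_ideal Q \<and> J \<subseteq> Q \<and> Q \<subseteq> P \<longrightarrow> Q = P)}"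

text \<open>Equality of the fractions \<open>a/s\<close> and \<open>b/t\<close> in the localization at the prime \<open>P\<close>,
  where \<open>s\<close> and \<open>t\<close> lie outside \<open>P\<close>.\<close>

definition frac_eq :: "'a::comm_ring_1 set \<Rightarrow> 'a \<times> 'a \<Rightarrow> 'a \<times> 'a \<Rightarrow> bool" where
  "frac_eq P x y \<longleftrightarrow> (\<exists>w. w \<notin> P \<and> w * (fst x * snd y - fst y * snd x) = 0)"

text \<open>The contraction \<open>I T\<^sub>P \<inter> T\<close>: the \<open>f\<close> whose image \<open>f/1\<close> in \<open>T\<^sub>P\<close> lies in
  \<open>I T\<^sub>P = {a/s | a \<in> I, s \<notin> P}\<close>.\<close>

definition localization_contraction :: "'a::comm_ring_1 set \<Rightarrow> 'a set \<Rightarrow> 'a set" where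
  "localization_contraction I P = {f. \<exists>a\<in>I. \<exists>s. s \<notin> P \<and> frac_eq P (f, 1) (a, s)}"

definition symbolic_power :: "'a::comm_ring_1 set \<Rightarrow> nat \<Rightarrow> 'a set" where
  "symbolic_power J r = (\<Inter>P\<in>minimal_primes J. localization_contraction (ideal_power J r) P)"

definition minimally_generates :: "'v monom set \<Rightarrow> ('v, 'k::comm_ring_1) mpoly set \<Rightarrow> bool" where
  "minimally_generates G J \<longleftrightarrow>
     ideal.span (monom ` G) = J \<and> (\<forall>G'. G' \<subset> G \<longrightarrow> ideal.span (monom ` G') \<noteq> J)"

definition minimal_generators :: "('v, 'k::comm_ring_1) mpoly set \<Rightarrow> 'v monom set" where
  "minimal_generators J = (THE G. minimally_generates G J)"

definition LCM_lattice :: "('v, 'k::comm_ring_1) mpoly set \<Rightarrow> 'v monom set" where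
  "LCM_lattice J = mlcm ` Pow (minimal_generators J)"


section \<open>Graded free modules and resolutions\<close>

text \<open>
  The free module on a set \<open>B\<close> of basis elements consists of the finitely supported
  coefficient functions with support in \<open>B\<close>; \<open>Poly_Mapping.single b 1\<close> is the basis element
  itself. A homomorphism out of it is given by the images of the basis elements.
\<close>

definition free_module :: "'b set \<Rightarrow> ('b \<Rightarrow>\<^sub>0 'a::comm_ring_1) set" where
  "free_module B = {f. Poly_Mapping.keys f \<subseteq> B}"

definition smult :: "'a::comm_ring_1 \<Rightarrow> ('b \<Rightarrow>\<^sub>0 'a) \<Rightarrow> ('b \<Rightarrow>\<^sub>0 'a)" where
  "smult p f = Poly_Mapping.map ((*) p) f"

definition hom_of :: "('a \<Rightarrow> 'c \<Rightarrow> 'c) \<Rightarrow> ('b \<Rightarrow> 'c) \<Rightarrow> ('b \<Rightarrow>\<^sub>0 'a::comm_ring_1) \<Rightarrow> 'c::ab_group_add"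
  where "hom_of sc img f = (\<Sum>b\<in>Poly_Mapping.keys f. sc (Poly_Mapping.lookup f b) (img b))"

text \<open>
  A sequence \<open>\<dots> \<rightarrow> F\<^sub>1 \<rightarrow> F\<^sub>0\<close> of graded free modules: \<open>F\<^sub>i\<close> has basis \<open>basis F i\<close>, the basis
  element \<open>b\<close> of \<open>F\<^sub>i\<close> has degree \<open>dgr F i b\<close> in the abelian group \<open>'g\<close>, and, for \<open>i \<ge> 1\<close>,
  \<open>bdry F i b\<close> is its image in \<open>F\<^bsub>i-1\<^esub>\<close> (\<open>bdry F 0\<close> is irrelevant).
\<close>

record (overloaded) ('b, 'v, 'g, 'k) free_complex =
  basis :: "nat \<Rightarrow> 'b set"
  dgr :: "nat \<Rightarrow> 'b \<Rightarrow> 'g"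
  bdry :: "nat \<Rightarrow> 'b \<Rightarrow> 'b \<Rightarrow>\<^sub>0 ('v, 'k) mpoly"

definition Fmod :: "('b, 'v, 'g, 'k::comm_ring_1) free_complex \<Rightarrow> nat \<Rightarrow> ('b \<Rightarrow>\<^sub>0 ('v, 'k) mpoly) set"
  where "Fmod F i = free_module (basis F i)"

definition dmap :: "('b, 'v, 'g, 'k::comm_ring_1) free_complex \<Rightarrow> nat \<Rightarrow>
    ('b \<Rightarrow>\<^sub>0 ('v, 'k) mpoly) \<Rightarrow> ('b \<Rightarrow>\<^sub>0 ('v, 'k) mpoly)"
  where "dmap F i = hom_of smult (bdry F i)"

text \<open>A grading of the polynomial ring by \<open>'g\<close> is given by the degree \<open>wt m\<close> of each monomial.\<close>

definition homogeneous :: "('v monom \<Rightarrow> 'g) \<Rightarrow> 'g \<Rightarrow> ('v, 'k::comm_ring_1) mpoly \<Rightarrow> bool" where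
  "homogeneous wt d p \<longleftrightarrow> (\<forall>m\<in>Poly_Mapping.keys p. wt m = d)"

definition Fhomogeneous :: "('v monom \<Rightarrow> 'g::ab_group_add) \<Rightarrow>
    ('b, 'v, 'g, 'k::comm_ring_1) free_complex \<Rightarrow> nat \<Rightarrow> 'g \<Rightarrow> ('b \<Rightarrow>\<^sub>0 ('v, 'k) mpoly) \<Rightarrow> bool"
  where "Fhomogeneous wt F i d f \<longleftrightarrow>
    f \<in> Fmod F i \<and> (\<forall>b\<in>basis F i. homogeneous wt (d - dgr F i b) (Poly_Mapping.lookup f b))"

text \<open>
  The isomorphism of \<open>J\<close> with \<open>F\<^sub>0 / im \<partial>\<^sub>1\<close> is given as a degree-preserving homomorphism
  from \<open>F\<^sub>0\<close> onto \<open>J\<close> with kernel \<open>im \<partial>\<^sub>1\<close>.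
\<close>

definition graded_free_resolution :: "('v monom \<Rightarrow> 'g::ab_group_add) \<Rightarrow>
    ('v, 'k::comm_ring_1) mpoly set \<Rightarrow> ('b, 'v, 'g, 'k) free_complex \<Rightarrow> bool"
  where "graded_free_resolution wt J F \<longleftrightarrow>
    (\<forall>i. \<forall>b\<in>basis F (Suc i). bdry F (Suc i) b \<in> Fmod F i) \<and>
    (\<forall>i d f. Fhomogeneous wt F (Suc i) d f \<longrightarrow> Fhomogeneous wt F i d (dmap F (Suc i) f)) \<and>
    (\<forall>i. dmap F (Suc (Suc i)) ` Fmod F (Suc (Suc i)) = {f \<in> Fmod F (Suc i). dmap F (Suc i) f = 0}) \<and>
    (\<exists>e. (\<forall>d f. Fhomogeneous wt F 0 d f \<longrightarrow> homogeneous wt d (hom_of (*) e f)) \<and>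
         hom_of (*) e ` Fmod F 0 = J \<and>
         dmap F (Suc 0) ` Fmod F (Suc 0) = {f \<in> Fmod F 0. hom_of (*) e f = 0})"

text \<open>Minimality: \<open>im \<partial>\<^bsub>i+1\<^esub> \<subseteq> \<mm> F\<^sub>i\<close> for the ideal \<open>\<mm>\<close> generated by the variables. As usual, the
  modules of a minimal resolution are of finite rank.\<close>

definition minimal_graded_free_resolution :: "('v monom \<Rightarrow> 'g::ab_group_add) \<Rightarrow>
    ('v, 'k::comm_ring_1) mpoly set \<Rightarrow> ('b, 'v, 'g, 'k) free_complex \<Rightarrow> bool"
  where "minimal_graded_free_resolution wt J F \<longleftrightarrow>
    graded_free_resolution wt J F \<and> (\<forall>i. finite (basis F i)) \<and>
    (\<forall>i. \<forall>f\<in>dmap F (Suc i) ` Fmod F (Suc i). \<forall>b. Poly_Mapping.lookup f b \<in> ideal.span (range Var))"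

text \<open>The standard multigrading (by \<open>\<int>\<^sup>n\<close>) and the standard \<open>\<int>\<close>-grading.\<close>

definition mdeg :: "'v monom \<Rightarrow> ('v \<Rightarrow>\<^sub>0 int)" where
  "mdeg m = Poly_Mapping.map int m"

definition tdeg :: "'v monom \<Rightarrow> int" where
  "tdeg m = (\<Sum>v\<in>Poly_Mapping.keys m. int (Poly_Mapping.lookup m v))"

abbreviation multigraded_free_resolution :: "('v, 'k::comm_ring_1) mpoly set \<Rightarrow>
    ('b, 'v, 'v \<Rightarrow>\<^sub>0 int, 'k) free_complex \<Rightarrow> bool"
  where "multigraded_free_resolution \<equiv> graded_free_resolution mdeg"

text \<open>Minimal resolutions are unique up to isomorphism, so the choices below do not matter. Being of
  finite rank, their modules can be taken to have bases of natural numbers.\<close>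

definition multigraded_betti :: "nat \<Rightarrow> 'v monom \<Rightarrow> ('v, 'k::comm_ring_1) mpoly set \<Rightarrow> nat" where
  "multigraded_betti i u J =
    (let F = (SOME F :: (nat, 'v, 'v \<Rightarrow>\<^sub>0 int, 'k) free_complex. minimal_graded_free_resolution mdeg J F)
     in card {b \<in> basis F i. dgr F i b = mdeg u})"

definition betti :: "nat \<Rightarrow> ('v, 'k::comm_ring_1) mpoly set \<Rightarrow> nat" where
  "betti i J =
    (let F = (SOME F :: (nat, 'v, int, 'k) free_complex. minimal_graded_free_resolution tdeg J F)
     in card (basis F i))"


section \<open>Monomial algebra homomorphisms and base change\<close>

definition algebra_hom :: "(('z, 'k::comm_ring_1) mpoly \<Rightarrow> ('x, 'k) mpoly) \<Rightarrow> bool" where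
  "algebra_hom \<psi> \<longleftrightarrow> \<psi> 1 = 1 \<and> (\<forall>p q. \<psi> (p + q) = \<psi> p + \<psi> q) \<and> (\<forall>p q. \<psi> (p * q) = \<psi> p * \<psi> q) \<and>
     (\<forall>c. \<psi> (Const c) = Const c)"

definition monomial_map :: "(('z, 'k::comm_ring_1) mpoly \<Rightarrow> ('x, 'k) mpoly) \<Rightarrow> bool" where
  "monomial_map \<psi> \<longleftrightarrow> (\<forall>m. \<exists>m'. \<psi> (monom m) = monom m')"

definition on_monom :: "(('z, 'k::comm_ring_1) mpoly \<Rightarrow> ('x, 'k) mpoly) \<Rightarrow> 'z monom \<Rightarrow> 'x monom" where
  "on_monom \<psi> m = (THE m'. \<psi> (monom m) = monom m')"

text \<open>The induced group homomorphism \<open>\<int>\<^sup>s \<rightarrow> \<int>\<^sup>n\<close>, determined on the standard basis by the images of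
  the variables.\<close>

definition induced_deg :: "(('z, 'k::comm_ring_1) mpoly \<Rightarrow> ('x, 'k) mpoly) \<Rightarrow> ('z \<Rightarrow>\<^sub>0 int) \<Rightarrow> ('x \<Rightarrow>\<^sub>0 int)"
  where "induced_deg \<psi> = frag_extend (\<lambda>z. mdeg (on_monom \<psi> (Poly_Mapping.single z 1)))"

definition regrade :: "('g \<Rightarrow> 'h) \<Rightarrow> ('b, 'v, 'g, 'k::comm_ring_1) free_complex \<Rightarrow>
    ('b, 'v, 'h, 'k) free_complex"
  where "regrade \<phi> F = \<lparr>basis = basis F, dgr = (\<lambda>i b. \<phi> (dgr F i b)), bdry = bdry F\<rparr>"

text \<open>
  Extension of scalars along \<open>\<psi>\<close>: for a free module with basis \<open>B\<close> it is the free module over the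
  target ring with the same basis (\<open>b\<close> standing for \<open>b \<otimes> 1\<close>, with the degree of \<open>b\<close>), the canonical map
  \<open>f \<mapsto> f \<otimes> 1\<close> applies \<open>\<psi>\<close> to the coefficients, and so does the extension of a homomorphism to its
  matrix entries. The lemmas below verify the universal property of \<open>f \<mapsto> f \<otimes> 1\<close>
  and that the new differential is \<open>\<partial> \<otimes> 1\<close>.
\<close>

definition ext_scalars :: "(('z, 'k::comm_ring_1) mpoly \<Rightarrow> ('x, 'k) mpoly) \<Rightarrow>
    ('b \<Rightarrow>\<^sub>0 ('z, 'k) mpoly) \<Rightarrow> ('b \<Rightarrow>\<^sub>0 ('x, 'k) mpoly)"
  where "ext_scalars \<psi> f = Poly_Mapping.map \<psi> f"

definition base_change :: "(('z, 'k::comm_ring_1) mpoly \<Rightarrow> ('x, 'k) mpoly) \<Rightarrow>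
    ('b, 'z, 'g, 'k) free_complex \<Rightarrow> ('b, 'x, 'g, 'k) free_complex"
  where "base_change \<psi> F =
    \<lparr>basis = basis F, dgr = dgr F, bdry = (\<lambda>i b. ext_scalars \<psi> (bdry F i b))\<rparr>"

lemma algebra_hom_0: "algebra_hom \<psi> \<Longrightarrow> \<psi> 0 = 0"
  unfolding algebra_hom_def by (metis add_cancel_left_left add.right_neutral)

lemma lookup_smult [simp]: "Poly_Mapping.lookup (smult p f) b = p * Poly_Mapping.lookup f b"
  by (simp add: smult_def map.rep_eq when_def)

lemma module_smult: "module (smult :: 'a::comm_ring_1 \<Rightarrow> ('b \<Rightarrow>\<^sub>0 'a) \<Rightarrow> _)"
  by (unfold_locales; rule poly_mapping_eqI; simp add: lookup_add algebra_simps)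

lemma lookup_ext_scalars: "algebra_hom \<psi> \<Longrightarrow> Poly_Mapping.lookup (ext_scalars \<psi> f) b = \<psi> (Poly_Mapping.lookup f b)"
  by (simp add: ext_scalars_def map.rep_eq when_def algebra_hom_0)

lemma ext_scalars_add:
  "algebra_hom \<psi> \<Longrightarrow> ext_scalars \<psi> (f + g) = ext_scalars \<psi> f + ext_scalars \<psi> g"
  by (rule poly_mapping_eqI) (simp add: lookup_ext_scalars lookup_add algebra_hom_def)

lemma ext_scalars_smult:
  "algebra_hom \<psi> \<Longrightarrow> ext_scalars \<psi> (smult p f) = smult (\<psi> p) (ext_scalars \<psi> f)"
  by (rule poly_mapping_eqI) (simp add: lookup_ext_scalars algebra_hom_def)

lemma keys_ext_scalars: "algebra_hom \<psi> \<Longrightarrow> Poly_Mapping.keys (ext_scalars \<psi> f) \<subseteq> Poly_Mapping.keys f"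
  by (auto simp: in_keys_iff lookup_ext_scalars algebra_hom_0)

lemma ext_scalars_sum:
  assumes "algebra_hom \<psi>"
  shows "ext_scalars \<psi> (sum h A) = (\<Sum>a\<in>A. ext_scalars \<psi> (h a))"
proof -
  have "ext_scalars \<psi> 0 = 0" by (simp add: ext_scalars_def poly_mapping_eqI map.rep_eq)
  then show ?thesis
    by (induction A rule: infinite_finite_induct) (simp_all add: ext_scalars_add[OF assms])
qed

lemma hom_of_mono:
  assumes "module sc" "finite A" "Poly_Mapping.keys f \<subseteq> A"
  shows "hom_of sc img f = (\<Sum>b\<in>A. sc (Poly_Mapping.lookup f b) (img b))"
  unfolding hom_of_def using assms
  by (intro sum.mono_neutral_left) (auto simp: in_keys_iff module.scale_zero_left)

lemma hom_of_add:
  assumes "module sc"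
  shows "hom_of sc img (f + g) = hom_of sc img f + hom_of sc img g"
proof -
  have "Poly_Mapping.keys (f + g) \<subseteq> Poly_Mapping.keys f \<union> Poly_Mapping.keys g" by (rule Poly_Mapping.keys_add)
  then show ?thesis
    by (simp add: hom_of_mono[OF assms, of "Poly_Mapping.keys f \<union> Poly_Mapping.keys g"] lookup_add
        module.scale_left_distrib[OF assms] sum.distrib)
qed

lemma hom_of_smult:
  assumes "module sc"
  shows "hom_of sc img (smult p f) = sc p (hom_of sc img f)"
proof -
  have "Poly_Mapping.keys (smult p f) \<subseteq> Poly_Mapping.keys f" by (auto simp: in_keys_iff)
  then show ?thesis
    by (simp add: hom_of_mono[OF assms, of "Poly_Mapping.keys f"] module.scale_sum_right[OF assms]
        module.scale_scale[OF assms])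
qed

lemma free_module_add: "f \<in> free_module B \<Longrightarrow> g \<in> free_module B \<Longrightarrow> f + g \<in> free_module B"
  unfolding free_module_def using Poly_Mapping.keys_add[of f g] by auto

lemma hom_of_unique:
  assumes "module sc"
    and add: "\<And>f g. f \<in> free_module B \<Longrightarrow> g \<in> free_module B \<Longrightarrow> h (f + g) = h f + h g"
    and scale: "\<And>p f. f \<in> free_module B \<Longrightarrow> h (smult p f) = sc p (h f)"
    and f: "f \<in> free_module B"
  shows "h f = hom_of sc (\<lambda>b. h (Poly_Mapping.single b 1)) f"
proof -
  have 0: "h 0 = 0" using add[of 0 0] by (simp add: free_module_def)
  have *: "h (\<Sum>b\<in>A. smult (Poly_Mapping.lookup f b) (Poly_Mapping.single b 1)) =
      (\<Sum>b\<in>A. sc (Poly_Mapping.lookup f b) (h (Poly_Mapping.single b 1))) \<and>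
      (\<Sum>b\<in>A. smult (Poly_Mapping.lookup f b) (Poly_Mapping.single b 1)) \<in> free_module B"
    if "finite A" "A \<subseteq> B" for A
    using that
  proof induction
    case empty then show ?case by (simp add: 0 free_module_def)
  next
    case (insert b A)
    have 1: "Poly_Mapping.single b 1 \<in> free_module B"
      using insert.prems by (auto simp: free_module_def)
    have 2: "smult (Poly_Mapping.lookup f b) (Poly_Mapping.single b 1) \<in> free_module B"
      using insert.prems by (auto simp: free_module_def in_keys_iff lookup_single when_def split: if_splits)
    let ?S = "\<Sum>b\<in>A. smult (Poly_Mapping.lookup f b) (Poly_Mapping.single b 1)"
    have 3: "?S \<in> free_module B" using insert by blast
    have 4: "smult (Poly_Mapping.lookup f b) (Poly_Mapping.single b 1) + ?S \<in> free_module B"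
      by (rule free_module_add[OF 2 3])
    have 5: "h (smult (Poly_Mapping.lookup f b) (Poly_Mapping.single b 1) + ?S) =
        sc (Poly_Mapping.lookup f b) (h (Poly_Mapping.single b 1)) + h ?S"
      by (simp only: add[OF 2 3] scale[OF 1])
    show ?case using insert 4 5 by simp
  qed
  have "f = (\<Sum>b\<in>Poly_Mapping.keys f. smult (Poly_Mapping.lookup f b) (Poly_Mapping.single b 1))"
    by (rule poly_mapping_eqI)
      (simp add: lookup_sum lookup_single when_def in_keys_iff if_distrib cong: if_cong)
  then show ?thesis using *[of "Poly_Mapping.keys f"] f by (simp add: free_module_def hom_of_def)
qed

lemma ext_scalars_universal:
  fixes sc :: "('x, 'k::comm_ring_1) mpoly \<Rightarrow> 'c \<Rightarrow> 'c::ab_group_add"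
    and \<psi> :: "('z, 'k) mpoly \<Rightarrow> ('x, 'k) mpoly"
  assumes \<psi>: "algebra_hom \<psi>" and sc: "module sc"
    and add: "\<And>f g. f \<in> free_module B \<Longrightarrow> g \<in> free_module B \<Longrightarrow> h (f + g) = h f + h g"
    and scale: "\<And>p f. f \<in> free_module B \<Longrightarrow> h (smult p f) = sc (\<psi> p) (h f)"
  shows "\<exists>H. module_hom smult sc H \<and> (\<forall>f\<in>free_module B. H (ext_scalars \<psi> f) = h f) \<and>
    (\<forall>H'. module_hom smult sc H' \<and> (\<forall>f\<in>free_module B. H' (ext_scalars \<psi> f) = h f) \<longrightarrow>
       (\<forall>f\<in>free_module B. H' f = H f))"
proof -
  define H where "H = hom_of sc (\<lambda>b. h (Poly_Mapping.single b 1))"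
  have one: "\<psi> 1 = 1" "\<psi> 0 = 0"
    using \<psi> algebra_hom_0 by (auto simp: algebra_hom_def)
  have single: "ext_scalars \<psi> (Poly_Mapping.single b 1) = Poly_Mapping.single b 1" for b :: 'b
    by (rule poly_mapping_eqI) (simp add: lookup_ext_scalars[OF \<psi>] lookup_single when_def one)
  have mod\<psi>: "module (\<lambda>p. sc (\<psi> p))"
    using sc \<psi> unfolding module_def algebra_hom_def by auto
  have "module_hom smult sc H"
    unfolding module_hom_def module_hom_axioms_def H_def
    by (auto simp: sc module_smult hom_of_add[OF sc] hom_of_smult[OF sc])
  moreover have "H (ext_scalars \<psi> f) = h f" if f: "f \<in> free_module B" for f
  proof -
    have "h f = hom_of (\<lambda>p. sc (\<psi> p)) (\<lambda>b. h (Poly_Mapping.single b 1)) f"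
      by (rule hom_of_unique[where h = h, OF mod\<psi> _ _ f]) (simp_all only: add scale)
    also have "\<dots> = H (ext_scalars \<psi> f)"
      unfolding H_def
      by (subst hom_of_mono[OF sc finite_keys keys_ext_scalars[OF \<psi>]])
         (simp add: hom_of_def lookup_ext_scalars[OF \<psi>])
    finally show ?thesis by simp
  qed
  moreover have "H' f = H f" if H': "module_hom smult sc H'"
      "\<forall>f\<in>free_module B. H' (ext_scalars \<psi> f) = h f" and f: "f \<in> free_module B" for H' f
  proof -
    have "H' f = hom_of sc (\<lambda>b. H' (Poly_Mapping.single b 1)) f"
      by (rule hom_of_unique[OF sc _ _ f]) (auto simp: module_hom.add[OF H'(1)] module_hom.scale[OF H'(1)])
    also have "\<dots> = H f"
      unfolding H_def hom_of_def
    proof (rule sum.cong)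
      fix b assume "b \<in> Poly_Mapping.keys f"
      then have "Poly_Mapping.single b (1 :: ('z, 'k) mpoly) \<in> free_module B"
        using f by (auto simp: free_module_def)
      then show "sc (Poly_Mapping.lookup f b) (H' (Poly_Mapping.single b 1)) = sc (Poly_Mapping.lookup f b) (h (Poly_Mapping.single b 1))"
        using H'(2) single by metis
    qed simp
    finally show ?thesis .
  qed
  ultimately show ?thesis by blast
qed

lemma dmap_base_change:
  assumes "algebra_hom \<psi>"
  shows "dmap (base_change \<psi> F) i (ext_scalars \<psi> f) = ext_scalars \<psi> (dmap F i f)"
proof -
  have "dmap (base_change \<psi> F) i (ext_scalars \<psi> f) =
      (\<Sum>b\<in>Poly_Mapping.keys f. smult (Poly_Mapping.lookup (ext_scalars \<psi> f) b) (bdry (base_change \<psi> F) i b))"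
    unfolding dmap_def
    by (rule hom_of_mono[OF module_smult finite_keys keys_ext_scalars[OF assms]])
  also have "\<dots> = (\<Sum>b\<in>Poly_Mapping.keys f. ext_scalars \<psi> (smult (Poly_Mapping.lookup f b) (bdry F i b)))"
    by (simp only: lookup_ext_scalars[OF assms] ext_scalars_smult[OF assms] base_change_def
        free_complex.simps)
  also have "\<dots> = ext_scalars \<psi> (dmap F i f)"
    unfolding dmap_def hom_of_def by (rule ext_scalars_sum[OF assms, symmetric])
  finally show ?thesis .
qed

text \<open>
  The conjuncts: base change of resolutions, the multigraded Betti number bound and the total Betti
  number bound. The resolutions \<open>F\<close> have arbitrary subsets of the arbitrary type \<open>'b\<close> as bases.
\<close>

definition resolution_and_betti_statements ::
    "'b itself \<Rightarrow> (('z, 'k::field) mpoly \<Rightarrow> ('x, 'k) mpoly) \<Rightarrow> ('z, 'k) mpoly set \<Rightarrow> ('x, 'k) mpoly set \<Rightarrow> bool"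
  where "resolution_and_betti_statements _ \<psi> \<J> J \<longleftrightarrow>
    (\<forall>F :: ('b, 'z, 'z \<Rightarrow>\<^sub>0 int, 'k) free_complex.
       multigraded_free_resolution \<J> F \<longrightarrow>
       multigraded_free_resolution J (base_change \<psi> (regrade (induced_deg \<psi>) F))) \<and>
    (\<forall>m\<in>LCM_lattice J. \<forall>i.
       multigraded_betti i m J
         \<le> (\<Sum>u | u \<in> LCM_lattice \<J> \<and> \<psi> (monom u) = monom m. multigraded_betti i u \<J>)) \<and>
    (\<forall>i. betti i J \<le> betti i \<J>)"


section \<open>Extremal ideals\<close>

text \<open>The nonempty subsets of \<open>[q]\<close>, where \<open>[q]\<close> is represented by a finite type \<open>'q\<close> with \<open>q\<close> elements.\<close>

typedef 'q nonempty_subset = "{A :: 'q set. A \<noteq> {}}"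
  by auto

instance nonempty_subset :: (finite) finite
proof
  have "range (Rep_nonempty_subset :: 'a nonempty_subset \<Rightarrow> _) \<subseteq> UNIV" by simp
  then have "finite (range (Rep_nonempty_subset :: 'a nonempty_subset \<Rightarrow> _))"
    by (rule finite_subset) simp
  then show "finite (UNIV :: 'a nonempty_subset set)"
    by (rule finite_imageD) (simp add: inj_on_def Rep_nonempty_subset_inject)
qed

definition extremal_ideal :: "('q::finite nonempty_subset, 'k::comm_ring_1) mpoly set" where
  "extremal_ideal = ideal.span (range (\<lambda>i. \<Prod>A | i \<in> Rep_nonempty_subset A. Var A))"

text \<open>\<open>\<psi>\<close> is the algebra homomorphism \<open>\<psi>\<^sub>I\<close> for the monomial ideal \<open>I\<close> with minimal generators
  \<open>m j\<close>, \<open>j \<in> [q]\<close>. The variable \<open>x\<^sub>k\<close> divides \<open>m j\<close> iff its exponent there is positive.\<close>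

definition is_psi :: "('q::finite \<Rightarrow> 'x::finite monom) \<Rightarrow>
    (('q nonempty_subset, 'k::comm_ring_1) mpoly \<Rightarrow> ('x, 'k) mpoly) \<Rightarrow> bool"
  where "is_psi m \<psi> \<longleftrightarrow> algebra_hom \<psi> \<and>
    (\<forall>A. \<psi> (Var A) =
       (\<Prod>k | \<forall>j. Poly_Mapping.lookup (m j) k > 0 \<longleftrightarrow> j \<in> Rep_nonempty_subset A. Var k))"

end

theory Submission
  imports Defs
begin

text \<open>
  Let \<open>D\<close> be the additive map on exponent vectors with \<open>\<psi> (monom a) = monom (D a)\<close>, and let \<open>L\<close> be the
  set of lcms of nonempty subsets of the generators \<open>U\<close> of \<open>\<J>\<close>.

  The first half rests on one special resolution \<open>T\<close> of \<open>\<J>\<close>, whose basis elements all have degrees in \<open>L\<close>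
  (lemma \<open>monomial_resolution\<close>). Once the degrees \<open>deg b \<in> L\<close> are known, such a complex is a matter of linear
  algebra over the field: the entry of the differential at \<open>b, b'\<close> is a scalar times
  \<open>monom (deg b - deg b')\<close>, and the part of the complex in multidegree \<open>e\<close> has the basis
  \<open>{b. deg b \<unlhd> e}\<close>. The set \<open>{l \<in> L. l \<unlhd> e}\<close> is empty or has a largest element, so exactness only has to
  be arranged at the finitely many \<open>l \<in> L\<close>; this is done step by step by choosing generators of the kernels
  (lemma \<open>frame_step\<close>), and choosing them economically makes \<open>T\<close> minimal. After base change along \<open>\<psi>\<close> the
  scalars are the same and only \<open>deg b\<close> is replaced by \<open>D (deg b)\<close>. The lcm condition says precisely that
  \<open>{l \<in> L. D l \<unlhd> e}\<close> still is empty or has a largest element (lemma \<open>lcm_closed_max\<close>), so the base change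
  of \<open>T\<close> is a resolution of \<open>J\<close> (lemma \<open>exact_res_frame_complex\<close>).

  An arbitrary resolution \<open>F\<close> of \<open>\<J>\<close> is homotopy equivalent to \<open>T\<close>, the matrices of the chain maps
  and of the homotopy can be pushed through \<open>\<psi>\<close>, and exactness transfers from \<open>T\<close> to \<open>F\<close> (lemma
  \<open>exact_res_base_change_transfer\<close>). The same comparison, read modulo the ideal of the variables,
  shows that a minimal resolution has in each degree at most as many basis elements as any other finite
  resolution (lemma \<open>minimal_rank_le\<close>). So Betti numbers can be read off from any minimal resolution, and
  comparing a minimal resolution of \<open>J\<close> with the base change of \<open>T\<close> gives both inequalities.

  In the extremal case \<open>\<psi>\<close> sends distinct variables to products of disjoint sets of variables, so \<open>D\<close> copies
  exponents and preserves all lcms. It remains to find monomial generators \<open>G\<close> and \<open>H\<close> of the two ideals in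
  each case and to match them: \<open>D\<close> has to map \<open>G\<close> into \<open>H\<close>, and each element of \<open>H\<close> has to be divisible by one
  of \<open>D ` G\<close> (lemma \<open>monomial_pair_statements\<close>). For powers, \<open>G\<close> and \<open>H\<close> consist of the \<open>r\<close>-fold products of
  generators. The integral closure of a monomial ideal \<open>N\<close> is spanned by the monomials some power of which, say the
  \<open>n\<close>-th, lies in \<open>N ^ n\<close> (theorem \<open>integral_closure_monomial\<close>), and a preimage exponent is
  found by rounding up. The \<open>r\<close>-th symbolic power of a squarefree monomial ideal is spanned by the monomials whose
  degree on each vertex cover of the generators is at least \<open>r\<close> (theorem \<open>symbolic_power_monomial\<close>), and a preimage
  exponent is the minimum of the given exponents on a fibre.
\<close>

section \<open>Monomials and monomial ideals\<close>

abbreviation "lookup \<equiv> Poly_Mapping.lookup"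
abbreviation "keys \<equiv> Poly_Mapping.keys"
abbreviation "single \<equiv> Poly_Mapping.single"

text \<open>
  Divisibility of monomials, read on exponent vectors.
\<close>

definition mdvd :: "'v monom \<Rightarrow> 'v monom \<Rightarrow> bool" (infix "\<unlhd>" 50) where
  "a \<unlhd> b \<longleftrightarrow> (\<forall>v. lookup a v \<le> lookup b v)"

lemma mdvd_refl [simp]: "a \<unlhd> a"
  by (simp add: mdvd_def)

lemma mdvd_trans [trans]: "a \<unlhd> b \<Longrightarrow> b \<unlhd> c \<Longrightarrow> a \<unlhd> c"
  unfolding mdvd_def by (meson order_trans)

lemma mdvd_antisym: "a \<unlhd> b \<Longrightarrow> b \<unlhd> a \<Longrightarrow> a = b"
  unfolding mdvd_def by (intro poly_mapping_eqI) (meson antisym)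

lemma mdvd_add: "a \<unlhd> b \<Longrightarrow> c \<unlhd> d \<Longrightarrow> a + c \<unlhd> b + d"
  unfolding mdvd_def by (simp add: lookup_add add_mono)

lemma mdvd_add_right [simp]: "a \<unlhd> a + b" "b \<unlhd> a + b"
  unfolding mdvd_def by (simp_all add: lookup_add)

lemma zero_mdvd [simp]: "0 \<unlhd> a"
  by (simp add: mdvd_def)

lemma mdvd_diff: "a \<unlhd> b \<Longrightarrow> a + (b - a) = b" "a \<unlhd> b \<Longrightarrow> b - a + a = b"
  unfolding mdvd_def by (auto intro!: poly_mapping_eqI simp: lookup_add lookup_minus)

lemma mdvd_iff: "a \<unlhd> b \<longleftrightarrow> (\<exists>c. b = a + c)"
  using mdvd_diff(1) mdvd_add_right(1) by metis

lemma mdvd_cancel: "a + c \<unlhd> b + c \<longleftrightarrow> a \<unlhd> b"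
  unfolding mdvd_def by (simp add: lookup_add)

lemma lookup_mlcm:
  assumes "finite A"
  shows "lookup (mlcm A) (v :: 'v::finite) = Max (insert 0 ((\<lambda>m. lookup m v) ` A))"
  unfolding mlcm_def by (subst lookup_Abs_poly_mapping) auto

lemma mlcm_mdvd_iff:
  "finite A \<Longrightarrow> mlcm A \<unlhd> (b :: 'v::finite monom) \<longleftrightarrow> (\<forall>a\<in>A. a \<unlhd> b)"
  unfolding mdvd_def by (auto simp: lookup_mlcm)

lemma mdvd_mlcm: "finite A \<Longrightarrow> a \<in> A \<Longrightarrow> a \<unlhd> mlcm (A :: 'v::finite monom set)"
  using mlcm_mdvd_iff mdvd_refl by blast

lemma poly_mapping_sum_single:
  fixes p :: "'a \<Rightarrow>\<^sub>0 'b::comm_monoid_add"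
  assumes "finite A" "keys p \<subseteq> A"
  shows "p = (\<Sum>a\<in>A. single a (lookup p a))"
  using assms by (intro poly_mapping_eqI) (auto simp: lookup_sum lookup_single when_def in_keys_iff)

lemma poly_mapping_single_induct [case_names zero single add]:
  fixes p :: "'a \<Rightarrow>\<^sub>0 'b::comm_monoid_add"
  assumes "P 0" and s: "\<And>a c. P (single a c)" and a: "\<And>p q. P p \<Longrightarrow> P q \<Longrightarrow> P (p + q)"
  shows "P p"
proof -
  have "P (\<Sum>a\<in>A. single a (lookup p a))" if "finite A" for A
    using that by induction (simp_all add: \<open>P 0\<close> s a)
  from this[of "keys p"] show ?thesis
    using poly_mapping_sum_single[of "keys p" p] by simp
qed

lemma lookup_times:
  fixes p q :: "('v, 'k::comm_ring_1) mpoly"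
  assumes "finite A" "finite B" "keys p \<subseteq> A" "keys q \<subseteq> B"
  shows "lookup (p * q) m = (\<Sum>a\<in>A. \<Sum>b\<in>B. if a + b = m then lookup p a * lookup q b else 0)"
proof -
  have "p * q = (\<Sum>a\<in>A. single a (lookup p a)) * (\<Sum>b\<in>B. single b (lookup q b))"
    using assms poly_mapping_sum_single by metis
  also have "\<dots> = (\<Sum>a\<in>A. \<Sum>b\<in>B. single (a + b) (lookup p a * lookup q b))"
    by (simp add: sum_product mult_single)
  finally show ?thesis
    by (simp add: lookup_sum lookup_single when_def)
qed

lemma lookup_times_single:
  fixes p :: "('v, 'k::comm_ring_1) mpoly"
  shows "lookup (p * single a c) m = (if a \<unlhd> m then lookup p (m - a) * c else 0)"
proof -
  have "lookup (p * single a c) m = (\<Sum>x\<in>keys p. if x + a = m then lookup p x * c else 0)"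
    by (subst lookup_times[of "keys p" "{a}"]) (simp_all cong: if_cong)
  also have "\<dots> = (if a \<unlhd> m then lookup p (m - a) * c else 0)"
  proof (cases "a \<unlhd> m")
    case True
    then have "x + a = m \<longleftrightarrow> x = m - a" for x
      by (metis add_diff_cancel_right' mdvd_diff(2))
    then show ?thesis
      using True by (auto simp: in_keys_iff)
  next
    case False
    then have "x + a \<noteq> m" for x by auto
    then show ?thesis using False by simp
  qed
  finally show ?thesis .
qed

text \<open>
  Taking constant coefficients is a ring homomorphism; this is reduction modulo the ideal of the variables.
\<close>

lemma lookup_times_0:
  fixes p q :: "('v, 'k::comm_ring_1) mpoly"
  shows "lookup (p * q) 0 = lookup p 0 * lookup q 0"
proof (induction q rule: poly_mapping_single_induct)
  case (single a c)
  have "a \<unlhd> 0 \<longleftrightarrow> a = 0" using mdvd_antisym zero_mdvd by blast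
  then show ?case by (auto simp: lookup_times_single lookup_single when_def)
qed (simp_all add: lookup_add algebra_simps)

lemma monom_eq_iff [simp]: "monom a = (monom b :: ('v, 'k::{comm_ring_1,zero_neq_one}) mpoly) \<longleftrightarrow> a = b"
  unfolding monom_def by (metis lookup_single_eq lookup_single_not_eq zero_neq_one)

lemma monom_add: "monom (a + b) = monom a * monom b"
  by (simp add: monom_def mult_single)

lemma monom_zero [simp]: "monom 0 = 1"
  by (simp add: monom_def)

lemma keys_monom [simp]: "keys (monom a :: ('v, 'k::{comm_ring_1,zero_neq_one}) mpoly) = {a}"
  by (simp add: monom_def)

lemma keys_times: "a \<in> keys (p * q) \<Longrightarrow> \<exists>x\<in>keys p. \<exists>y\<in>keys q. a = x + y"
  for p q :: "('v, 'k::comm_ring_1) mpoly"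
  using keys_mult[of p q] by blast

text \<open>
  Membership in a monomial ideal is decided monomial by monomial. All later ideal computations use this
  description.
\<close>

lemma span_monom:
  "ideal.span (monom ` U) = {f :: ('v, 'k::comm_ring_1) mpoly. \<forall>m\<in>keys f. \<exists>u\<in>U. u \<unlhd> m}"
proof (intro equalityI)
  show "ideal.span (monom ` U) \<subseteq> {f :: ('v, 'k::comm_ring_1) mpoly. \<forall>m\<in>keys f. \<exists>u\<in>U. u \<unlhd> m}"
  proof (rule ideal.span_minimal)
    show "ideal.subspace {f :: ('v, 'k) mpoly. \<forall>m\<in>keys f. \<exists>u\<in>U. u \<unlhd> m}"
    proof (rule ideal.subspaceI)
      fix x y :: "('v, 'k) mpoly"
      assume "x \<in> {f. \<forall>m\<in>keys f. \<exists>u\<in>U. u \<unlhd> m}" "y \<in> {f. \<forall>m\<in>keys f. \<exists>u\<in>U. u \<unlhd> m}"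
      then show "x + y \<in> {f. \<forall>m\<in>keys f. \<exists>u\<in>U. u \<unlhd> m}"
        using Poly_Mapping.keys_add[of x y] by blast
    next
      fix c x :: "('v, 'k) mpoly"
      assume x: "x \<in> {f. \<forall>m\<in>keys f. \<exists>u\<in>U. u \<unlhd> m}"
      show "c * x \<in> {f. \<forall>m\<in>keys f. \<exists>u\<in>U. u \<unlhd> m}"
      proof (clarify)
        fix m assume "m \<in> keys (c * x)"
        then obtain a b where "b \<in> keys x" "m = a + b" using keys_times by blast
        then show "\<exists>u\<in>U. u \<unlhd> m" using x mdvd_trans mdvd_add_right(2) by blast
      qed
    qed simp
    show "monom ` U \<subseteq> {f :: ('v, 'k) mpoly. \<forall>m\<in>keys f. \<exists>u\<in>U. u \<unlhd> m}"
    proof (rule image_subsetI, clarify)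
      fix u m assume "u \<in> U" "m \<in> keys (monom u :: ('v, 'k) mpoly)"
      then have "m = u" by (simp add: monom_def split: if_splits)
      then show "\<exists>u\<in>U. u \<unlhd> m" using \<open>u \<in> U\<close> mdvd_refl by blast
    qed
  qed
  show "{f :: ('v, 'k) mpoly. \<forall>m\<in>keys f. \<exists>u\<in>U. u \<unlhd> m} \<subseteq> ideal.span (monom ` U)"
  proof
    fix f :: "('v, 'k) mpoly" assume "f \<in> {f. \<forall>m\<in>keys f. \<exists>u\<in>U. u \<unlhd> m}"
    then have f: "\<exists>u\<in>U. u \<unlhd> m" if "m \<in> keys f" for m using that by blast
    have "single m (lookup f m) \<in> ideal.span (monom ` U)" if m: "m \<in> keys f" for m
    proof -
      obtain u where u: "u \<in> U" "u \<unlhd> m" using f[OF m] by blast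
      have "single m (lookup f m) = single (m - u) (lookup f m) * monom u"
        by (simp only: monom_def mult_single mdvd_diff(2)[OF u(2)] mult_1_right)
      then show ?thesis
        using ideal.span_scale[OF ideal.span_base[OF imageI[OF u(1)]]] by simp
    qed
    then have "(\<Sum>m\<in>keys f. single m (lookup f m)) \<in> ideal.span (monom ` U)"
      by (rule ideal.span_sum)
    then show "f \<in> ideal.span (monom ` U)"
      by (simp add: poly_mapping_sum_single[of "keys f" f, symmetric])
  qed
qed

section \<open>Linear maps on free modules\<close>

lemma hom_of_single:
  assumes "module sc" shows "hom_of sc img (single b 1) = img b"
proof -
  have "hom_of sc img (single b 1) = (\<Sum>b'\<in>{b}. sc (lookup (single b 1) b') (img b'))"
    by (rule hom_of_mono[OF assms]) auto
  then show ?thesis by (simp add: module.scale_one[OF assms])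
qed

lemma hom_of_zero [simp]: "hom_of sc img 0 = 0"
  by (simp add: hom_of_def)

lemma hom_of_sum: "module sc \<Longrightarrow> hom_of sc img (sum h A) = (\<Sum>a\<in>A. hom_of sc img (h a))"
  by (induction A rule: infinite_finite_induct) (simp_all add: hom_of_add)

lemma module_times: "module ((*) :: 'a::comm_ring_1 \<Rightarrow> 'a \<Rightarrow> 'a)"
  by (fact ideal.module_axioms)

lemma hom_of_diff:
  assumes "module sc" shows "hom_of sc img (f - g) = hom_of sc img f - hom_of sc img g"
  using hom_of_add[OF assms, of img "f - g" g] by simp

lemma hom_of_cong:
  "(\<And>b. b \<in> keys f \<Longrightarrow> img b = img' b) \<Longrightarrow> hom_of sc img f = hom_of sc img' f"
  by (simp add: hom_of_def)

lemma hom_of_img_diff: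
  assumes "module sc"
  shows "hom_of sc (\<lambda>b. img b - img' b) f = hom_of sc img f - hom_of sc img' f"
  by (simp add: hom_of_def module.scale_right_diff_distrib[OF assms] sum_subtractf)

lemma hom_of_hom_of:
  assumes "module sc"
  shows "hom_of sc img' (hom_of smult img f) = hom_of sc (\<lambda>b. hom_of sc img' (img b)) f"
  unfolding hom_of_def[of smult img]
  by (simp add: hom_of_sum[OF assms] hom_of_smult[OF assms]) (simp add: hom_of_def)

lemma smult_single: "smult c (single b d) = single b (c * d)"
  by (rule poly_mapping_eqI) (simp add: lookup_single when_def)

lemma hom_of_single_id: "hom_of smult (\<lambda>b. single b 1) f = f"
  using poly_mapping_sum_single[of "keys f" f] by (simp add: hom_of_def smult_single)

lemma lookup_hom_of:
  "lookup (hom_of smult img f) c = (\<Sum>b\<in>keys f. lookup f b * lookup (img b) c)"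
  by (simp add: hom_of_def lookup_sum)

lemma free_module_sum: "(\<And>a. a \<in> A \<Longrightarrow> h a \<in> free_module B) \<Longrightarrow> sum h A \<in> free_module B"
  by (induction A rule: infinite_finite_induct) (auto simp: free_module_add, auto simp: free_module_def)

lemma keys_smult: "keys (smult p f) \<subseteq> keys f"
  by (auto simp: in_keys_iff)

lemma free_module_smult: "f \<in> free_module B \<Longrightarrow> smult p f \<in> free_module B"
  using keys_smult[of p f] unfolding free_module_def by blast

lemma free_module_uminus: "f \<in> free_module B \<Longrightarrow> - f \<in> free_module B"
  unfolding free_module_def by (simp add: subset_iff in_keys_iff)

lemma free_module_diff: "f \<in> free_module B \<Longrightarrow> g \<in> free_module B \<Longrightarrow> f - g \<in> free_module B"
  using free_module_add[OF _ free_module_uminus] by (metis add_uminus_conv_diff)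

lemma free_module_zero [simp]: "0 \<in> free_module B"
  by (simp add: free_module_def)

lemma free_module_single: "b \<in> B \<Longrightarrow> single b c \<in> free_module B"
  by (simp add: free_module_def)

lemma hom_of_free_module:
  assumes "f \<in> free_module B" "\<And>b. b \<in> B \<Longrightarrow> img b \<in> free_module C"
  shows "hom_of smult img f \<in> free_module C"
  unfolding hom_of_def using assms
  by (intro free_module_sum free_module_smult) (auto simp: free_module_def)

text \<open>
  Used both for the image of the augmentation, as an ideal, and for images of linear maps over the field.
\<close>

lemma hom_of_image_span:
  assumes "module (sc :: 'a::comm_ring_1 \<Rightarrow> 'c \<Rightarrow> 'c::ab_group_add)"
  shows "hom_of sc img ` free_module B = module.span sc (img ` B)"
proof (intro equalityI)
  show "hom_of sc img ` free_module B \<subseteq> module.span sc (img ` B)"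
  proof (rule image_subsetI)
    fix f :: "'b \<Rightarrow>\<^sub>0 'a" assume "f \<in> free_module B"
    then show "hom_of sc img f \<in> module.span sc (img ` B)"
      unfolding hom_of_def free_module_def
      by (intro module.span_sum[OF assms] module.span_scale[OF assms] module.span_base[OF assms]) auto
  qed
  show "module.span sc (img ` B) \<subseteq> hom_of sc img ` free_module B"
  proof (rule module.span_minimal[OF assms])
    show "img ` B \<subseteq> hom_of sc img ` free_module B"
      using hom_of_single[OF assms, of img] free_module_single by (metis image_eqI image_subsetI)
    show "module.subspace sc (hom_of sc img ` free_module B)"
    proof (rule module.subspaceI[OF assms])
      show "0 \<in> hom_of sc img ` free_module B"
        using free_module_zero hom_of_zero by (metis image_eqI)
    next
      fix x y assume "x \<in> hom_of sc img ` free_module B" "y \<in> hom_of sc img ` free_module B"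
      then show "x + y \<in> hom_of sc img ` free_module B"
        using hom_of_add[OF assms] free_module_add by (smt (verit) image_iff)
    next
      fix c x assume "x \<in> hom_of sc img ` free_module B"
      then show "sc c x \<in> hom_of sc img ` free_module B"
        using hom_of_smult[OF assms] free_module_smult by (smt (verit) image_iff)
    qed
  qed
qed

lemma ext_scalars_hom_of:
  assumes "algebra_hom \<psi>"
  shows "ext_scalars \<psi> (hom_of smult img f) = hom_of smult (\<lambda>b. ext_scalars \<psi> (img b)) (ext_scalars \<psi> f)"
proof -
  have "hom_of smult (\<lambda>b. ext_scalars \<psi> (img b)) (ext_scalars \<psi> f) =
      (\<Sum>b\<in>keys f. smult (\<psi> (lookup f b)) (ext_scalars \<psi> (img b)))"
    by (subst hom_of_mono[OF module_smult finite_keys keys_ext_scalars[OF assms]])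
      (simp add: lookup_ext_scalars[OF assms])
  then show ?thesis
    by (simp add: hom_of_def ext_scalars_sum[OF assms] ext_scalars_smult[OF assms])
qed

lemma algebra_hom_sum:
  assumes "algebra_hom \<psi>" shows "\<psi> (sum h A) = (\<Sum>a\<in>A. \<psi> (h a))"
  using assms by (induction A rule: infinite_finite_induct) (auto simp: algebra_hom_0 algebra_hom_def)

lemma hom_of_ext_scalars:
  assumes "algebra_hom \<psi>"
  shows "\<psi> (hom_of (*) img f) = hom_of (*) (\<lambda>b. \<psi> (img b)) (ext_scalars \<psi> f)"
proof -
  have "hom_of (*) (\<lambda>b. \<psi> (img b)) (ext_scalars \<psi> f) = (\<Sum>b\<in>keys f. \<psi> (lookup f b) * \<psi> (img b))"
    by (subst hom_of_mono[OF module_times finite_keys keys_ext_scalars[OF assms]])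
      (simp add: lookup_ext_scalars[OF assms])
  then show ?thesis
    using assms by (simp add: hom_of_def algebra_hom_sum algebra_hom_def)
qed

lemma ext_scalars_free_module: 
  "algebra_hom \<psi> \<Longrightarrow> f \<in> free_module B \<Longrightarrow> ext_scalars \<psi> f \<in> free_module B"
  using keys_ext_scalars[of \<psi> f] unfolding free_module_def by blast

section \<open>Resolutions and homogeneous elements\<close>

text \<open>
  The module of cycles in degree \<open>i\<close>; in degree \<open>0\<close> the augmentation takes the place of the differential. With
  this convention exactness is one formula in all degrees.
\<close>

definition cycles :: "('b, 'v, 'g, 'k::comm_ring_1) free_complex \<Rightarrow> ('b \<Rightarrow> ('v, 'k) mpoly) \<Rightarrow> nat \<Rightarrow>
    ('b \<Rightarrow>\<^sub>0 ('v, 'k) mpoly) set" where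
  "cycles F e i = {f \<in> Fmod F i. if i = 0 then hom_of (*) e f = 0 else dmap F i f = 0}"

text \<open>
  A resolution with its augmentation \<open>e\<close> made explicit and the grading left aside: base change and homotopies
  only concern this part.
\<close>

definition exact_res :: "('v, 'k::comm_ring_1) mpoly set \<Rightarrow> ('b, 'v, 'g, 'k) free_complex \<Rightarrow>
    ('b \<Rightarrow> ('v, 'k) mpoly) \<Rightarrow> bool" where
  "exact_res J F e \<longleftrightarrow> (\<forall>i. \<forall>b\<in>basis F (Suc i). bdry F (Suc i) b \<in> Fmod F i) \<and>
     hom_of (*) e ` Fmod F 0 = J \<and> (\<forall>i. dmap F (Suc i) ` Fmod F (Suc i) = cycles F e i)"

text \<open>
  By linearity it suffices that the images of the basis elements are homogeneous of the right degree.
\<close>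

definition graded_at :: "('v monom \<Rightarrow> 'g::ab_group_add) \<Rightarrow> ('b, 'v, 'g, 'k::comm_ring_1) free_complex \<Rightarrow>
    ('b \<Rightarrow> ('v, 'k) mpoly) \<Rightarrow> bool" where
  "graded_at wt F e \<longleftrightarrow> (\<forall>b\<in>basis F 0. homogeneous wt (dgr F 0 b) (e b)) \<and>
     (\<forall>i. \<forall>b\<in>basis F (Suc i). Fhomogeneous wt F i (dgr F (Suc i) b) (bdry F (Suc i) b))"

definition grading :: "('v monom \<Rightarrow> 'g::ab_group_add) \<Rightarrow> bool" where
  "grading wt \<longleftrightarrow> wt 0 = 0 \<and> (\<forall>a b. wt (a + b) = wt a + wt b)"

lemma FmodD: "f \<in> Fmod F i \<Longrightarrow> b \<in> keys f \<Longrightarrow> b \<in> basis F i"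
  unfolding Fmod_def free_module_def by blast

lemma dmap_single: "dmap F i (single b 1) = bdry F i b"
  unfolding dmap_def by (rule hom_of_single[OF module_smult])

lemma Fmod_single: "b \<in> basis F i \<Longrightarrow> single b c \<in> Fmod F i"
  unfolding Fmod_def by (rule free_module_single)

lemma dmap_zero [simp]: "dmap F i 0 = 0"
  by (simp add: dmap_def)

lemma homogeneous_add: "homogeneous wt d p \<Longrightarrow> homogeneous wt d q \<Longrightarrow> homogeneous wt d (p + q)"
  unfolding homogeneous_def using Poly_Mapping.keys_add[of p q] by blast

lemma homogeneous_zero [simp]: "homogeneous wt d 0"
  by (simp add: homogeneous_def)

lemma homogeneous_sum: "(\<And>a. a \<in> A \<Longrightarrow> homogeneous wt d (h a)) \<Longrightarrow> homogeneous wt d (sum h A)"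
  by (induction A rule: infinite_finite_induct) (simp_all add: homogeneous_add)

lemma homogeneous_times:
  assumes "grading wt" "homogeneous wt d p" "homogeneous wt e q"
  shows "homogeneous wt (d + e) (p * q)"
  unfolding homogeneous_def
proof
  fix m assume "m \<in> keys (p * q)"
  then obtain x y where "x \<in> keys p" "y \<in> keys q" "m = x + y" using keys_times by blast
  then show "wt m = d + e" using assms by (simp add: homogeneous_def grading_def)
qed

lemma homogeneous_one: "grading wt \<Longrightarrow> homogeneous wt 0 1"
  by (simp add: homogeneous_def grading_def)

lemma Fhomogeneous_lookup:
  assumes "Fhomogeneous wt F i d f"
  shows "homogeneous wt (d - dgr F i b) (lookup f b)"
proof (cases "b \<in> basis F i")
  case False
  then have "lookup f b = 0"
    using assms FmodD[of f F i b] unfolding Fhomogeneous_def by (auto simp: in_keys_iff)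
  then show ?thesis by simp
qed (use assms in \<open>simp add: Fhomogeneous_def\<close>)

lemma Fhomogeneous_single:
  "grading wt \<Longrightarrow> b \<in> basis F i \<Longrightarrow> Fhomogeneous wt F i (dgr F i b) (single b 1)"
  unfolding Fhomogeneous_def by (auto simp: Fmod_single lookup_single when_def homogeneous_one)

lemma Fhomogeneous_hom_of:
  assumes wt: "grading wt" and f: "Fhomogeneous wt F i d f"
    and img: "\<And>b. b \<in> basis F i \<Longrightarrow> Fhomogeneous wt G j (dgr F i b) (img b)"
  shows "Fhomogeneous wt G j d (hom_of smult img f)"
  unfolding Fhomogeneous_def
proof (intro conjI ballI)
  have fm: "f \<in> free_module (basis F i)" using f by (simp add: Fhomogeneous_def Fmod_def)
  show "hom_of smult img f \<in> Fmod G j"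
    unfolding Fmod_def
    by (rule hom_of_free_module[OF fm]) (use img in \<open>simp add: Fhomogeneous_def Fmod_def\<close>)
  fix c
  have "homogeneous wt (d - dgr G j c) (lookup f b * lookup (img b) c)" if "b \<in> keys f" for b
  proof -
    have "b \<in> basis F i" using fm that by (auto simp: free_module_def)
    then show ?thesis
      using homogeneous_times[OF wt Fhomogeneous_lookup[OF f, of b] Fhomogeneous_lookup[OF img[of b], of c]] by simp
  qed
  then show "homogeneous wt (d - dgr G j c) (lookup (hom_of smult img f) c)"
    unfolding lookup_hom_of by (rule homogeneous_sum)
qed

lemma homogeneous_hom_of:
  assumes wt: "grading wt" and f: "Fhomogeneous wt F i d f"
    and img: "\<And>b. b \<in> basis F i \<Longrightarrow> homogeneous wt (dgr F i b) (img b)"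
  shows "homogeneous wt d (hom_of (*) img f)"
  unfolding hom_of_def
proof (rule homogeneous_sum)
  fix b assume "b \<in> keys f"
  then have "b \<in> basis F i" using f by (auto simp: Fhomogeneous_def Fmod_def free_module_def)
  then show "homogeneous wt d (lookup f b * img b)"
    using homogeneous_times[OF wt Fhomogeneous_lookup[OF f, of b] img[of b]] by simp
qed

lemma graded_free_resolution_iff:
  assumes wt: "grading wt"
  shows "graded_free_resolution wt J F \<longleftrightarrow> (\<exists>e. exact_res J F e \<and> graded_at wt F e)"
proof
  assume R: "graded_free_resolution wt J F"
  then obtain e where e: "\<And>d f. Fhomogeneous wt F 0 d f \<Longrightarrow> homogeneous wt d (hom_of (*) e f)"
    "hom_of (*) e ` Fmod F 0 = J"
    "dmap F (Suc 0) ` Fmod F (Suc 0) = {f \<in> Fmod F 0. hom_of (*) e f = 0}"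
    unfolding graded_free_resolution_def by blast
  have "dmap F (Suc i) ` Fmod F (Suc i) = cycles F e i" for i
    using R e(3) unfolding graded_free_resolution_def cycles_def by (cases i) auto
  moreover have "\<forall>i. \<forall>b\<in>basis F (Suc i). bdry F (Suc i) b \<in> Fmod F i"
    using R unfolding graded_free_resolution_def by (elim conjE)
  ultimately have "exact_res J F e"
    unfolding exact_res_def using e(2) by simp
  moreover have R2: "\<forall>i d f. Fhomogeneous wt F (Suc i) d f \<longrightarrow> Fhomogeneous wt F i d (dmap F (Suc i) f)"
    using R unfolding graded_free_resolution_def by (elim conjE)
  have "graded_at wt F e"
    unfolding graded_at_def
  proof (intro conjI ballI allI)
    fix b assume "b \<in> basis F 0"
    then show "homogeneous wt (dgr F 0 b) (e b)"
      using e(1)[OF Fhomogeneous_single[OF wt]] by (simp add: hom_of_single[OF module_times])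
  next
    fix i b assume "b \<in> basis F (Suc i)"
    then have "Fhomogeneous wt F (Suc i) (dgr F (Suc i) b) (single b 1)"
      by (rule Fhomogeneous_single[OF wt])
    then have "Fhomogeneous wt F i (dgr F (Suc i) b) (dmap F (Suc i) (single b 1))"
      using R2 by simp
    then show "Fhomogeneous wt F i (dgr F (Suc i) b) (bdry F (Suc i) b)"
      by (simp add: dmap_single)
  qed
  ultimately show "\<exists>e. exact_res J F e \<and> graded_at wt F e" by blast
next
  assume "\<exists>e. exact_res J F e \<and> graded_at wt F e"
  then obtain e where e: "exact_res J F e" "graded_at wt F e" by blast
  have "dmap F (Suc (Suc i)) ` Fmod F (Suc (Suc i)) = {f \<in> Fmod F (Suc i). dmap F (Suc i) f = 0}" for i
    using e(1) unfolding exact_res_def cycles_def by simp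
  moreover have "dmap F (Suc 0) ` Fmod F (Suc 0) = {f \<in> Fmod F 0. hom_of (*) e f = 0}"
    using e(1) unfolding exact_res_def cycles_def by simp
  moreover have "Fhomogeneous wt F i d (dmap F (Suc i) f)" if "Fhomogeneous wt F (Suc i) d f" for i d f
    unfolding dmap_def using e(2)
    by (intro Fhomogeneous_hom_of[OF wt that]) (simp add: graded_at_def)
  moreover have "homogeneous wt d (hom_of (*) e f)" if "Fhomogeneous wt F 0 d f" for d f
    using e(2) by (intro homogeneous_hom_of[OF wt that]) (simp add: graded_at_def)
  ultimately show "graded_free_resolution wt J F"
    using e(1) unfolding graded_free_resolution_def exact_res_def by (intro conjI exI[of _ e]) simp_all
qed

definition homogeneous_part :: "('v monom \<Rightarrow> 'g) \<Rightarrow> 'g \<Rightarrow> ('v, 'k::comm_ring_1) mpoly \<Rightarrow> ('v, 'k) mpoly" where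
  "homogeneous_part wt d p = Poly_Mapping.mapp (\<lambda>m c. if wt m = d then c else 0) p"

lemma lookup_homogeneous_part: "lookup (homogeneous_part wt d p) m = (if wt m = d then lookup p m else 0)"
  unfolding homogeneous_part_def lookup_mapp by (simp add: when_def in_keys_iff)

lemma homogeneous_part_add: "homogeneous_part wt d (p + q) = homogeneous_part wt d p + homogeneous_part wt d q"
  by (rule poly_mapping_eqI) (simp add: lookup_homogeneous_part lookup_add)

lemma homogeneous_part_zero [simp]: "homogeneous_part wt d 0 = 0"
  by (rule poly_mapping_eqI) (simp add: lookup_homogeneous_part)

lemma homogeneous_part_sum: "homogeneous_part wt d (sum h A) = (\<Sum>a\<in>A. homogeneous_part wt d (h a))"
  by (induction A rule: infinite_finite_induct) (simp_all add: homogeneous_part_add)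

lemma homogeneous_homogeneous_part: "homogeneous wt d (homogeneous_part wt d p)"
  unfolding homogeneous_def by (auto simp: in_keys_iff lookup_homogeneous_part split: if_splits)

lemma homogeneous_part_homogeneous: "homogeneous wt d p \<Longrightarrow> homogeneous_part wt d p = p"
  by (rule poly_mapping_eqI) (auto simp: homogeneous_def lookup_homogeneous_part in_keys_iff)

lemma homogeneous_part_homogeneous_other: "homogeneous wt d p \<Longrightarrow> d \<noteq> d' \<Longrightarrow> homogeneous_part wt d' p = 0"
  by (rule poly_mapping_eqI) (auto simp: homogeneous_def lookup_homogeneous_part in_keys_iff)

text \<open>
  Degrees add, so multiplication by a homogeneous element commutes with taking components up to a shift of
  the degree. This is why homogeneous maps commute with taking components.
\<close>

lemma homogeneous_part_times:
  assumes wt: "grading wt" and q: "homogeneous wt e q"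
  shows "homogeneous_part wt d p * q = homogeneous_part wt (d + e) (p * q)"
proof (induction p rule: poly_mapping_single_induct)
  case (single m c)
  have s: "homogeneous wt (wt m) (single m c)"
    by (simp add: homogeneous_def)
  then have h: "homogeneous wt (wt m + e) (single m c * q)"
    using homogeneous_times[OF wt _ q] by blast
  show ?case
  proof (cases "wt m = d")
    case True
    then show ?thesis using homogeneous_part_homogeneous[OF s] homogeneous_part_homogeneous[OF h] by simp
  next
    case False
    then show ?thesis
      using homogeneous_part_homogeneous_other[OF s] homogeneous_part_homogeneous_other[OF h, of "d + e"] by simp
  qed
qed (simp_all add: homogeneous_part_add ring_distribs)

text \<open>
  The component of degree \<open>d\<close> in the free module whose basis element \<open>b\<close> has degree \<open>D b\<close>.
\<close>

definition free_module_part :: "('v monom \<Rightarrow> 'g::ab_group_add) \<Rightarrow> ('b \<Rightarrow> 'g) \<Rightarrow> 'g \<Rightarrow>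
    ('b \<Rightarrow>\<^sub>0 ('v, 'k::comm_ring_1) mpoly) \<Rightarrow> ('b \<Rightarrow>\<^sub>0 ('v, 'k) mpoly)" where
  "free_module_part wt D d f = Poly_Mapping.mapp (\<lambda>b p. homogeneous_part wt (d - D b) p) f"

lemma lookup_free_module_part: "lookup (free_module_part wt D d f) b = homogeneous_part wt (d - D b) (lookup f b)"
  unfolding free_module_part_def lookup_mapp by (auto simp: when_def in_keys_iff)

lemma keys_free_module_part: "keys (free_module_part wt D d f) \<subseteq> keys f"
  unfolding free_module_part_def by (rule keys_mapp_subset)

lemma Fhomogeneous_free_module_part:
  "f \<in> Fmod F i \<Longrightarrow> Fhomogeneous wt F i d (free_module_part wt (dgr F i) d f)"
  unfolding Fhomogeneous_def Fmod_def free_module_def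
  using keys_free_module_part[of wt "dgr F i" d f] by (auto simp: lookup_free_module_part homogeneous_homogeneous_part)

lemma free_module_part_hom_of:
  assumes wt: "grading wt"
    and img: "\<And>b c. b \<in> keys f \<Longrightarrow> homogeneous wt (D b - E c) (lookup (img b) c)"
  shows "hom_of smult img (free_module_part wt D d f) = free_module_part wt E d (hom_of smult img f)"
proof (rule poly_mapping_eqI)
  fix c
  have "lookup (hom_of smult img (free_module_part wt D d f)) c
      = (\<Sum>b\<in>keys f. homogeneous_part wt (d - D b) (lookup f b) * lookup (img b) c)"
    by (subst hom_of_mono[OF module_smult finite_keys keys_free_module_part]) (simp add: lookup_sum lookup_free_module_part)
  also have "\<dots> = (\<Sum>b\<in>keys f. homogeneous_part wt (d - E c) (lookup f b * lookup (img b) c))"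
  proof (rule sum.cong)
    fix b assume "b \<in> keys f"
    then show "homogeneous_part wt (d - D b) (lookup f b) * lookup (img b) c
        = homogeneous_part wt (d - E c) (lookup f b * lookup (img b) c)"
      using homogeneous_part_times[OF wt img, of b "d - D b" "lookup f b" c] by simp
  qed simp
  finally show "lookup (hom_of smult img (free_module_part wt D d f)) c = lookup (free_module_part wt E d (hom_of smult img f)) c"
    by (simp add: lookup_free_module_part lookup_hom_of homogeneous_part_sum)
qed

lemma homogeneous_part_hom_of:
  assumes wt: "grading wt" and img: "\<And>b. b \<in> keys f \<Longrightarrow> homogeneous wt (D b) (img b)"
  shows "hom_of (*) img (free_module_part wt D d f) = homogeneous_part wt d (hom_of (*) img f)"
proof -
  have "hom_of (*) img (free_module_part wt D d f) = (\<Sum>b\<in>keys f. homogeneous_part wt (d - D b) (lookup f b) * img b)"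
    by (subst hom_of_mono[OF module_times finite_keys keys_free_module_part]) (simp add: lookup_free_module_part)
  also have "\<dots> = (\<Sum>b\<in>keys f. homogeneous_part wt d (lookup f b * img b))"
  proof (rule sum.cong)
    fix b assume "b \<in> keys f"
    then show "homogeneous_part wt (d - D b) (lookup f b) * img b = homogeneous_part wt d (lookup f b * img b)"
      using homogeneous_part_times[OF wt img, of b "d - D b" "lookup f b"] by simp
  qed simp
  finally show ?thesis by (simp add: hom_of_def homogeneous_part_sum)
qed

lemma free_module_part_Fhomogeneous: "Fhomogeneous wt F i d f \<Longrightarrow> free_module_part wt (dgr F i) d f = f"
  by (rule poly_mapping_eqI) (simp add: lookup_free_module_part homogeneous_part_homogeneous Fhomogeneous_lookup)

text \<open>
  Any preimage of a homogeneous cycle may be replaced by its component of the same degree.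
\<close>

lemma homogeneous_lift:
  assumes wt: "grading wt" and F: "exact_res J F e" "graded_at wt F e"
    and z: "z \<in> cycles F e i" "Fhomogeneous wt F i d z"
  shows "\<exists>y. Fhomogeneous wt F (Suc i) d y \<and> dmap F (Suc i) y = z"
proof -
  obtain y where y: "y \<in> Fmod F (Suc i)" "dmap F (Suc i) y = z"
    using F(1) z(1) unfolding exact_res_def by (metis imageE)
  have "dmap F (Suc i) (free_module_part wt (dgr F (Suc i)) d y) = free_module_part wt (dgr F i) d z"
    unfolding y(2)[symmetric] dmap_def
  proof (rule free_module_part_hom_of[OF wt])
    fix b c assume "b \<in> keys y"
    then have "b \<in> basis F (Suc i)" using y(1) FmodD by fast
    then have "Fhomogeneous wt F i (dgr F (Suc i) b) (bdry F (Suc i) b)"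
      using F(2) by (simp add: graded_at_def)
    then show "homogeneous wt (dgr F (Suc i) b - dgr F i c) (lookup (bdry F (Suc i) b) c)"
      by (rule Fhomogeneous_lookup)
  qed
  then show ?thesis
    using Fhomogeneous_free_module_part[OF y(1)] free_module_part_Fhomogeneous[OF z(2)] by metis
qed

lemma homogeneous_lift_augmentation:
  assumes wt: "grading wt" and F: "exact_res J F e" "graded_at wt F e"
    and p: "p \<in> J" "homogeneous wt d p"
  shows "\<exists>y. Fhomogeneous wt F 0 d y \<and> hom_of (*) e y = p"
proof -
  obtain y where y: "y \<in> Fmod F 0" "hom_of (*) e y = p"
    using F(1) p(1) unfolding exact_res_def by (metis imageE)
  have "hom_of (*) e (free_module_part wt (dgr F 0) d y) = homogeneous_part wt d p"
    unfolding y(2)[symmetric]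
    by (rule homogeneous_part_hom_of[OF wt]) (use F(2) y(1) FmodD in \<open>fastforce simp: graded_at_def\<close>)
  then show ?thesis
    using Fhomogeneous_free_module_part[OF y(1)] homogeneous_part_homogeneous[OF p(2)] by metis
qed

section \<open>Comparison of resolutions\<close>

lemma bdry_cycles:
  assumes "exact_res J F e" "b \<in> basis F (Suc i)"
  shows "bdry F (Suc i) b \<in> cycles F e i"
proof -
  have "dmap F (Suc i) (single b 1) \<in> cycles F e i"
    using assms Fmod_single[OF assms(2)] unfolding exact_res_def by blast
  then show ?thesis by (simp add: dmap_single)
qed

definition chain_map :: "('b, 'v, 'g, 'k::comm_ring_1) free_complex \<Rightarrow> ('b \<Rightarrow> ('v, 'k) mpoly) \<Rightarrow>
    ('c, 'v, 'h, 'k) free_complex \<Rightarrow> ('c \<Rightarrow> ('v, 'k) mpoly) \<Rightarrow>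
    (nat \<Rightarrow> 'b \<Rightarrow> 'c \<Rightarrow>\<^sub>0 ('v, 'k) mpoly) \<Rightarrow> bool" where
  "chain_map F e G e' f \<longleftrightarrow> (\<forall>i. \<forall>b\<in>basis F i. f i b \<in> Fmod G i) \<and>
     (\<forall>b\<in>basis F 0. hom_of (*) e' (f 0 b) = e b) \<and>
     (\<forall>i. \<forall>b\<in>basis F (Suc i). dmap G (Suc i) (f (Suc i) b) = hom_of smult (f i) (bdry F (Suc i) b))"

lemma hom_of_Fmod:
  assumes "z \<in> Fmod F i" "\<And>b. b \<in> basis F i \<Longrightarrow> img b \<in> Fmod G j"
  shows "hom_of smult img z \<in> Fmod G j"
  using hom_of_free_module[of z "basis F i" img "basis G j"] assms by (simp add: Fmod_def)

lemma dmap_hom_of: "dmap G i (hom_of smult img z) = hom_of smult (\<lambda>b. dmap G i (img b)) z"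
  unfolding dmap_def by (rule hom_of_hom_of[OF module_smult])

lemma dmap_hom_of_eq:
  assumes "z \<in> Fmod F j" "\<And>b. b \<in> basis F j \<Longrightarrow> dmap G i (img b) = hom_of smult img' (bdry F j b)"
  shows "dmap G i (hom_of smult img z) = hom_of smult img' (dmap F j z)"
proof -
  have "dmap G i (hom_of smult img z) = hom_of smult (\<lambda>b. hom_of smult img' (bdry F j b)) z"
    unfolding dmap_hom_of by (rule hom_of_cong) (use assms FmodD in fast)
  then show ?thesis
    unfolding dmap_def[of F] by (simp add: hom_of_hom_of[OF module_smult])
qed

lemma chain_map_cycles:
  assumes f: "chain_map F e G e' f" and z: "z \<in> cycles F e i"
  shows "hom_of smult (f i) z \<in> cycles G e' i"
proof -
  have zF: "z \<in> Fmod F i" using z by (simp add: cycles_def)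
  then have "hom_of smult (f i) z \<in> Fmod G i"
    by (rule hom_of_Fmod) (use f in \<open>simp add: chain_map_def\<close>)
  moreover have "hom_of (*) e' (hom_of smult (f i) z) = 0" if "i = 0"
  proof -
    have "hom_of (*) e' (hom_of smult (f i) z) = hom_of (*) e z"
      unfolding hom_of_hom_of[OF module_times]
      by (rule hom_of_cong) (use f that FmodD[OF zF] in \<open>simp add: chain_map_def\<close>)
    then show ?thesis using z that by (simp add: cycles_def)
  qed
  moreover have "dmap G i (hom_of smult (f i) z) = 0" if "i = Suc j" for j
  proof -
    have "dmap G i (hom_of smult (f i) z) = hom_of smult (f j) (dmap F i z)"
      by (rule dmap_hom_of_eq[OF zF]) (use f that in \<open>simp add: chain_map_def\<close>)
    then show ?thesis using z that by (simp add: cycles_def)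
  qed
  ultimately show ?thesis unfolding cycles_def by (cases i) auto
qed

text \<open>
  The comparison theorem: a map is built degree by degree, sending each basis element to a homogeneous preimage
  of an element that is a cycle because of the previous step. The induction therefore carries along that cycles
  are sent to cycles.
\<close>

lemma comparison_map:
  fixes F :: "('b, 'v, 'g::ab_group_add, 'k::comm_ring_1) free_complex"
    and G :: "('c, 'v, 'g, 'k) free_complex"
  assumes wt: "grading wt" and F: "exact_res J F e" "graded_at wt F e"
    and G: "exact_res J G e'" "graded_at wt G e'"
  shows "\<exists>f. chain_map F e G e' f \<and> (\<forall>i. \<forall>b\<in>basis F i. Fhomogeneous wt G i (dgr F i b) (f i b))"
proof -
  define P where "P i g \<longleftrightarrow> (\<forall>b\<in>basis F i. Fhomogeneous wt G i (dgr F i b) (g b)) \<and>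
      (\<forall>z\<in>cycles F e i. hom_of smult g z \<in> cycles G e' i) \<and>
      (i = 0 \<longrightarrow> (\<forall>b\<in>basis F 0. hom_of (*) e' (g b) = e b))" for i g
  define Q where "Q i g g' \<longleftrightarrow> (\<forall>b\<in>basis F (Suc i). dmap G (Suc i) (g' b) = hom_of smult g (bdry F (Suc i) b))" for i g g'
  have "\<exists>f. \<forall>i. P i (f i) \<and> Q i (f i) (f (Suc i))"
  proof (rule dependent_nat_choice)
    have "\<exists>y. Fhomogeneous wt G 0 (dgr F 0 b) y \<and> hom_of (*) e' y = e b" if b: "b \<in> basis F 0" for b
    proof (rule homogeneous_lift_augmentation[OF wt G])
      have "hom_of (*) e (single b 1) \<in> J"
        using F(1) Fmod_single[OF b] unfolding exact_res_def by blast
      then show "e b \<in> J" by (simp add: hom_of_single[OF module_times])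
      show "homogeneous wt (dgr F 0 b) (e b)" using F(2) b by (simp add: graded_at_def)
    qed
    then obtain g where g: "\<And>b. b \<in> basis F 0 \<Longrightarrow> Fhomogeneous wt G 0 (dgr F 0 b) (g b) \<and> hom_of (*) e' (g b) = e b"
      by metis
    have "hom_of smult g z \<in> cycles G e' 0" if z: "z \<in> cycles F e 0" for z
    proof -
      have zF: "z \<in> Fmod F 0" using z by (simp add: cycles_def)
      have "hom_of smult g z \<in> Fmod G 0"
        by (rule hom_of_Fmod[OF zF]) (use g in \<open>simp add: Fhomogeneous_def\<close>)
      moreover have "hom_of (*) e' (hom_of smult g z) = hom_of (*) e z"
        unfolding hom_of_hom_of[OF module_times]
        by (rule hom_of_cong) (use g FmodD[OF zF] in simp)
      ultimately show ?thesis using z by (simp add: cycles_def)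
    qed
    then have "P 0 g" using g unfolding P_def by blast
    then show "\<exists>g. P 0 g" by blast
  next
    fix g i assume g: "P i g"
    have "\<exists>y. Fhomogeneous wt G (Suc i) (dgr F (Suc i) b) y \<and> dmap G (Suc i) y = hom_of smult g (bdry F (Suc i) b)"
      if b: "b \<in> basis F (Suc i)" for b
    proof (rule homogeneous_lift[OF wt G])
      show "hom_of smult g (bdry F (Suc i) b) \<in> cycles G e' i"
        using g bdry_cycles[OF F(1) b] unfolding P_def by blast
      show "Fhomogeneous wt G i (dgr F (Suc i) b) (hom_of smult g (bdry F (Suc i) b))"
        by (rule Fhomogeneous_hom_of[OF wt, of F i])
          (use F(2) b g in \<open>simp_all add: graded_at_def P_def\<close>)
    qed
    then obtain g' where g': "\<And>b. b \<in> basis F (Suc i) \<Longrightarrow> Fhomogeneous wt G (Suc i) (dgr F (Suc i) b) (g' b) \<and>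
        dmap G (Suc i) (g' b) = hom_of smult g (bdry F (Suc i) b)"
      by metis
    have "hom_of smult g' z \<in> cycles G e' (Suc i)" if z: "z \<in> cycles F e (Suc i)" for z
    proof -
      have zF: "z \<in> Fmod F (Suc i)" using z by (simp add: cycles_def)
      have "hom_of smult g' z \<in> Fmod G (Suc i)"
        by (rule hom_of_Fmod[OF zF]) (use g' in \<open>simp add: Fhomogeneous_def\<close>)
      moreover have "dmap G (Suc i) (hom_of smult g' z) = hom_of smult g (dmap F (Suc i) z)"
        by (rule dmap_hom_of_eq[OF zF]) (use g' in simp)
      ultimately show ?thesis using z by (simp add: cycles_def)
    qed
    then have "P (Suc i) g' \<and> Q i g g'" using g' unfolding P_def Q_def by blast
    then show "\<exists>g'. P (Suc i) g' \<and> Q i g g'" by blast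
  qed
  then obtain f where f: "\<And>i. P i (f i)" "\<And>i. Q i (f i) (f (Suc i))" by blast
  have "chain_map F e G e' f"
    unfolding chain_map_def using f by (simp add: P_def Q_def Fhomogeneous_def)
  then show ?thesis using f(1) unfolding P_def by blast
qed

text \<open>
  The maps \<open>h i\<close> satisfy \<open>\<partial> h + h \<partial> = k\<close> on basis elements, where \<open>k\<close> is a chain map from \<open>F\<close> to itself.
\<close>

definition homotopy :: "('b, 'v, 'g, 'k::comm_ring_1) free_complex \<Rightarrow>
    (nat \<Rightarrow> 'b \<Rightarrow> 'b \<Rightarrow>\<^sub>0 ('v, 'k) mpoly) \<Rightarrow> (nat \<Rightarrow> 'b \<Rightarrow> 'b \<Rightarrow>\<^sub>0 ('v, 'k) mpoly) \<Rightarrow> bool" where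
  "homotopy F k h \<longleftrightarrow> (\<forall>i. \<forall>b\<in>basis F i. h i b \<in> Fmod F (Suc i)) \<and>
     (\<forall>b\<in>basis F 0. dmap F (Suc 0) (h 0 b) = k 0 b) \<and>
     (\<forall>i. \<forall>b\<in>basis F (Suc i). dmap F (Suc (Suc i)) (h (Suc i) b) = k (Suc i) b - hom_of smult (h i) (bdry F (Suc i) b))"

lemma homotopy_cycles:
  assumes h: "homotopy F k h" and z: "z \<in> cycles F e i"
  shows "dmap F (Suc i) (hom_of smult (h i) z) = hom_of smult (k i) z"
proof (cases i)
  case 0
  then show ?thesis
    unfolding dmap_hom_of using h z FmodD
    by (intro hom_of_cong) (fastforce simp: homotopy_def cycles_def)
next
  case (Suc j)
  have zF: "z \<in> Fmod F (Suc j)" using z Suc by (simp add: cycles_def)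
  have "dmap F (Suc i) (hom_of smult (h i) z)
      = hom_of smult (\<lambda>b. k i b - hom_of smult (h j) (bdry F i b)) z"
    unfolding dmap_hom_of using h FmodD[OF zF] Suc by (intro hom_of_cong) (simp add: homotopy_def)
  also have "\<dots> = hom_of smult (k i) z - hom_of smult (h j) (dmap F i z)"
    unfolding hom_of_img_diff[OF module_smult] dmap_def by (simp add: hom_of_hom_of[OF module_smult])
  finally show ?thesis using z Suc by (simp add: cycles_def)
qed

text \<open>
  A chain map of a resolution to itself that is killed by the augmentation is null-homotopic: \<open>k - h \<partial>\<close> takes values
  in cycles and so can be lifted through \<open>\<partial>\<close>.
\<close>

lemma null_homotopy:
  fixes F :: "('b, 'v, 'g, 'k::comm_ring_1) free_complex"
  assumes F: "exact_res J F e"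
    and k: "\<And>i b. b \<in> basis F i \<Longrightarrow> k i b \<in> Fmod F i"
      "\<And>b. b \<in> basis F 0 \<Longrightarrow> hom_of (*) e (k 0 b) = 0"
      "\<And>i b. b \<in> basis F (Suc i) \<Longrightarrow> dmap F (Suc i) (k (Suc i) b) = hom_of smult (k i) (bdry F (Suc i) b)"
  shows "\<exists>h. homotopy F k h"
proof -
  have lift: "\<exists>y\<in>Fmod F (Suc i). dmap F (Suc i) y = z" if "z \<in> cycles F e i" for i z
    using F that unfolding exact_res_def by (metis imageE)
  define P where "P i h \<longleftrightarrow> (\<forall>b\<in>basis F i. h b \<in> Fmod F (Suc i)) \<and>
      (\<forall>z\<in>cycles F e i. dmap F (Suc i) (hom_of smult h z) = hom_of smult (k i) z) \<and>
      (i = 0 \<longrightarrow> (\<forall>b\<in>basis F 0. dmap F (Suc 0) (h b) = k 0 b))" for i h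
  define Q where "Q i h h' \<longleftrightarrow> (\<forall>b\<in>basis F (Suc i). dmap F (Suc (Suc i)) (h' b)
      = k (Suc i) b - hom_of smult h (bdry F (Suc i) b))" for i h h'
  have "\<exists>h. \<forall>i. P i (h i) \<and> Q i (h i) (h (Suc i))"
  proof (rule dependent_nat_choice)
    have "\<exists>y\<in>Fmod F (Suc 0). dmap F (Suc 0) y = k 0 b" if b: "b \<in> basis F 0" for b
      using k(1,2)[OF b] by (intro lift) (simp add: cycles_def)
    then obtain h where h: "\<And>b. b \<in> basis F 0 \<Longrightarrow> h b \<in> Fmod F (Suc 0) \<and> dmap F (Suc 0) (h b) = k 0 b"
      by metis
    have "dmap F (Suc 0) (hom_of smult h z) = hom_of smult (k 0) z" if z: "z \<in> cycles F e 0" for z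
    proof -
      have zF: "z \<in> Fmod F 0" using z by (simp add: cycles_def)
      show ?thesis unfolding dmap_hom_of
        by (rule hom_of_cong) (use h FmodD[OF zF] in simp)
    qed
    then have "P 0 h" using h unfolding P_def by blast
    then show "\<exists>h. P 0 h" by blast
  next
    fix h i assume h: "P i h"
    have "\<exists>y\<in>Fmod F (Suc (Suc i)). dmap F (Suc (Suc i)) y = k (Suc i) b - hom_of smult h (bdry F (Suc i) b)"
      if b: "b \<in> basis F (Suc i)" for b
    proof (rule lift)
      have bc: "bdry F (Suc i) b \<in> cycles F e i" by (rule bdry_cycles[OF F b])
      then have "hom_of smult h (bdry F (Suc i) b) \<in> Fmod F (Suc i)"
        by (intro hom_of_Fmod[of _ F i]) (use h in \<open>simp_all add: P_def cycles_def\<close>)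
      then have "k (Suc i) b - hom_of smult h (bdry F (Suc i) b) \<in> Fmod F (Suc i)"
        using k(1)[OF b] free_module_diff unfolding Fmod_def by blast
      moreover have "dmap F (Suc i) (hom_of smult h (bdry F (Suc i) b)) = hom_of smult (k i) (bdry F (Suc i) b)"
        using h bc unfolding P_def by blast
      then have "dmap F (Suc i) (k (Suc i) b - hom_of smult h (bdry F (Suc i) b)) = 0"
        using k(3)[OF b] unfolding dmap_def by (simp add: hom_of_diff[OF module_smult])
      ultimately show "k (Suc i) b - hom_of smult h (bdry F (Suc i) b) \<in> cycles F e (Suc i)"
        by (simp add: cycles_def)
    qed
    then obtain h' where h': "\<And>b. b \<in> basis F (Suc i) \<Longrightarrow> h' b \<in> Fmod F (Suc (Suc i)) \<and>
        dmap F (Suc (Suc i)) (h' b) = k (Suc i) b - hom_of smult h (bdry F (Suc i) b)"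
      by metis
    have "dmap F (Suc (Suc i)) (hom_of smult h' z) = hom_of smult (k (Suc i)) z" if z: "z \<in> cycles F e (Suc i)" for z
    proof -
      have zF: "z \<in> Fmod F (Suc i)" using z by (simp add: cycles_def)
      have "dmap F (Suc (Suc i)) (hom_of smult h' z)
          = hom_of smult (\<lambda>b. k (Suc i) b - hom_of smult h (bdry F (Suc i) b)) z"
        unfolding dmap_hom_of by (rule hom_of_cong) (use h' FmodD[OF zF] in simp)
      also have "\<dots> = hom_of smult (k (Suc i)) z - hom_of smult h (dmap F (Suc i) z)"
        unfolding hom_of_img_diff[OF module_smult] dmap_def by (simp add: hom_of_hom_of[OF module_smult])
      finally show ?thesis using z by (simp add: cycles_def)
    qed
    then have "P (Suc i) h' \<and> Q i h h'" using h' unfolding P_def Q_def by blast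
    then show "\<exists>h'. P (Suc i) h' \<and> Q i h h'" by blast
  qed
  then obtain h where "\<And>i. P i (h i)" "\<And>i. Q i (h i) (h (Suc i))" by blast
  then have "homotopy F k h" unfolding homotopy_def P_def Q_def by simp
  then show ?thesis by blast
qed

text \<open>
  The chain map \<open>g f - id\<close> is killed by the augmentation, since \<open>f\<close> and \<open>g\<close> are compatible with the augmentations.
\<close>

lemma homotopy_equivalence:
  fixes F :: "('b, 'v, 'g, 'k::comm_ring_1) free_complex" and G :: "('c, 'v, 'h, 'k) free_complex"
  assumes F: "exact_res J F e"
    and f: "chain_map F e G e' f" and g: "chain_map G e' F e g"
  shows "\<exists>h. homotopy F (\<lambda>i b. hom_of smult (g i) (f i b) - single b 1) h"
proof (rule null_homotopy[OF F])
  let ?k = "\<lambda>i b. hom_of smult (g i) (f i b) - single b 1"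
  show "?k i b \<in> Fmod F i" if b: "b \<in> basis F i" for i b
  proof -
    have "hom_of smult (g i) (f i b) \<in> Fmod F i"
      by (rule hom_of_Fmod[of _ G i]) (use f g b in \<open>simp_all add: chain_map_def\<close>)
    then show ?thesis using Fmod_single[OF b] free_module_diff unfolding Fmod_def by blast
  qed
  show "hom_of (*) e (?k 0 b) = 0" if b: "b \<in> basis F 0" for b
  proof -
    have fb: "f 0 b \<in> Fmod G 0" using f b by (simp add: chain_map_def)
    have "hom_of (*) e (hom_of smult (g 0) (f 0 b)) = hom_of (*) e' (f 0 b)"
      unfolding hom_of_hom_of[OF module_times]
      by (rule hom_of_cong) (use g FmodD[OF fb] in \<open>simp add: chain_map_def\<close>)
    also have "\<dots> = e b" using f b by (simp add: chain_map_def)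
    finally show ?thesis
      by (simp add: hom_of_diff[OF module_times] hom_of_single[OF module_times])
  qed
  show "dmap F (Suc i) (?k (Suc i) b) = hom_of smult (?k i) (bdry F (Suc i) b)"
    if b: "b \<in> basis F (Suc i)" for i b
  proof -
    have fb: "f (Suc i) b \<in> Fmod G (Suc i)" using f b by (simp add: chain_map_def)
    have "dmap F (Suc i) (hom_of smult (g (Suc i)) (f (Suc i) b)) = hom_of smult (g i) (dmap G (Suc i) (f (Suc i) b))"
      by (rule dmap_hom_of_eq[OF fb]) (use g in \<open>simp add: chain_map_def\<close>)
    also have "\<dots> = hom_of smult (\<lambda>b. hom_of smult (g i) (f i b)) (bdry F (Suc i) b)"
      using f b by (simp add: chain_map_def hom_of_hom_of[OF module_smult])
    finally have 1: "dmap F (Suc i) (hom_of smult (g (Suc i)) (f (Suc i) b)) = hom_of smult (\<lambda>b. hom_of smult (g i) (f i b)) (bdry F (Suc i) b)" .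
    have "dmap F (Suc i) (?k (Suc i) b) = dmap F (Suc i) (hom_of smult (g (Suc i)) (f (Suc i) b)) - bdry F (Suc i) b"
      unfolding dmap_def by (simp add: hom_of_diff[OF module_smult] hom_of_single[OF module_smult])
    then show ?thesis
      unfolding 1 hom_of_img_diff[OF module_smult] by (simp add: hom_of_single_id)
  qed
qed

section \<open>Base change of resolutions\<close>

lemma chain_map_hom_Fmod:
  "chain_map F e G e' f \<Longrightarrow> z \<in> Fmod F i \<Longrightarrow> hom_of smult (f i) z \<in> Fmod G i"
  by (rule hom_of_Fmod[of z F i]) (simp_all add: chain_map_def)

lemma chain_map_dmap:
  "chain_map F e G e' f \<Longrightarrow> z \<in> Fmod F (Suc i) \<Longrightarrow>
     dmap G (Suc i) (hom_of smult (f (Suc i)) z) = hom_of smult (f i) (dmap F (Suc i) z)"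
  by (rule dmap_hom_of_eq) (simp_all add: chain_map_def)

lemma basis_base_change [simp]: "basis (base_change \<psi> F) = basis F"
  by (simp add: base_change_def)

lemma dgr_base_change [simp]: "dgr (base_change \<psi> F) = dgr F"
  by (simp add: base_change_def)

lemma bdry_base_change [simp]: "bdry (base_change \<psi> F) i b = ext_scalars \<psi> (bdry F i b)"
  by (simp add: base_change_def)

lemma basis_regrade [simp]: "basis (regrade \<phi> F) = basis F"
  by (simp add: regrade_def)

lemma dgr_regrade [simp]: "dgr (regrade \<phi> F) i b = \<phi> (dgr F i b)"
  by (simp add: regrade_def)

lemma bdry_regrade [simp]: "bdry (regrade \<phi> F) = bdry F"
  by (simp add: regrade_def)

lemma Fmod_regrade [simp]: "Fmod (regrade \<phi> F) = Fmod F"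
  by (rule ext) (simp add: Fmod_def)

lemma dmap_regrade [simp]: "dmap (regrade \<phi> F) = dmap F"
  by (intro ext) (simp add: dmap_def)

lemma exact_res_regrade [simp]: "exact_res J (regrade \<phi> F) e \<longleftrightarrow> exact_res J F e"
  by (simp add: exact_res_def cycles_def)

lemma ext_scalars_Fmod:
  "algebra_hom \<psi> \<Longrightarrow> f \<in> Fmod F i \<Longrightarrow> ext_scalars \<psi> f \<in> Fmod (base_change \<psi> F) i"
  unfolding Fmod_def basis_base_change by (rule ext_scalars_free_module)

lemma ext_scalars_single_one:
  assumes "algebra_hom \<psi>" shows "ext_scalars \<psi> (single b 1) = single b 1"
  using assms algebra_hom_0[OF assms]
  by (intro poly_mapping_eqI) (simp add: lookup_ext_scalars lookup_single when_def algebra_hom_def)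

lemma ext_scalars_zero [simp]: "ext_scalars \<psi> 0 = 0"
  by (rule poly_mapping_eqI) (simp add: ext_scalars_def map.rep_eq)

lemma ext_scalars_diff:
  assumes "algebra_hom \<psi>"
  shows "ext_scalars \<psi> (f - g) = ext_scalars \<psi> f - ext_scalars \<psi> g"
  using ext_scalars_add[OF assms, of "f - g" g] by simp

lemma chain_map_base_change:
  assumes \<psi>: "algebra_hom \<psi>" and f: "chain_map F e G e' f"
  shows "chain_map (base_change \<psi> F) (\<lambda>b. \<psi> (e b)) (base_change \<psi> G) (\<lambda>b. \<psi> (e' b))
           (\<lambda>i b. ext_scalars \<psi> (f i b))"
  unfolding chain_map_def
proof (intro conjI allI ballI)
  fix i b assume "b \<in> basis (base_change \<psi> F) i"
  then show "ext_scalars \<psi> (f i b) \<in> Fmod (base_change \<psi> G) i"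
    using f by (intro ext_scalars_Fmod[OF \<psi>]) (simp add: chain_map_def)
next
  fix b assume "b \<in> basis (base_change \<psi> F) 0"
  then have "hom_of (*) e' (f 0 b) = e b" using f by (simp add: chain_map_def)
  then show "hom_of (*) (\<lambda>b. \<psi> (e' b)) (ext_scalars \<psi> (f 0 b)) = \<psi> (e b)"
    by (metis hom_of_ext_scalars[OF \<psi>])
next
  fix i b assume "b \<in> basis (base_change \<psi> F) (Suc i)"
  then have "dmap G (Suc i) (f (Suc i) b) = hom_of smult (f i) (bdry F (Suc i) b)"
    using f by (simp add: chain_map_def)
  then show "dmap (base_change \<psi> G) (Suc i) (ext_scalars \<psi> (f (Suc i) b))
      = hom_of smult (\<lambda>b. ext_scalars \<psi> (f i b)) (bdry (base_change \<psi> F) (Suc i) b)"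
    by (simp add: dmap_base_change[OF \<psi>] ext_scalars_hom_of[OF \<psi>])
qed

lemma homotopy_base_change:
  assumes \<psi>: "algebra_hom \<psi>" and h: "homotopy F k h"
  shows "homotopy (base_change \<psi> F) (\<lambda>i b. ext_scalars \<psi> (k i b)) (\<lambda>i b. ext_scalars \<psi> (h i b))"
  unfolding homotopy_def
proof (intro conjI allI ballI)
  fix i b assume "b \<in> basis (base_change \<psi> F) i"
  then show "ext_scalars \<psi> (h i b) \<in> Fmod (base_change \<psi> F) (Suc i)"
    using h by (intro ext_scalars_Fmod[OF \<psi>]) (simp add: homotopy_def)
next
  fix b assume "b \<in> basis (base_change \<psi> F) 0"
  then show "dmap (base_change \<psi> F) (Suc 0) (ext_scalars \<psi> (h 0 b)) = ext_scalars \<psi> (k 0 b)"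
    using h by (simp add: homotopy_def dmap_base_change[OF \<psi>])
next
  fix i b assume "b \<in> basis (base_change \<psi> F) (Suc i)"
  then show "dmap (base_change \<psi> F) (Suc (Suc i)) (ext_scalars \<psi> (h (Suc i) b)) = ext_scalars \<psi> (k (Suc i) b)
      - hom_of smult (\<lambda>b. ext_scalars \<psi> (h i b)) (bdry (base_change \<psi> F) (Suc i) b)"
    using h by (simp add: homotopy_def dmap_base_change[OF \<psi>] ext_scalars_diff[OF \<psi>] ext_scalars_hom_of[OF \<psi>])
qed

lemma ideal_span_image:
  assumes "algebra_hom \<psi>"
  shows "ideal.span (\<psi> ` ideal.span X) = ideal.span (\<psi> ` X)"
proof
  show "ideal.span (\<psi> ` ideal.span X) \<subseteq> ideal.span (\<psi> ` X)"
  proof (rule ideal.span_minimal)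
    show "\<psi> ` ideal.span X \<subseteq> ideal.span (\<psi> ` X)"
    proof (rule image_subsetI)
      fix x assume "x \<in> ideal.span X"
      then show "\<psi> x \<in> ideal.span (\<psi> ` X)"
      proof (induction rule: ideal.span_induct_alt)
        case base
        then show ?case by (simp add: algebra_hom_0[OF assms] ideal.span_zero)
      next
        case (step c x y)
        have "\<psi> (c * x + y) = \<psi> c * \<psi> x + \<psi> y" using assms by (simp add: algebra_hom_def)
        then show ?case using step
          by (simp add: ideal.span_add ideal.span_scale ideal.span_base)
      qed
    qed
  qed (rule ideal.subspace_span)
  show "ideal.span (\<psi> ` X) \<subseteq> ideal.span (\<psi> ` ideal.span X)"
    by (rule ideal.span_mono) (use ideal.span_superset in blast)
qed

lemma exact_res_span:
  assumes "exact_res J F e" shows "J = ideal.span (e ` basis F 0)"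
  using assms hom_of_image_span[OF module_times, of e "basis F 0"]
  unfolding exact_res_def Fmod_def by metis

text \<open>
  A cycle \<open>z\<close> of the base change of \<open>F\<close> is sent by \<open>f\<close> to a cycle, hence to a boundary \<open>\<partial> w\<close>, of the base change of
  \<open>T\<close>. The homotopy gives \<open>z = g (f z) - \<partial> (h z) = \<partial> (g w - h z)\<close>.
\<close>

lemma exact_res_base_change_transfer:
  assumes \<psi>: "algebra_hom \<psi>"
    and F: "exact_res \<J> F e" and T: "exact_res J (base_change \<psi> T) (\<lambda>b. \<psi> (e' b))"
    and f: "chain_map F e T e' f" and g: "chain_map T e' F e g"
    and J: "J = ideal.span (\<psi> ` \<J>)"
  shows "exact_res J (base_change \<psi> F) (\<lambda>b. \<psi> (e b))"
proof -
  obtain h where h: "homotopy F (\<lambda>i b. hom_of smult (g i) (f i b) - single b 1) h"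
    using homotopy_equivalence[OF F f g] by blast
  let ?F = "base_change \<psi> F" and ?T = "base_change \<psi> T"
  let ?e = "\<lambda>b. \<psi> (e b)" and ?e' = "\<lambda>b. \<psi> (e' b)"
  define f' where "f' i b = ext_scalars \<psi> (f i b)" for i b
  define g' where "g' i b = ext_scalars \<psi> (g i b)" for i b
  define h' where "h' i b = ext_scalars \<psi> (h i b)" for i b
  have f': "chain_map ?F ?e ?T ?e' f'" and g': "chain_map ?T ?e' ?F ?e g'"
    unfolding f'_def g'_def using chain_map_base_change[OF \<psi>] f g by blast+
  have h': "homotopy ?F (\<lambda>i b. hom_of smult (g' i) (f' i b) - single b 1) h'"
    using homotopy_base_change[OF \<psi> h] unfolding h'_def f'_def g'_def
    by (simp add: ext_scalars_diff[OF \<psi>] ext_scalars_hom_of[OF \<psi>] ext_scalars_single_one[OF \<psi>])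
  have bd: "bdry F (Suc i) b \<in> cycles F e i" if "b \<in> basis F (Suc i)" for i b
    by (rule bdry_cycles[OF F that])
  have "bdry ?F (Suc i) b \<in> cycles ?F ?e i" if "b \<in> basis F (Suc i)" for i b
  proof -
    have "ext_scalars \<psi> (bdry F (Suc i) b) \<in> Fmod ?F i"
      using bd[OF that] by (intro ext_scalars_Fmod[OF \<psi>]) (simp add: cycles_def)
    moreover have "hom_of (*) ?e (ext_scalars \<psi> (bdry F (Suc i) b)) = 0" if "i = 0"
      using bd[OF \<open>b \<in> basis F (Suc i)\<close>] that
      by (simp add: cycles_def hom_of_ext_scalars[OF \<psi>, symmetric] algebra_hom_0[OF \<psi>])
    moreover have "dmap ?F i (ext_scalars \<psi> (bdry F (Suc i) b)) = 0" if "i \<noteq> 0"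
      using bd[OF \<open>b \<in> basis F (Suc i)\<close>] that
      by (simp add: cycles_def dmap_base_change[OF \<psi>])
    ultimately show ?thesis by (simp add: cycles_def)
  qed
  then have bd': "bdry ?F (Suc i) b \<in> cycles ?F ?e i" if "b \<in> basis ?F (Suc i)" for i b
    using that by simp
  show ?thesis
    unfolding exact_res_def
  proof (intro conjI allI ballI)
    fix i b assume "b \<in> basis ?F (Suc i)"
    then show "bdry ?F (Suc i) b \<in> Fmod ?F i" using bd' by (simp add: cycles_def)
  next
    have "hom_of (*) ?e ` Fmod ?F 0 = ideal.span (\<psi> ` (e ` basis F 0))"
      using hom_of_image_span[OF module_times, of ?e "basis F 0"]
      by (simp add: Fmod_def image_image)
    also have "\<dots> = J"
      unfolding J exact_res_span[OF F] by (rule ideal_span_image[OF \<psi>, symmetric])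
    finally show "hom_of (*) ?e ` Fmod ?F 0 = J" .
  next
    fix i
    show "dmap ?F (Suc i) ` Fmod ?F (Suc i) = cycles ?F ?e i"
    proof (intro equalityI subsetI)
      fix z assume "z \<in> dmap ?F (Suc i) ` Fmod ?F (Suc i)"
      then obtain y where y: "y \<in> Fmod ?F (Suc i)" "z = hom_of smult (bdry ?F (Suc i)) y"
        unfolding dmap_def by blast
      have yb: "bdry ?F (Suc i) b \<in> cycles ?F ?e i" if "b \<in> keys y" for b
        using bd' FmodD[OF y(1) that] by blast
      have "z \<in> Fmod ?F i"
        unfolding y(2) by (rule hom_of_Fmod[OF y(1)]) (use bd' in \<open>simp add: cycles_def\<close>)
      moreover have "hom_of (*) ?e z = 0" if "i = 0"
      proof -
        have "hom_of (*) ?e z = hom_of (*) (\<lambda>b. 0) y"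
          unfolding y(2) hom_of_hom_of[OF module_times]
          by (rule hom_of_cong) (use yb that in \<open>simp add: cycles_def\<close>)
        then show ?thesis by (simp add: hom_of_def)
      qed
      moreover have "dmap ?F i z = 0" if "i \<noteq> 0"
      proof -
        have "dmap ?F i z = hom_of smult (\<lambda>b. 0) y"
          unfolding y(2) dmap_hom_of
          by (rule hom_of_cong) (use yb that in \<open>simp add: cycles_def\<close>)
        then show ?thesis by (simp add: hom_of_def module.scale_zero_right[OF module_smult])
      qed
      ultimately show "z \<in> cycles ?F ?e i" by (simp add: cycles_def)
    next
      fix z assume z: "z \<in> cycles ?F ?e i"
      then have zF: "z \<in> Fmod ?F i" by (simp add: cycles_def)
      have "hom_of smult (f' i) z \<in> cycles ?T ?e' i" by (rule chain_map_cycles[OF f' z])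
      then have "hom_of smult (f' i) z \<in> dmap ?T (Suc i) ` Fmod ?T (Suc i)"
        using T by (simp add: exact_res_def)
      then obtain w where w: "w \<in> Fmod ?T (Suc i)" "hom_of smult (f' i) z = dmap ?T (Suc i) w"
        by blast
      have "hom_of smult (g' i) (hom_of smult (f' i) z) = dmap ?F (Suc i) (hom_of smult (g' (Suc i)) w)"
        unfolding w(2) by (rule chain_map_dmap[OF g' w(1), symmetric])
      moreover have "dmap ?F (Suc i) (hom_of smult (h' i) z)
          = hom_of smult (g' i) (hom_of smult (f' i) z) - z"
        unfolding homotopy_cycles[OF h' z] hom_of_img_diff[OF module_smult]
        by (simp add: hom_of_single_id hom_of_hom_of[OF module_smult])
      ultimately have "z = dmap ?F (Suc i) (hom_of smult (g' (Suc i)) w) - dmap ?F (Suc i) (hom_of smult (h' i) z)"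
        by simp
      then have "z = dmap ?F (Suc i) (hom_of smult (g' (Suc i)) w - hom_of smult (h' i) z)"
        unfolding dmap_def hom_of_diff[OF module_smult] .
      moreover have "hom_of smult (g' (Suc i)) w \<in> Fmod ?F (Suc i)"
        by (rule chain_map_hom_Fmod[OF g' w(1)])
      moreover have "hom_of smult (h' i) z \<in> Fmod ?F (Suc i)"
        by (rule hom_of_Fmod[OF zF]) (use h' in \<open>simp add: homotopy_def\<close>)
      ultimately show "z \<in> dmap ?F (Suc i) ` Fmod ?F (Suc i)"
        unfolding Fmod_def using free_module_diff by blast
    qed
  qed
qed

lemma algebra_hom_single:
  assumes "algebra_hom \<psi>" "\<And>m. \<psi> (monom m) = monom (D m)"
  shows "\<psi> (single m c) = single (D m) c"
proof -
  have "single m c = Const c * monom m" by (simp add: Const_def monom_def mult_single)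
  then have "\<psi> (single m c) = Const c * monom (D m)"
    using assms by (simp add: algebra_hom_def)
  then show ?thesis by (simp add: Const_def monom_def mult_single)
qed

lemma homogeneous_algebra_hom:
  assumes \<psi>: "algebra_hom \<psi>" and D: "\<And>m. \<psi> (monom m) = monom (D m)"
    and w: "\<And>m. wt' (D m) = \<phi> (wt m)" and p: "homogeneous wt d p"
  shows "homogeneous wt' (\<phi> d) (\<psi> p)"
proof -
  have "\<psi> p = (\<Sum>m\<in>keys p. single (D m) (lookup p m))"
    by (subst poly_mapping_sum_single[OF finite_keys order_refl, of p]) (simp only: algebra_hom_sum[OF \<psi>] algebra_hom_single[OF \<psi> D])
  moreover have "homogeneous wt' (\<phi> d) (\<Sum>m\<in>keys p. single (D m) (lookup p m))"
    using p by (intro homogeneous_sum) (simp add: homogeneous_def w)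
  ultimately show ?thesis by simp
qed

lemma graded_at_base_change:
  assumes \<psi>: "algebra_hom \<psi>" and D: "\<And>m. \<psi> (monom m) = monom (D m)"
    and w: "\<And>m. wt' (D m) = \<phi> (wt m)" and \<phi>: "\<And>x y. \<phi> (x - y) = \<phi> x - \<phi> y"
    and F: "graded_at wt F e"
  shows "graded_at wt' (base_change \<psi> (regrade \<phi> F)) (\<lambda>b. \<psi> (e b))"
  unfolding graded_at_def
proof (intro conjI allI ballI)
  fix b assume "b \<in> basis (base_change \<psi> (regrade \<phi> F)) 0"
  then show "homogeneous wt' (dgr (base_change \<psi> (regrade \<phi> F)) 0 b) (\<psi> (e b))"
    using F homogeneous_algebra_hom[of \<psi> D wt' \<phi> wt, OF \<psi> D w] by (simp add: graded_at_def)
next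
  fix i b assume "b \<in> basis (base_change \<psi> (regrade \<phi> F)) (Suc i)"
  then have b: "Fhomogeneous wt F i (dgr F (Suc i) b) (bdry F (Suc i) b)"
    using F by (simp add: graded_at_def)
  then have "ext_scalars \<psi> (bdry F (Suc i) b) \<in> Fmod (base_change \<psi> (regrade \<phi> F)) i"
    by (intro ext_scalars_Fmod[OF \<psi>]) (simp add: Fhomogeneous_def)
  then show "Fhomogeneous wt' (base_change \<psi> (regrade \<phi> F)) i (dgr (base_change \<psi> (regrade \<phi> F)) (Suc i) b)
      (bdry (base_change \<psi> (regrade \<phi> F)) (Suc i) b)"
    using homogeneous_algebra_hom[of \<psi> D wt' \<phi> wt, OF \<psi> D w Fhomogeneous_lookup[OF b]]
    unfolding Fhomogeneous_def by (simp add: lookup_ext_scalars[OF \<psi>] \<phi>)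
qed

lemma graded_at_regrade:
  assumes w: "\<And>m. wt' m = \<phi> (wt m)" and \<phi>: "\<And>x y. \<phi> (x - y) = \<phi> x - \<phi> y"
    and F: "graded_at wt F e"
  shows "graded_at wt' (regrade \<phi> F) e"
  using F unfolding graded_at_def Fhomogeneous_def homogeneous_def by (simp add: w \<phi>)

section \<open>Ranks of minimal resolutions\<close>

text \<open>
  The rows of \<open>A\<close> are linearly independent, because \<open>B\<close> recovers the coefficients of a linear combination.
\<close>

lemma card_le_of_left_inverse:
  fixes A :: "'b \<Rightarrow> 'c \<Rightarrow> 'k::field" and B :: "'c \<Rightarrow> 'b \<Rightarrow> 'k"
  assumes "finite X" "finite Y"
    and inv: "\<And>b b'. b \<in> X \<Longrightarrow> b' \<in> X \<Longrightarrow> (\<Sum>c\<in>Y. A b c * B c b') = (if b = b' then 1 else 0)"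
  shows "card X \<le> card Y"
proof -
  interpret V: vector_space "smult :: 'k \<Rightarrow> ('c \<Rightarrow>\<^sub>0 'k) \<Rightarrow> _"
    using module_smult by (simp add: module_def vector_space_def)
  define a where "a b = (\<Sum>c\<in>Y. single c (A b c))" for b
  have lk: "lookup (a b) c = A b c" if "c \<in> Y" for b c
    using \<open>finite Y\<close> that by (simp add: a_def lookup_sum lookup_single when_def)
  have coeff: "x b' = 0" if "(\<Sum>b\<in>X. smult (x b) (a b)) = 0" "b' \<in> X" for x b'
  proof -
    have "0 = (\<Sum>c\<in>Y. lookup (\<Sum>b\<in>X. smult (x b) (a b)) c * B c b')"
      using that by simp
    also have "\<dots> = (\<Sum>c\<in>Y. \<Sum>b\<in>X. x b * (A b c * B c b'))"
      by (intro sum.cong refl) (simp add: lookup_sum lk sum_distrib_right mult.assoc)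
    also have "\<dots> = (\<Sum>b\<in>X. x b * (\<Sum>c\<in>Y. A b c * B c b'))"
      by (subst sum.swap) (simp add: sum_distrib_left)
    also have "\<dots> = (\<Sum>b\<in>X. if b = b' then x b else 0)"
      using inv that(2) by (intro sum.cong) auto
    also have "\<dots> = x b'" using \<open>finite X\<close> that(2) by simp
    finally show ?thesis by simp
  qed
  have inj: "inj_on a X"
  proof (rule inj_onI, rule ccontr)
    fix b1 b2 assume b: "b1 \<in> X" "b2 \<in> X" "a b1 = a b2" "b1 \<noteq> b2"
    have "(\<Sum>b\<in>X. smult (if b = b1 then 1 else if b = b2 then -1 else 0) (a b))
        = (\<Sum>b\<in>{b1, b2}. smult (if b = b1 then 1 else if b = b2 then -1 else 0) (a b))"
      using \<open>finite X\<close> b by (intro sum.mono_neutral_right) auto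
    also have "\<dots> = 0" using b by simp
    finally show False using coeff[of "\<lambda>b. if b = b1 then 1 else if b = b2 then -1 else 0" b1] b by simp
  qed
  have "V.independent (a ` X)"
  proof (rule V.independent_if_scalars_zero)
    fix f x assume "(\<Sum>x\<in>a ` X. smult (f x) x) = 0" "x \<in> a ` X"
    then show "f x = 0"
      using coeff[of "\<lambda>b. f (a b)"] by (auto simp: sum.reindex[OF inj])
  qed (use \<open>finite X\<close> in simp)
  moreover have "a ` X \<subseteq> V.span ((\<lambda>c. single c 1) ` Y)"
  proof (rule image_subsetI)
    fix b
    have "a b = (\<Sum>c\<in>Y. smult (A b c) (single c 1))" by (simp add: a_def smult_single)
    then show "a b \<in> V.span ((\<lambda>c. single c 1) ` Y)"
      by (simp add: V.span_sum V.span_scale V.span_base)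
  qed
  ultimately have "card (a ` X) \<le> card ((\<lambda>c. single c (1::'k)) ` Y)"
    using V.independent_span_bound[of "(\<lambda>c. single c 1) ` Y" "a ` X"] \<open>finite Y\<close> by simp
  also have "\<dots> \<le> card Y" by (rule card_image_le[OF \<open>finite Y\<close>])
  finally show ?thesis by (simp add: card_image[OF inj])
qed

lemma span_Var_const:
  assumes "p \<in> ideal.span (range Var)" shows "lookup p 0 = (0::'k::comm_ring_1)"
  using assms
proof (induction rule: ideal.span_induct_alt)
  case (step c x y)
  then obtain v where v: "x = Var v" by blast
  have "single v (Suc 0) \<noteq> 0"
    by (metis lookup_single_eq lookup_zero nat.distinct(1))
  then have "lookup x 0 = 0" by (simp add: v Var_def monom_def lookup_single when_def)
  then show ?case using step by (simp add: lookup_add lookup_times_0)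
qed simp

text \<open>
  Modulo the ideal of the variables the differential of \<open>M\<close> vanishes, so the homotopy formula \<open>g f - id = \<partial> h + h \<partial>\<close>
  becomes \<open>g f = id\<close>. The constant coefficients of the matrices of \<open>f\<close> and \<open>g\<close> are thus mutually inverse on one
  side, and since \<open>f\<close> is homogeneous its constant coefficients only connect basis elements of equal degree.
\<close>

lemma minimal_rank_le:
  fixes M :: "('b, 'v, 'g::ab_group_add, 'k::field) free_complex"
    and G :: "('c, 'v, 'g, 'k) free_complex"
  assumes wt: "grading wt" and M: "minimal_graded_free_resolution wt J M"
    and G: "graded_free_resolution wt J G" and fin: "finite (basis G i)"
  shows "card {b \<in> basis M i. dgr M i b \<in> X} \<le> card {c \<in> basis G i. dgr G i c \<in> X}"
proof -
  obtain e where e: "exact_res J M e" "graded_at wt M e"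
    using M graded_free_resolution_iff[OF wt] unfolding minimal_graded_free_resolution_def by blast
  obtain e' where e': "exact_res J G e'" "graded_at wt G e'"
    using G graded_free_resolution_iff[OF wt] by blast
  obtain f where f: "chain_map M e G e' f" "\<And>i b. b \<in> basis M i \<Longrightarrow> Fhomogeneous wt G i (dgr M i b) (f i b)"
    using comparison_map[OF wt e e'] by blast
  obtain g where g: "chain_map G e' M e g"
    using comparison_map[OF wt e' e] by blast
  obtain h where h: "homotopy M (\<lambda>i b. hom_of smult (g i) (f i b) - single b 1) h"
    using homotopy_equivalence[OF e(1) f(1) g] by blast
  have min: "lookup (lookup z c) 0 = 0" if "z \<in> dmap M (Suc j) ` Fmod M (Suc j)" for j z c
    using M that span_Var_const unfolding minimal_graded_free_resolution_def by blast
  define A where "A b c = lookup (lookup (f i b) c) 0" for b c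
  define B where "B c b = lookup (lookup (g i c) b) 0" for b c
  have prod: "(\<Sum>c\<in>basis G i. A b c * B c b') = (if b = b' then 1 else 0)"
    if b: "b \<in> basis M i" for b b'
  proof -
    have fb: "f i b \<in> Fmod G i" using f(1) b by (simp add: chain_map_def)
    then have ks: "keys (f i b) \<subseteq> basis G i" by (simp add: Fmod_def free_module_def)
    have hb: "h i b \<in> Fmod M (Suc i)" using h b by (simp add: homotopy_def)
    have "lookup (lookup (hom_of smult (g i) (f i b) - single b 1) b') 0 = 0"
    proof (cases i)
      case 0
      then have "hom_of smult (g i) (f i b) - single b 1 = dmap M (Suc 0) (h 0 b)"
        using h b by (simp add: homotopy_def)
      then show ?thesis using min[of "dmap M (Suc 0) (h 0 b)" 0] hb 0 by simp
    next
      case (Suc j)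
      then have "hom_of smult (g i) (f i b) - single b 1
          = dmap M (Suc i) (h i b) + hom_of smult (h j) (bdry M i b)"
        using h b by (simp add: homotopy_def)
      moreover have "lookup (lookup (dmap M (Suc i) (h i b)) b') 0 = 0"
        by (rule min[OF imageI[OF hb]])
      moreover have "lookup (lookup (hom_of smult (h j) (bdry M i b)) b') 0 = 0"
      proof -
        have "bdry M i b \<in> dmap M (Suc j) ` Fmod M (Suc j)"
          using Fmod_single[of b M i 1] dmap_single[of M i b] b Suc by (metis image_eqI)
        then show ?thesis
          by (simp add: lookup_hom_of lookup_sum lookup_times_0 min)
      qed
      ultimately show ?thesis by (simp add: lookup_add)
    qed
    then have "lookup (lookup (hom_of smult (g i) (f i b)) b') 0 = (if b = b' then 1 else 0)"
      by (simp add: lookup_minus lookup_single when_def split: if_splits)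
    moreover have "lookup (lookup (hom_of smult (g i) (f i b)) b') 0 = (\<Sum>c\<in>basis G i. A b c * B c b')"
      by (subst hom_of_mono[OF module_smult fin ks]) (simp add: lookup_sum lookup_times_0 A_def B_def)
    ultimately show ?thesis by simp
  qed
  have Azero: "A b c = 0" if "b \<in> basis M i" "dgr G i c \<noteq> dgr M i b" for b c
  proof (rule ccontr)
    assume "A b c \<noteq> 0"
    then have "0 \<in> keys (lookup (f i b) c)" by (simp add: A_def in_keys_iff)
    then have "wt 0 = dgr M i b - dgr G i c"
      using Fhomogeneous_lookup[OF f(2)[OF that(1)], of c] by (simp add: homogeneous_def)
    then show False using wt that(2) by (simp add: grading_def)
  qed
  show ?thesis
  proof (rule card_le_of_left_inverse)
    show "finite {b \<in> basis M i. dgr M i b \<in> X}"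
      using M by (simp add: minimal_graded_free_resolution_def)
    show "finite {c \<in> basis G i. dgr G i c \<in> X}" using fin by simp
    fix b b' assume b: "b \<in> {b \<in> basis M i. dgr M i b \<in> X}" "b' \<in> {b \<in> basis M i. dgr M i b \<in> X}"
    have "(\<Sum>c\<in>{c \<in> basis G i. dgr G i c \<in> X}. A b c * B c b') = (\<Sum>c\<in>basis G i. A b c * B c b')"
    proof (rule sum.mono_neutral_left[OF fin])
      show "\<forall>c\<in>basis G i - {c \<in> basis G i. dgr G i c \<in> X}. A b c * B c b' = 0"
        using Azero[of b] b(1) by (auto, metis)
    qed auto
    then show "(\<Sum>c\<in>{c \<in> basis G i. dgr G i c \<in> X}. A b c * B c b') = (if b = b' then 1 else 0)"
      using prod b(1) by simp
  qed
qed

section \<open>Frames\<close>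

text \<open>
  Given subspaces \<open>K l\<close> growing with \<open>l\<close> in a finite poset, this chooses finitely many vectors \<open>\<delta> j\<close> of degree \<open>dg j\<close> such
  that \<open>K l\<close> is spanned by those of degree below \<open>l\<close>. In degree \<open>l\<close> one takes a basis of \<open>K l\<close> modulo the span
  \<open>N l\<close> of the smaller \<open>K l'\<close>; for this choice a linear relation among vectors of degree below \<open>l\<close>
  cannot involve those of degree exactly \<open>l\<close>, which is the minimality of the resolution to be built.
\<close>

lemma frame_step:
  fixes K :: "'l \<Rightarrow> (nat \<Rightarrow>\<^sub>0 'k::field) set" and le :: "'l \<Rightarrow> 'l \<Rightarrow> bool"
  assumes "finite L" "finite B"
    and refl: "\<And>l. le l l" and trans: "\<And>a b c. le a b \<Longrightarrow> le b c \<Longrightarrow> le a c"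
    and antisym: "\<And>a b. le a b \<Longrightarrow> le b a \<Longrightarrow> a = b"
    and sub: "\<And>l. l \<in> L \<Longrightarrow> module.subspace smult (K l)"
    and fm: "\<And>l. l \<in> L \<Longrightarrow> K l \<subseteq> free_module B"
    and mono: "\<And>l l'. l \<in> L \<Longrightarrow> l' \<in> L \<Longrightarrow> le l l' \<Longrightarrow> K l \<subseteq> K l'"
  shows "\<exists>(n::nat) dg \<delta>. (\<forall>j<n. dg j \<in> L) \<and>
     (\<forall>l\<in>L. hom_of smult \<delta> ` free_module {j. j < n \<and> le (dg j) l} = K l) \<and>
     (\<forall>l\<in>L. \<forall>c\<in>free_module {j. j < n \<and> le (dg j) l}. hom_of smult \<delta> c = 0 \<longrightarrow>
        (\<forall>j<n. dg j = l \<longrightarrow> lookup c j = 0))"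
proof -
  interpret V: vector_space "smult :: 'k \<Rightarrow> (nat \<Rightarrow>\<^sub>0 'k) \<Rightarrow> _"
    using module_smult by (simp add: module_def vector_space_def)
  define N where "N l = V.span (\<Union>l'\<in>{l'\<in>L. le l' l \<and> l' \<noteq> l}. K l')" for l
  have NK: "N l \<subseteq> K l" if "l \<in> L" for l
    unfolding N_def using mono that by (intro V.span_minimal sub) auto
  have fin: "finite S" if S: "V.independent S" "S \<subseteq> K l" "l \<in> L" for S l
  proof -
    have "S \<subseteq> V.span ((\<lambda>b. single b 1) ` B)"
      using hom_of_image_span[OF module_smult, of "\<lambda>b. single b (1::'k)" B] S(2) fm[OF S(3)]
      unfolding hom_of_single_id by auto
    then show ?thesis
      using V.independent_span_bound[OF _ S(1)] \<open>finite B\<close> by blast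
  qed
  \<comment> \<open>\<open>C\<close> is a basis of \<open>K l\<close> modulo \<open>N l\<close>.\<close>
  define good where "good l C \<longleftrightarrow> finite C \<and> C \<subseteq> K l \<and> K l \<subseteq> V.span (N l \<union> C) \<and>
      (\<forall>x. (\<Sum>v\<in>C. smult (x v) v) \<in> N l \<longrightarrow> (\<forall>v\<in>C. x v = 0))" for l C
  have "\<exists>C. finite C \<and> C \<subseteq> K l \<and> K l \<subseteq> V.span (N l \<union> C) \<and>
      (\<forall>x. (\<Sum>v\<in>C. smult (x v) v) \<in> N l \<longrightarrow> (\<forall>v\<in>C. x v = 0))" if l: "l \<in> L" for l
  proof -
    obtain B0 where B0: "B0 \<subseteq> N l" "V.independent B0" "N l \<subseteq> V.span B0"
      using V.maximal_independent_subset by blast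
    obtain B1 where B1: "B0 \<subseteq> B1" "B1 \<subseteq> K l" "V.independent B1" "K l \<subseteq> V.span B1"
      using V.maximal_independent_subset_extend[of B0 "K l"] B0 NK[OF l] by (metis subset_trans)
    have f1: "finite B1" by (rule fin[OF B1(3,2) l])
    then have f0: "finite B0" using B1(1) finite_subset by blast
    have "K l \<subseteq> V.span (N l \<union> (B1 - B0))"
      using B1(4) V.span_mono[of B1 "N l \<union> (B1 - B0)"] B0(1) by blast
    moreover have "x v = 0" if x: "(\<Sum>v\<in>B1 - B0. smult (x v) v) \<in> N l" and v: "v \<in> B1 - B0" for x v
    proof -
      obtain y where y: "(\<Sum>v\<in>B1 - B0. smult (x v) v) = (\<Sum>v\<in>B0. smult (y v) v)"
        using x B0(3) V.span_finite[OF f0] by blast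
      have "(\<Sum>v\<in>B1. smult (if v \<in> B0 then - y v else x v) v) =
          (\<Sum>v\<in>B1 - B0. smult (x v) v) + (\<Sum>v\<in>B0. smult (- y v) v)"
        unfolding sum.subset_diff[OF B1(1) f1] by (intro arg_cong2[of _ _ _ _ "(+)"] sum.cong) auto
      also have "\<dots> = 0" by (simp add: y sum_negf)
      finally have "(if v \<in> B0 then - y v else x v) = 0"
        using V.independentD[OF B1(3) f1 order_refl, of "\<lambda>v. if v \<in> B0 then - y v else x v"] v by blast
      then show ?thesis using v by simp
    qed
    ultimately have "finite (B1 - B0) \<and> B1 - B0 \<subseteq> K l \<and> K l \<subseteq> V.span (N l \<union> (B1 - B0)) \<and>
        (\<forall>x. (\<Sum>v\<in>B1 - B0. smult (x v) v) \<in> N l \<longrightarrow> (\<forall>v\<in>B1 - B0. x v = 0))"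
      using f1 B1(2) by (intro conjI allI impI ballI) auto
    then show ?thesis by (rule exI)
  qed
  then have "\<forall>l\<in>L. \<exists>C. good l C" unfolding good_def by (rule ballI)
  then obtain C where good: "\<forall>l\<in>L. good l (C l)" unfolding bchoice_iff ..
  have C: "finite (C l)" "C l \<subseteq> K l" "K l \<subseteq> V.span (N l \<union> C l)"
    "\<And>x. (\<Sum>v\<in>C l. smult (x v) v) \<in> N l \<Longrightarrow> \<forall>v\<in>C l. x v = 0" if "l \<in> L" for l
    using bspec[OF good that] unfolding good_def by simp_all
  have "finite (Sigma L C)" using \<open>finite L\<close> C(1) by blast
  then obtain h where h: "bij_betw h {0..<card (Sigma L C)} (Sigma L C)"
    using ex_bij_betw_nat_finite by blast
  define n where "n = card (Sigma L C)"
  define dg where "dg j = fst (h j)" for j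
  define \<delta> where "\<delta> j = snd (h j)" for j
  have hj: "h j \<in> Sigma L C" if "j < n" for j
    using bij_betw_apply[OF h, of j] that by (simp add: n_def)
  have dgL: "dg j \<in> L" "\<delta> j \<in> C (dg j)" if "j < n" for j
    using hj[OF that] unfolding dg_def \<delta>_def by auto
  have hex: "\<exists>j<n. dg j = l \<and> \<delta> j = v" if "l \<in> L" "v \<in> C l" for l v
  proof -
    have "(l, v) \<in> h ` {0..<n}" using bij_betw_imp_surj_on[OF h] that by (simp add: n_def)
    then obtain j where "j < n" "h j = (l, v)" by auto
    then show ?thesis unfolding dg_def \<delta>_def by (intro exI[of _ j]) simp
  qed
  have hinj: "j = j'" if "j < n" "j' < n" "dg j = dg j'" "\<delta> j = \<delta> j'" for j j'
    using h that unfolding n_def bij_betw_def inj_on_def dg_def \<delta>_def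
    by (metis atLeastLessThan_iff prod.collapse zero_le)
  define T where "T l = {j. j < n \<and> le (dg j) l}" for l
  have upper: "V.span (\<delta> ` T l) \<subseteq> K l" if "l \<in> L" for l
  proof (rule V.span_minimal[OF _ sub[OF that]])
    show "\<delta> ` T l \<subseteq> K l"
      using dgL C(2) mono that unfolding T_def by blast
  qed
  have lower: "K l \<subseteq> V.span (\<delta> ` T l)" if "l \<in> L" for l
    using that
  proof (induction "card {l'\<in>L. le l' l}" arbitrary: l rule: less_induct)
    case less
    have "K l' \<subseteq> V.span (\<delta> ` T l)" if l': "l' \<in> L" "le l' l" "l' \<noteq> l" for l'
    proof -
      have "{x\<in>L. le x l'} \<subset> {x\<in>L. le x l}"
        using l' less.prems trans antisym refl by blast
      then have "card {x\<in>L. le x l'} < card {x\<in>L. le x l}"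
        using \<open>finite L\<close> by (intro psubset_card_mono) auto
      then have "K l' \<subseteq> V.span (\<delta> ` T l')" using less l' by blast
      moreover have "T l' \<subseteq> T l" using l' trans unfolding T_def by blast
      ultimately show ?thesis using V.span_mono[of "\<delta> ` T l'" "\<delta> ` T l"] by blast
    qed
    then have "N l \<subseteq> V.span (\<delta> ` T l)"
      unfolding N_def by (intro V.span_minimal V.subspace_span) blast
    moreover have "C l \<subseteq> \<delta> ` T l"
      using hex[OF less.prems] refl unfolding T_def by blast
    then have "C l \<subseteq> V.span (\<delta> ` T l)" using V.span_superset by blast
    ultimately have "V.span (N l \<union> C l) \<subseteq> V.span (\<delta> ` T l)"
      by (intro V.span_minimal V.subspace_span) blast
    then show ?case using C(3)[OF less.prems] by blast
  qed
  have "hom_of smult \<delta> ` free_module (T l) = K l" if "l \<in> L" for l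
    unfolding hom_of_image_span[OF module_smult] using upper lower that by blast
  moreover have "lookup c j = 0" if l: "l \<in> L" and c: "c \<in> free_module (T l)" "hom_of smult \<delta> c = 0"
    and j: "j < n" "dg j = l" for l c j
  proof -
    define J1 where "J1 = {j. j < n \<and> dg j = l}"
    define J2 where "J2 = {j. j < n \<and> le (dg j) l \<and> dg j \<noteq> l}"
    have TJ: "T l = J1 \<union> J2" "J1 \<inter> J2 = {}" "finite J1" "finite J2"
      unfolding T_def J1_def J2_def using refl by auto
    have "0 = (\<Sum>j\<in>J1 \<union> J2. smult (lookup c j) (\<delta> j))"
      using c TJ hom_of_mono[OF module_smult, of "J1 \<union> J2" c \<delta>] by (simp add: free_module_def)
    also have "\<dots> = (\<Sum>j\<in>J1. smult (lookup c j) (\<delta> j)) + (\<Sum>j\<in>J2. smult (lookup c j) (\<delta> j))"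
      by (rule sum.union_disjoint[OF TJ(3,4,2)])
    finally have s1: "(\<Sum>j\<in>J1. smult (lookup c j) (\<delta> j)) = - (\<Sum>j\<in>J2. smult (lookup c j) (\<delta> j))"
      by (simp add: eq_neg_iff_add_eq_0)
    have "(\<Sum>j\<in>J2. smult (lookup c j) (\<delta> j)) \<in> N l"
      unfolding N_def
    proof (intro V.span_sum V.span_scale V.span_base)
      fix j assume "j \<in> J2"
      then show "\<delta> j \<in> (\<Union>l'\<in>{l' \<in> L. le l' l \<and> l' \<noteq> l}. K l')"
        using dgL[of j] C(2)[of "dg j"] unfolding J2_def by blast
    qed
    then have s2: "(\<Sum>j\<in>J1. smult (lookup c j) (\<delta> j)) \<in> N l"
      unfolding s1 N_def by (rule V.span_neg)
    have inj: "inj_on \<delta> J1" using hinj unfolding inj_on_def J1_def by simp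
    have im: "\<delta> ` J1 = C l" using dgL hex[OF l] unfolding J1_def by blast
    \<comment> \<open>The coefficients \<open>c\<close> transported from indices to the vectors of \<open>C l\<close>.\<close>
    define x where "x v = lookup c (inv_into J1 \<delta> v)" for v
    have "(\<Sum>v\<in>C l. smult (x v) v) = (\<Sum>j\<in>J1. smult (lookup c j) (\<delta> j))"
      unfolding im[symmetric] sum.reindex[OF inj] using inj by (intro sum.cong) (simp_all add: x_def)
    then have "\<forall>v\<in>C l. x v = 0" using C(4)[OF l] s2 by simp
    moreover have "\<delta> j \<in> C l" "inv_into J1 \<delta> (\<delta> j) = j"
      using dgL(2)[OF j(1)] j inj by (simp_all add: J1_def)
    ultimately show ?thesis unfolding x_def by metis
  qed
  ultimately have "(\<forall>j<n. dg j \<in> L) \<and>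
     (\<forall>l\<in>L. hom_of smult \<delta> ` free_module {j. j < n \<and> le (dg j) l} = K l) \<and>
     (\<forall>l\<in>L. \<forall>c\<in>free_module {j. j < n \<and> le (dg j) l}. hom_of smult \<delta> c = 0 \<longrightarrow>
        (\<forall>j<n. dg j = l \<longrightarrow> lookup c j = 0))"
    using dgL(1) unfolding T_def by (intro conjI allI impI ballI)
  then show ?thesis by (intro exI)
qed

definition below :: "nat \<Rightarrow> (nat \<Rightarrow> 'v monom) \<Rightarrow> 'v monom \<Rightarrow> nat set" where
  "below n dg l = {j. j < n \<and> dg j \<unlhd> l}"

text \<open>
  A frame is the scalar shadow of a resolution: in step \<open>i\<close> there are \<open>n i\<close> basis vectors with degrees \<open>dg i j\<close> in
  \<open>L\<close>, and for each \<open>l\<close> in \<open>L\<close> the basis vectors of degree below \<open>l\<close> form an exact complex of vector spaces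
  augmented onto the one-dimensional space with basis vector \<open>0\<close>.
\<close>

definition frame :: "'v monom set \<Rightarrow> (nat \<Rightarrow> nat) \<Rightarrow> (nat \<Rightarrow> nat \<Rightarrow> 'v monom) \<Rightarrow>
    (nat \<Rightarrow> nat \<Rightarrow> nat \<Rightarrow>\<^sub>0 'k::field) \<Rightarrow> bool" where
  "frame L n dg \<delta> \<longleftrightarrow> (\<forall>i. \<forall>j<n i. dg i j \<in> L) \<and>
     (\<forall>l\<in>L. hom_of smult (\<delta> 0) ` free_module (below (n 0) (dg 0) l) = free_module {0}) \<and>
     (\<forall>i. \<forall>l\<in>L. hom_of smult (\<delta> (Suc i)) ` free_module (below (n (Suc i)) (dg (Suc i)) l)
        = {c \<in> free_module (below (n i) (dg i) l). hom_of smult (\<delta> i) c = 0})"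

text \<open>
  Kernels have no component in the top degree \<open>l\<close>, so after homogenization every entry of the differential is
  a multiple of a variable.
\<close>

definition minimal_frame :: "'v monom set \<Rightarrow> (nat \<Rightarrow> nat) \<Rightarrow> (nat \<Rightarrow> nat \<Rightarrow> 'v monom) \<Rightarrow>
    (nat \<Rightarrow> nat \<Rightarrow> nat \<Rightarrow>\<^sub>0 'k::field) \<Rightarrow> bool" where
  "minimal_frame L n dg \<delta> \<longleftrightarrow> (\<forall>i. \<forall>l\<in>L. \<forall>c\<in>free_module (below (n i) (dg i) l).
      hom_of smult (\<delta> i) c = 0 \<longrightarrow> (\<forall>j<n i. dg i j = l \<longrightarrow> lookup c j = 0))"

lemma frame_exists:
  assumes "finite (L :: 'v monom set)"
  shows "\<exists>n dg (\<delta> :: nat \<Rightarrow> nat \<Rightarrow> nat \<Rightarrow>\<^sub>0 'k::field). frame L n dg \<delta> \<and> minimal_frame L n dg \<delta>"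
proof -
  interpret V: vector_space "smult :: 'k \<Rightarrow> (nat \<Rightarrow>\<^sub>0 'k) \<Rightarrow> _"
    using module_smult by (simp add: module_def vector_space_def)
  note step = frame_step[where le = mdvd, OF assms _ mdvd_refl mdvd_trans mdvd_antisym, folded below_def]
  define P where "P i x \<longleftrightarrow> (case x of (n, dg, \<delta> :: nat \<Rightarrow> nat \<Rightarrow>\<^sub>0 'k) \<Rightarrow>
      (\<forall>j<n. dg j \<in> L) \<and>
      (i = (0::nat) \<longrightarrow> (\<forall>l\<in>L. hom_of smult \<delta> ` free_module (below n dg l) = free_module {0})) \<and>
      (\<forall>l\<in>L. \<forall>c\<in>free_module (below n dg l). hom_of smult \<delta> c = 0 \<longrightarrow> (\<forall>j<n. dg j = l \<longrightarrow> lookup c j = 0)))" for i x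
  define Q where "Q i x x' \<longleftrightarrow> (case x of (n, dg, \<delta> :: nat \<Rightarrow> nat \<Rightarrow>\<^sub>0 'k) \<Rightarrow> case x' of (n', dg', \<delta>') \<Rightarrow>
      (\<forall>l\<in>L. hom_of smult \<delta>' ` free_module (below n' dg' l)
        = {c \<in> free_module (below n dg l). hom_of smult \<delta> c = 0}))"
    for i :: nat and x x' :: "nat \<times> (nat \<Rightarrow> 'v monom) \<times> (nat \<Rightarrow> nat \<Rightarrow>\<^sub>0 'k)"
  have subfm: "V.subspace (free_module B)" for B
    by (intro V.subspaceI free_module_add free_module_smult free_module_zero)
  have "\<exists>f. \<forall>i. P i (f i) \<and> Q i (f i) (f (Suc i))"
  proof (rule dependent_nat_choice)
    have "\<exists>n dg \<delta>. (\<forall>j<n. dg j \<in> L) \<and>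
       (\<forall>l\<in>L. hom_of smult \<delta> ` free_module (below n dg l) = (free_module {0} :: (nat \<Rightarrow>\<^sub>0 'k) set)) \<and>
       (\<forall>l\<in>L. \<forall>c\<in>free_module (below n dg l). hom_of smult \<delta> c = 0 \<longrightarrow> (\<forall>j<n. dg j = l \<longrightarrow> lookup c j = 0))"
      by (rule step[where B = "{0}"]) (simp_all add: subfm)
    then obtain n dg and \<delta> :: "nat \<Rightarrow> nat \<Rightarrow>\<^sub>0 'k" where "P 0 (n, dg, \<delta>)"
      unfolding P_def by auto
    then show "\<exists>x. P 0 x" by blast
  next
    fix x i assume "P i x"
    obtain n dg and \<delta> :: "nat \<Rightarrow> nat \<Rightarrow>\<^sub>0 'k" where x: "x = (n, dg, \<delta>)" by (cases x)
    have "\<exists>n' dg' \<delta>'. (\<forall>j<n'. dg' j \<in> L) \<and>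
       (\<forall>l\<in>L. hom_of smult \<delta>' ` free_module (below n' dg' l)
          = {c \<in> free_module (below n dg l). hom_of smult \<delta> c = 0}) \<and>
       (\<forall>l\<in>L. \<forall>c\<in>free_module (below n' dg' l). hom_of smult \<delta>' c = 0 \<longrightarrow> (\<forall>j<n'. dg' j = l \<longrightarrow> lookup c j = 0))"
    proof (rule step[where B = "{..<n}"])
      fix l
      show "V.subspace {c \<in> free_module (below n dg l). hom_of smult \<delta> c = 0}"
        by (rule V.subspaceI)
          (simp_all add: free_module_add free_module_smult hom_of_add[OF module_smult] hom_of_smult[OF module_smult])
      show "{c \<in> free_module (below n dg l). hom_of smult \<delta> c = 0} \<subseteq> free_module {..<n}"
        unfolding free_module_def below_def by blast
    next
      fix l l' :: "'v monom" assume "l \<unlhd> l'"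
      then have "below n dg l \<subseteq> below n dg l'" unfolding below_def using mdvd_trans by blast
      then show "{c \<in> free_module (below n dg l). hom_of smult \<delta> c = 0}
          \<subseteq> {c \<in> free_module (below n dg l'). hom_of smult \<delta> c = 0}"
        unfolding free_module_def by blast
    qed simp
    then obtain n' dg' and \<delta>' :: "nat \<Rightarrow> nat \<Rightarrow>\<^sub>0 'k" where "P (Suc i) (n', dg', \<delta>') \<and> Q i x (n', dg', \<delta>')"
      unfolding P_def Q_def x by auto
    then show "\<exists>x'. P (Suc i) x' \<and> Q i x x'" by blast
  qed
  then obtain f where f: "\<And>i. P i (f i)" "\<And>i. Q i (f i) (f (Suc i))" by blast
  define n where "n i = fst (f i)" for i
  define dg where "dg i = fst (snd (f i))" for i
  define \<delta> where "\<delta> i = snd (snd (f i))" for i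
  have fi: "f i = (n i, dg i, \<delta> i)" for i by (simp add: n_def dg_def \<delta>_def)
  have "frame L n dg \<delta> \<and> minimal_frame L n dg \<delta>"
    using f unfolding fi frame_def minimal_frame_def P_def Q_def by simp
  then show ?thesis by blast
qed

section \<open>Homogenization of frames\<close>

text \<open>
  The element of degree \<open>e\<close> of the free module with basis degrees \<open>d\<close> that has the scalars \<open>c\<close> as its coefficients.
\<close>

definition homogenize :: "(nat \<Rightarrow> 'v monom) \<Rightarrow> 'v monom \<Rightarrow> (nat \<Rightarrow>\<^sub>0 'k::field) \<Rightarrow> (nat \<Rightarrow>\<^sub>0 ('v, 'k) mpoly)" where
  "homogenize d e c = Poly_Mapping.mapp (\<lambda>j x. single (e - d j) x) c"

text \<open>
  The inverse operation: the scalars in the component of degree \<open>e\<close>.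
\<close>

definition strand :: "(nat \<Rightarrow> 'v monom) \<Rightarrow> 'v monom \<Rightarrow> (nat \<Rightarrow>\<^sub>0 ('v, 'k::field) mpoly) \<Rightarrow> (nat \<Rightarrow>\<^sub>0 'k)" where
  "strand d e f = Poly_Mapping.mapp (\<lambda>j p. if d j \<unlhd> e then lookup p (e - d j) else 0) f"

lemma lookup_homogenize: "lookup (homogenize d e c) j = single (e - d j) (lookup c j)"
  unfolding homogenize_def lookup_mapp by (auto simp: when_def in_keys_iff)

lemma keys_homogenize: "keys (homogenize d e c) \<subseteq> keys c"
  unfolding homogenize_def by (rule keys_mapp_subset)

lemma lookup_strand: "lookup (strand d e f) j = (if d j \<unlhd> e then lookup (lookup f j) (e - d j) else 0)"
  unfolding strand_def lookup_mapp by (auto simp: when_def in_keys_iff)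

lemma keys_strand: "keys (strand d e f) \<subseteq> {j \<in> keys f. d j \<unlhd> e}"
  by (auto simp: in_keys_iff lookup_strand split: if_splits)

lemma strand_add: "strand d e (f + g) = strand d e f + strand d e g"
  by (rule poly_mapping_eqI) (simp add: lookup_strand lookup_add)

lemma strand_zero [simp]: "strand d e 0 = 0"
  by (rule poly_mapping_eqI) (simp add: lookup_strand)

lemma strand_sum: "strand d e (sum h A) = (\<Sum>a\<in>A. strand d e (h a))"
  by (induction A rule: infinite_finite_induct) (simp_all add: strand_add)

lemma strand_ext:
  assumes "\<And>e. strand d e f = strand d e g" shows "f = g"
proof (intro poly_mapping_eqI)
  fix j m
  have "lookup (strand d (m + d j) f) j = lookup (strand d (m + d j) g) j" using assms by simp
  then show "lookup (lookup f j) m = lookup (lookup g j) m"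
    by (simp add: lookup_strand)
qed

lemma finite_strands: "finite {e. strand d e f \<noteq> 0}"
proof (rule finite_subset)
  show "{e. strand d e f \<noteq> 0} \<subseteq> (\<Union>j\<in>keys f. (\<lambda>m. m + d j) ` keys (lookup f j))"
  proof
    fix e assume "e \<in> {e. strand d e f \<noteq> 0}"
    then obtain j where "lookup (strand d e f) j \<noteq> 0"
      using poly_mapping_eqI[of "strand d e f" 0] by auto
    then have j: "d j \<unlhd> e" "lookup (lookup f j) (e - d j) \<noteq> 0" by (auto simp: lookup_strand split: if_splits)
    then have "j \<in> keys f" "e - d j \<in> keys (lookup f j)" by (auto simp: in_keys_iff)
    then show "e \<in> (\<Union>j\<in>keys f. (\<lambda>m. m + d j) ` keys (lookup f j))"
      using image_eqI[of e "\<lambda>m. m + d j" "e - d j" "keys (lookup f j)"] mdvd_diff(2)[OF j(1)] by auto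
  qed
qed simp

lemma strand_homogenize:
  assumes "\<And>j. j \<in> keys c \<Longrightarrow> d j \<unlhd> e"
  shows "strand d e' (homogenize d e c) = (if e = e' then c else 0)"
proof (rule poly_mapping_eqI)
  fix j
  show "lookup (strand d e' (homogenize d e c)) j = lookup (if e = e' then c else 0) j"
  proof (cases "j \<in> keys c")
    case True
    then have j: "d j \<unlhd> e" by (rule assms)
    have "e - d j = e' - d j \<longleftrightarrow> e = e'" if "d j \<unlhd> e'"
      using mdvd_diff(2)[OF j] mdvd_diff(2)[OF that] by metis
    then show ?thesis
      using j by (auto simp: lookup_strand lookup_homogenize lookup_single when_def)
  next
    case False
    then show ?thesis by (simp add: lookup_strand lookup_homogenize in_keys_iff)
  qed
qed

lemma mdvd_diff_diff:
  assumes "a \<unlhd> b" "a \<unlhd> e"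
  shows "b - a \<unlhd> e - a \<longleftrightarrow> b \<unlhd> e" "b \<unlhd> e \<Longrightarrow> (e - a) - (b - a) = e - b"
proof -
  show "b - a \<unlhd> e - a \<longleftrightarrow> b \<unlhd> e"
    using mdvd_cancel[of "b - a" a "e - a"] mdvd_diff(2) assms by metis
  show "(e - a) - (b - a) = e - b" if "b \<unlhd> e"
    using assms that unfolding mdvd_def by (intro poly_mapping_eqI) (simp add: lookup_minus)
qed

text \<open>
  In each degree the homogenized map acts by the scalar matrix \<open>a\<close>.
\<close>

lemma strand_hom_of:
  assumes A: "\<And>j. j \<in> keys f \<Longrightarrow> A j = homogenize d' (d j) (a j)"
    and a: "\<And>j j'. j \<in> keys f \<Longrightarrow> j' \<in> keys (a j) \<Longrightarrow> d' j' \<unlhd> d j"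
  shows "strand d' e (hom_of smult A f) = hom_of smult a (strand d e f)"
proof (rule poly_mapping_eqI)
  fix j'
  have ks: "keys (strand d e f) \<subseteq> keys f" using keys_strand[of d e f] by blast
  have "(if d' j' \<unlhd> e then lookup (lookup f j * lookup (A j) j') (e - d' j') else 0)
      = lookup (strand d e f) j * lookup (a j) j'" if j: "j \<in> keys f" for j
  proof (cases "j' \<in> keys (a j)")
    case False
    then show ?thesis by (simp add: A[OF j] lookup_homogenize in_keys_iff)
  next
    case True
    then have dd: "d' j' \<unlhd> d j" by (rule a[OF j])
    show ?thesis
    proof (cases "d' j' \<unlhd> e")
      case True
      then show ?thesis
        using mdvd_diff_diff[OF dd True] by (simp add: A[OF j] lookup_homogenize lookup_times_single lookup_strand)
    next
      case False
      then have "\<not> d j \<unlhd> e" using dd mdvd_trans by blast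
      then show ?thesis using False by (simp add: lookup_strand)
    qed
  qed
  then have "(\<Sum>j\<in>keys f. if d' j' \<unlhd> e then lookup (lookup f j * lookup (A j) j') (e - d' j') else 0)
      = (\<Sum>j\<in>keys f. lookup (strand d e f) j * lookup (a j) j')"
    by (rule sum.cong[OF refl])
  moreover have "lookup (hom_of smult a (strand d e f)) j' = (\<Sum>j\<in>keys f. lookup (strand d e f) j * lookup (a j) j')"
    by (subst hom_of_mono[OF module_smult finite_keys ks]) (simp add: lookup_sum)
  moreover have "lookup (strand d' e (hom_of smult A f)) j'
      = (\<Sum>j\<in>keys f. if d' j' \<unlhd> e then lookup (lookup f j * lookup (A j) j') (e - d' j') else 0)"
    by (cases "d' j' \<unlhd> e") (simp_all add: lookup_strand lookup_hom_of lookup_sum)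
  ultimately show "lookup (strand d' e (hom_of smult A f)) j' = lookup (hom_of smult a (strand d e f)) j'"
    by simp
qed

lemma lookup_hom_of_augmentation:
  "lookup (hom_of (*) (\<lambda>j. single (d j) (lookup (a j) 0)) f) e = lookup (hom_of smult a (strand d e f)) (0::nat)"
proof -
  have ks: "keys (strand d e f) \<subseteq> keys f" using keys_strand[of d e f] by blast
  show ?thesis
    by (subst hom_of_mono[OF module_smult finite_keys ks])
      (simp add: lookup_sum hom_of_def lookup_times_single lookup_strand, intro sum.cong refl, simp)
qed

text \<open>
  Preimages can be found separately in each degree; only finitely many degrees occur in \<open>f\<close>.
\<close>

lemma glue_strands:
  fixes d :: "nat \<Rightarrow> 'v monom" and d' :: "nat \<Rightarrow> 'v monom"
    and A :: "nat \<Rightarrow> (nat \<Rightarrow>\<^sub>0 ('v, 'k::field) mpoly)"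
  assumes A: "\<And>j. j \<in> B \<Longrightarrow> A j = homogenize d' (d j) (a j)"
    and a: "\<And>j j'. j \<in> B \<Longrightarrow> j' \<in> keys (a j) \<Longrightarrow> d' j' \<unlhd> d j"
    and ex: "\<And>e. \<exists>y\<in>free_module {j\<in>B. d j \<unlhd> e}. hom_of smult a y = strand d' e f"
  shows "f \<in> hom_of smult A ` free_module B"
proof -
  obtain Y where Y: "\<And>e. Y e \<in> free_module {j\<in>B. d j \<unlhd> e}" "\<And>e. hom_of smult a (Y e) = strand d' e f"
    using ex by metis
  define E where "E = {e. strand d' e f \<noteq> 0}"
  have finE: "finite E" unfolding E_def by (rule finite_strands)
  define g where "g = (\<Sum>e\<in>E. homogenize d e (Y e))"
  have YB: "keys (Y e) \<subseteq> B" "\<And>j. j \<in> keys (Y e) \<Longrightarrow> d j \<unlhd> e" for e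
    using Y(1)[of e] by (auto simp: free_module_def)
  have gB: "g \<in> free_module B"
    unfolding g_def
  proof (intro free_module_sum)
    fix e show "homogenize d e (Y e) \<in> free_module B"
      using keys_homogenize[of d e "Y e"] YB(1)[of e] unfolding free_module_def by blast
  qed
  have sg: "strand d e g = (if e \<in> E then Y e else 0)" for e
    unfolding g_def strand_sum using finE by (simp add: strand_homogenize[OF YB(2)])
  have gk: "j \<in> B" if "j \<in> keys g" for j using gB that by (auto simp: free_module_def)
  have "hom_of smult A g = f"
  proof (rule strand_ext)
    fix e
    have "strand d' e (hom_of smult A g) = hom_of smult a (strand d e g)"
      by (rule strand_hom_of[OF A a]) (auto dest: gk)
    also have "\<dots> = strand d' e f"
      unfolding sg using Y(2) by (auto simp: E_def)
    finally show "strand d' e (hom_of smult A g) = strand d' e f" .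
  qed
  then show ?thesis using gB by blast
qed

lemma glue_augmentation:
  fixes d :: "nat \<Rightarrow> 'v monom" and p :: "('v, 'k::field) mpoly"
  assumes ex: "\<And>e. e \<in> keys p \<Longrightarrow> \<exists>y\<in>free_module {j\<in>B. d j \<unlhd> e}. hom_of smult a y = single (0::nat) (lookup p e)"
  shows "p \<in> hom_of (*) (\<lambda>j. single (d j) (lookup (a j) 0)) ` free_module B"
proof -
  obtain Y where Y: "\<And>e. e \<in> keys p \<Longrightarrow> Y e \<in> free_module {j\<in>B. d j \<unlhd> e}"
    "\<And>e. e \<in> keys p \<Longrightarrow> hom_of smult a (Y e) = single 0 (lookup p e)"
    using ex by metis
  define g where "g = (\<Sum>e\<in>keys p. homogenize d e (Y e))"
  have YB: "keys (Y e) \<subseteq> B" "\<And>j. j \<in> keys (Y e) \<Longrightarrow> d j \<unlhd> e" if "e \<in> keys p" for e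
    using Y(1)[OF that] by (auto simp: free_module_def)
  have gB: "g \<in> free_module B"
    unfolding g_def
  proof (intro free_module_sum)
    fix e assume "e \<in> keys p"
    then show "homogenize d e (Y e) \<in> free_module B"
      using keys_homogenize[of d e "Y e"] YB(1)[of e] unfolding free_module_def by blast
  qed
  have sg: "strand d e g = (if e \<in> keys p then Y e else 0)" for e
  proof -
    have "strand d e g = (\<Sum>e'\<in>keys p. if e' = e then Y e' else 0)"
      unfolding g_def strand_sum by (intro sum.cong refl strand_homogenize YB(2))
    then show ?thesis by simp
  qed
  have "hom_of (*) (\<lambda>j. single (d j) (lookup (a j) 0)) g = p"
  proof (rule poly_mapping_eqI)
    fix e
    show "lookup (hom_of (*) (\<lambda>j. single (d j) (lookup (a j) 0)) g) e = lookup p e"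
      unfolding lookup_hom_of_augmentation sg using Y(2) by (auto simp: in_keys_iff)
  qed
  then show ?thesis using gB by blast
qed

lemma lookup_mdeg: "lookup (mdeg m) v = int (lookup m v)"
  by (simp add: mdeg_def map.rep_eq when_def)

lemma mdeg_add: "mdeg (a + b) = mdeg a + mdeg b"
  by (rule poly_mapping_eqI) (simp add: lookup_mdeg lookup_add)

lemma mdeg_zero [simp]: "mdeg 0 = 0"
  by (rule poly_mapping_eqI) (simp add: lookup_mdeg)

lemma mdeg_eq_iff [simp]: "mdeg a = mdeg b \<longleftrightarrow> a = b"
proof
  assume "mdeg a = mdeg b"
  then have "lookup a v = lookup b v" for v by (metis lookup_mdeg of_nat_eq_iff)
  then show "a = b" by (rule poly_mapping_eqI)
qed simp

lemma grading_mdeg: "grading mdeg"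
  by (simp add: grading_def mdeg_add)

lemma mdeg_diff: "a \<unlhd> b \<Longrightarrow> mdeg (b - a) = mdeg b - mdeg a"
  using mdeg_add[of "b - a" a] mdvd_diff(2)[of a b] by simp

lemma tdeg_eq: "tdeg (m :: 'v::finite monom) = (\<Sum>v\<in>UNIV. lookup (mdeg m) v)"
  unfolding tdeg_def by (intro sum.mono_neutral_cong_left) (auto simp: lookup_mdeg in_keys_iff)

lemma grading_tdeg: "grading (tdeg :: 'v::finite monom \<Rightarrow> int)"
  by (simp add: grading_def tdeg_eq mdeg_add lookup_add sum.distrib)

text \<open>
  The complex over the polynomial ring in which the frame degree \<open>l\<close> is realized as \<open>D l\<close>. Taking the identity for \<open>D\<close>
  resolves \<open>\<J>\<close>, and taking the monomial map gives its base change. The source index \<open>i - 1\<close> is meant for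
  \<open>i > 0\<close>; at \<open>i = 0\<close> it is a default value.
\<close>

definition frame_complex :: "('z monom \<Rightarrow> 'x monom) \<Rightarrow> (nat \<Rightarrow> nat) \<Rightarrow> (nat \<Rightarrow> nat \<Rightarrow> 'z monom) \<Rightarrow>
    (nat \<Rightarrow> nat \<Rightarrow> nat \<Rightarrow>\<^sub>0 'k::field) \<Rightarrow> (nat, 'x, 'x \<Rightarrow>\<^sub>0 int, 'k) free_complex" where
  "frame_complex D n dg \<delta> = \<lparr>basis = (\<lambda>i. {..<n i}), dgr = (\<lambda>i j. mdeg (D (dg i j))),
     bdry = (\<lambda>i j. homogenize (\<lambda>j'. D (dg (i - 1) j')) (D (dg i j)) (\<delta> i j))\<rparr>"

definition frame_augmentation :: "('z monom \<Rightarrow> 'x monom) \<Rightarrow> (nat \<Rightarrow> nat \<Rightarrow> 'z monom) \<Rightarrow>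
    (nat \<Rightarrow> nat \<Rightarrow> nat \<Rightarrow>\<^sub>0 'k::field) \<Rightarrow> nat \<Rightarrow> ('x, 'k) mpoly" where
  "frame_augmentation D dg \<delta> j = single (D (dg 0 j)) (lookup (\<delta> 0 j) 0)"

lemma frame_complex_simps [simp]:
  "basis (frame_complex D n dg \<delta>) i = {..<n i}" "dgr (frame_complex D n dg \<delta>) i j = mdeg (D (dg i j))"
  "bdry (frame_complex D n dg \<delta>) (Suc i) j = homogenize (\<lambda>j'. D (dg i j')) (D (dg (Suc i) j)) (\<delta> (Suc i) j)"
  by (simp_all add: frame_complex_def)

lemma frame_diff_ker:
  assumes fr: "frame L n dg \<delta>" and j: "j < n (Suc i)"
  shows "\<delta> (Suc i) j \<in> free_module (below (n i) (dg i) (dg (Suc i) j))" "hom_of smult (\<delta> i) (\<delta> (Suc i) j) = 0"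
proof -
  have l: "dg (Suc i) j \<in> L" using fr j by (simp add: frame_def)
  have "single j 1 \<in> free_module (below (n (Suc i)) (dg (Suc i)) (dg (Suc i) j))"
    using j by (intro free_module_single) (simp add: below_def)
  then have "hom_of smult (\<delta> (Suc i)) (single j 1) \<in> hom_of smult (\<delta> (Suc i)) `
      free_module (below (n (Suc i)) (dg (Suc i)) (dg (Suc i) j))"
    by (rule imageI)
  also have "\<dots> = {c \<in> free_module (below (n i) (dg i) (dg (Suc i) j)). hom_of smult (\<delta> i) c = 0}"
    using fr l unfolding frame_def by blast
  finally show "\<delta> (Suc i) j \<in> free_module (below (n i) (dg i) (dg (Suc i) j))" "hom_of smult (\<delta> i) (\<delta> (Suc i) j) = 0"
    by (simp_all add: hom_of_single[OF module_smult])
qed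

lemma frame_diff_0:
  assumes fr: "frame L n dg \<delta>" and j: "j < n 0"
  shows "\<delta> 0 j \<in> free_module {0}"
proof -
  have l: "dg 0 j \<in> L" using fr j by (simp add: frame_def)
  have "single j 1 \<in> free_module (below (n 0) (dg 0) (dg 0 j))"
    using j by (intro free_module_single) (simp add: below_def)
  then have "hom_of smult (\<delta> 0) (single j 1) \<in> hom_of smult (\<delta> 0) ` free_module (below (n 0) (dg 0) (dg 0 j))"
    by (rule imageI)
  also have "\<dots> = free_module {0}" using fr l unfolding frame_def by blast
  finally show ?thesis by (simp add: hom_of_single[OF module_smult])
qed

lemma free_module_singleton_eq_0:
  assumes "c \<in> free_module {b}" "lookup c b = 0" shows "c = 0"
proof (rule poly_mapping_eqI)
  fix k show "lookup c k = lookup 0 k"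
    using assms unfolding free_module_def by (cases "k = b") (auto simp: in_keys_iff)
qed

text \<open>
  The basis elements occurring in multidegree \<open>e\<close> are those with frame degree below \<open>l0\<close>, or none at all, so the
  exactness of the frame at \<open>l0\<close> is exactness in degree \<open>e\<close>.
\<close>

lemma frame_in_degree:
  fixes D :: "'z monom \<Rightarrow> 'x monom" and \<delta> :: "nat \<Rightarrow> nat \<Rightarrow> nat \<Rightarrow>\<^sub>0 'k::field"
  assumes fr: "frame L n dg \<delta>"
    and max: "\<And>e. (\<forall>l\<in>L. \<not> D l \<unlhd> e) \<or> (\<exists>l0\<in>L. \<forall>l\<in>L. D l \<unlhd> e \<longleftrightarrow> l \<unlhd> l0)"
  shows "hom_of smult (\<delta> (Suc i)) ` free_module {j\<in>{..<n (Suc i)}. D (dg (Suc i) j) \<unlhd> e}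
      = {c \<in> free_module {j\<in>{..<n i}. D (dg i j) \<unlhd> e}. hom_of smult (\<delta> i) c = 0}"
    and "\<exists>l\<in>L. D l \<unlhd> e \<Longrightarrow> hom_of smult (\<delta> 0) ` free_module {j\<in>{..<n 0}. D (dg 0 j) \<unlhd> e} = free_module {0}"
proof -
  have dL: "dg i j \<in> L" if "j < n i" for i j using fr that by (simp add: frame_def)
  have b: "{j\<in>{..<n i}. D (dg i j) \<unlhd> e} = below (n i) (dg i) l0" if "\<forall>l\<in>L. D l \<unlhd> e \<longleftrightarrow> l \<unlhd> l0" for l0 i
    using dL that unfolding below_def by blast
  show "hom_of smult (\<delta> (Suc i)) ` free_module {j\<in>{..<n (Suc i)}. D (dg (Suc i) j) \<unlhd> e}
      = {c \<in> free_module {j\<in>{..<n i}. D (dg i j) \<unlhd> e}. hom_of smult (\<delta> i) c = 0}"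
    using max[of e]
  proof
    assume "\<forall>l\<in>L. \<not> D l \<unlhd> e"
    then have "{j\<in>{..<n i}. D (dg i j) \<unlhd> e} = {}" for i using dL by blast
    moreover have "free_module ({} :: nat set) = {0 :: nat \<Rightarrow>\<^sub>0 'k}" by (auto simp: free_module_def)
    ultimately have "free_module {j\<in>{..<n i}. D (dg i j) \<unlhd> e} = {0 :: nat \<Rightarrow>\<^sub>0 'k}" for i
      by (simp only:)
    then show ?thesis by (simp only:) auto
  next
    assume "\<exists>l0\<in>L. \<forall>l\<in>L. D l \<unlhd> e \<longleftrightarrow> l \<unlhd> l0"
    then obtain l0 where l0: "l0 \<in> L" "\<forall>l\<in>L. D l \<unlhd> e \<longleftrightarrow> l \<unlhd> l0" by blast
    show ?thesis unfolding b[OF l0(2)] using fr l0(1) unfolding frame_def by blast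
  qed
  assume "\<exists>l\<in>L. D l \<unlhd> e"
  then obtain l0 where l0: "l0 \<in> L" "\<forall>l\<in>L. D l \<unlhd> e \<longleftrightarrow> l \<unlhd> l0" using max[of e] by blast
  show "hom_of smult (\<delta> 0) ` free_module {j\<in>{..<n 0}. D (dg 0 j) \<unlhd> e} = free_module {0}"
    unfolding b[OF l0(2)] using fr l0(1) unfolding frame_def by blast
qed

lemma exact_res_frame_complex:
  fixes D :: "'z monom \<Rightarrow> 'x monom" and \<delta> :: "nat \<Rightarrow> nat \<Rightarrow> nat \<Rightarrow>\<^sub>0 'k::field"
  assumes fr: "frame L n dg \<delta>"
    and mono: "\<And>a b. a \<unlhd> b \<Longrightarrow> D a \<unlhd> D b"
    and max: "\<And>e. (\<forall>l\<in>L. \<not> D l \<unlhd> e) \<or> (\<exists>l0\<in>L. \<forall>l\<in>L. D l \<unlhd> e \<longleftrightarrow> l \<unlhd> l0)"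
  shows "exact_res (ideal.span (monom ` D ` L)) (frame_complex D n dg \<delta>) (frame_augmentation D dg \<delta>)"
proof -
  let ?F = "frame_complex D n dg \<delta>" and ?d = "\<lambda>i j. D (dg i j)"
  define Bd where "Bd i e = {j\<in>{..<n i}. ?d i j \<unlhd> e}" for i e
  note deg = frame_in_degree[OF fr max, folded Bd_def]
  have kd: "?d i j' \<unlhd> ?d (Suc i) j" "j' < n i" if "j < n (Suc i)" "j' \<in> keys (\<delta> (Suc i) j)" for i j j'
  proof -
    have "j' \<in> below (n i) (dg i) (dg (Suc i) j)"
      using frame_diff_ker(1)[OF fr that(1)] that(2) by (auto simp: free_module_def)
    then show "?d i j' \<unlhd> ?d (Suc i) j" "j' < n i" using mono by (simp_all add: below_def)
  qed
  have bF: "bdry ?F (Suc i) j \<in> Fmod ?F i" if "j < n (Suc i)" for i j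
    using kd(2)[OF that] keys_homogenize[of "?d i" "?d (Suc i) j" "\<delta> (Suc i) j"]
    unfolding Fmod_def free_module_def by auto
  have st: "strand (?d i) e (dmap ?F (Suc i) f) = hom_of smult (\<delta> (Suc i)) (strand (?d (Suc i)) e f)"
    if "f \<in> Fmod ?F (Suc i)" for i e f
  proof -
    have k: "j < n (Suc i)" if "j \<in> keys f" for j using FmodD[OF \<open>f \<in> Fmod ?F (Suc i)\<close> that] by simp
    show ?thesis unfolding dmap_def
      by (rule strand_hom_of) (use k kd in \<open>auto\<close>)
  qed
  have sB: "strand (?d i) e f \<in> free_module (Bd i e)" if "f \<in> Fmod ?F i" for i e f
  proof -
    have "keys f \<subseteq> {..<n i}" using that by (simp add: Fmod_def free_module_def)
    then show ?thesis using keys_strand[of "?d i" e f] unfolding free_module_def Bd_def by blast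
  qed
  have aug: "lookup (hom_of (*) (frame_augmentation D dg \<delta>) f) e = lookup (hom_of smult (\<delta> 0) (strand (?d 0) e f)) 0" for f e
    using lookup_hom_of_augmentation[of "?d 0" "\<delta> 0" f e] by (simp add: frame_augmentation_def[abs_def])
  have cycles: "f \<in> cycles ?F (frame_augmentation D dg \<delta>) i \<longleftrightarrow> f \<in> Fmod ?F i \<and> (\<forall>e. hom_of smult (\<delta> i) (strand (?d i) e f) = 0)" for f i
  proof (cases i)
    case 0
    have "hom_of (*) (frame_augmentation D dg \<delta>) f = 0 \<longleftrightarrow> (\<forall>e. hom_of smult (\<delta> 0) (strand (?d 0) e f) = 0)"
      if f: "f \<in> Fmod ?F 0"
    proof -
      have "hom_of smult (\<delta> 0) (strand (?d 0) e f) \<in> free_module {0}" for e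
        by (rule hom_of_free_module[OF sB[OF f]]) (use frame_diff_0[OF fr] in \<open>simp add: Bd_def\<close>)
      then have "hom_of smult (\<delta> 0) (strand (?d 0) e f) = 0 \<longleftrightarrow> lookup (hom_of smult (\<delta> 0) (strand (?d 0) e f)) 0 = 0" for e
        using free_module_singleton_eq_0 lookup_zero by metis
      then show ?thesis unfolding aug[symmetric] poly_mapping_eq_iff by (simp add: fun_eq_iff)
    qed
    then show ?thesis using 0 by (auto simp: cycles_def)
  next
    case (Suc k)
    have "dmap ?F (Suc k) f = 0 \<longleftrightarrow> (\<forall>e. hom_of smult (\<delta> (Suc k)) (strand (?d (Suc k)) e f) = 0)"
      if f: "f \<in> Fmod ?F (Suc k)"
      unfolding st[OF f, symmetric] using strand_ext[of "?d k" "dmap ?F (Suc k) f" 0] by auto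
    then show ?thesis using Suc by (auto simp: cycles_def)
  qed
  show ?thesis
    unfolding exact_res_def
  proof (intro conjI allI ballI)
    fix i j assume "j \<in> basis ?F (Suc i)"
    then show "bdry ?F (Suc i) j \<in> Fmod ?F i" using bF by simp
  next
    show "hom_of (*) (frame_augmentation D dg \<delta>) ` Fmod ?F 0 = ideal.span (monom ` D ` L)"
    proof
      have "frame_augmentation D dg \<delta> j \<in> ideal.span (monom ` D ` L)" if "j < n 0" for j
      proof -
        have "dg 0 j \<in> L" using fr that by (simp add: frame_def)
        then have "\<exists>u\<in>D ` L. u \<unlhd> D (dg 0 j)" using mdvd_refl by blast
        then show ?thesis unfolding span_monom frame_augmentation_def by simp
      qed
      then show "hom_of (*) (frame_augmentation D dg \<delta>) ` Fmod ?F 0 \<subseteq> ideal.span (monom ` D ` L)"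
        unfolding Fmod_def hom_of_image_span[OF module_times]
        by (intro ideal.span_minimal ideal.subspace_span) auto
      show "ideal.span (monom ` D ` L) \<subseteq> hom_of (*) (frame_augmentation D dg \<delta>) ` Fmod ?F 0"
      proof
        fix p :: "('x, 'k) mpoly" assume p: "p \<in> ideal.span (monom ` D ` L)"
        have "p \<in> hom_of (*) (\<lambda>j. single (?d 0 j) (lookup (\<delta> 0 j) 0)) ` free_module {..<n 0}"
        proof (rule glue_augmentation)
          fix e assume "e \<in> keys p"
          then have ex: "\<exists>l\<in>L. D l \<unlhd> e" using p unfolding span_monom by blast
          have "single 0 (lookup p e) \<in> hom_of smult (\<delta> 0) ` free_module (Bd 0 e)"
            unfolding deg(2)[OF ex] by (simp add: free_module_single)
          then show "\<exists>y\<in>free_module {j\<in>{..<n 0}. ?d 0 j \<unlhd> e}. hom_of smult (\<delta> 0) y = single 0 (lookup p e)"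
            unfolding Bd_def by (metis (no_types, lifting) imageE)
        qed
        then show "p \<in> hom_of (*) (frame_augmentation D dg \<delta>) ` Fmod ?F 0"
          by (simp add: frame_augmentation_def[abs_def] Fmod_def)
      qed
    qed
  next
    fix i
    show "dmap ?F (Suc i) ` Fmod ?F (Suc i) = cycles ?F (frame_augmentation D dg \<delta>) i"
    proof (intro equalityI subsetI)
      fix z assume "z \<in> dmap ?F (Suc i) ` Fmod ?F (Suc i)"
      then obtain f where f: "f \<in> Fmod ?F (Suc i)" "z = dmap ?F (Suc i) f" by blast
      have "z \<in> Fmod ?F i"
        unfolding f(2) dmap_def by (rule hom_of_Fmod[OF f(1)]) (use bF in simp)
      moreover have "hom_of smult (\<delta> i) (strand (?d i) e z) = 0" for e
        using imageI[OF sB[OF f(1), of e], of "hom_of smult (\<delta> (Suc i))"]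
        unfolding deg(1) f(2) st[OF f(1)] by simp
      ultimately show "z \<in> cycles ?F (frame_augmentation D dg \<delta>) i" unfolding cycles by simp
    next
      fix z assume "z \<in> cycles ?F (frame_augmentation D dg \<delta>) i"
      then have z: "z \<in> Fmod ?F i" "\<And>e. hom_of smult (\<delta> i) (strand (?d i) e z) = 0" unfolding cycles by auto
      have "z \<in> hom_of smult (bdry ?F (Suc i)) ` free_module {..<n (Suc i)}"
      proof (rule glue_strands[where d = "?d (Suc i)" and d' = "?d i" and a = "\<delta> (Suc i)"])
        fix e
        have "strand (?d i) e z \<in> hom_of smult (\<delta> (Suc i)) ` free_module (Bd (Suc i) e)"
          unfolding deg(1) using sB[OF z(1)] z(2) by simp
        then show "\<exists>y\<in>free_module {j\<in>{..<n (Suc i)}. ?d (Suc i) j \<unlhd> e}. hom_of smult (\<delta> (Suc i)) y = strand (?d i) e z"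
          unfolding Bd_def by (metis (no_types, lifting) imageE)
      qed (use kd in auto)
      then show "z \<in> dmap ?F (Suc i) ` Fmod ?F (Suc i)"
        by (simp add: dmap_def Fmod_def)
    qed
  qed
qed

lemma graded_at_frame_complex:
  fixes D :: "'z monom \<Rightarrow> 'x monom"
  assumes fr: "frame L n dg \<delta>" and mono: "\<And>a b. a \<unlhd> b \<Longrightarrow> D a \<unlhd> D b"
  shows "graded_at mdeg (frame_complex D n dg \<delta>) (frame_augmentation D dg \<delta>)"
  unfolding graded_at_def
proof (intro conjI allI ballI)
  fix j
  show "homogeneous mdeg (dgr (frame_complex D n dg \<delta>) 0 j) (frame_augmentation D dg \<delta> j)"
    by (simp add: frame_augmentation_def homogeneous_def)
next
  fix i j assume "j \<in> basis (frame_complex D n dg \<delta>) (Suc i)"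
  then have j: "\<delta> (Suc i) j \<in> free_module (below (n i) (dg i) (dg (Suc i) j))"
    using frame_diff_ker(1)[OF fr] by simp
  then have "bdry (frame_complex D n dg \<delta>) (Suc i) j \<in> Fmod (frame_complex D n dg \<delta>) i"
    using keys_homogenize[of "\<lambda>j'. D (dg i j')" "D (dg (Suc i) j)" "\<delta> (Suc i) j"]
    unfolding Fmod_def free_module_def below_def by auto
  moreover have "homogeneous mdeg (mdeg (D (dg (Suc i) j)) - mdeg (D (dg i j')))
      (single (D (dg (Suc i) j) - D (dg i j')) (lookup (\<delta> (Suc i) j) j'))" for j'
  proof (cases "j' \<in> keys (\<delta> (Suc i) j)")
    case True
    then have "D (dg i j') \<unlhd> D (dg (Suc i) j)" using j mono unfolding free_module_def below_def by blast
    then show ?thesis by (simp add: homogeneous_def mdeg_diff)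
  next
    case False
    then show ?thesis by (simp add: in_keys_iff)
  qed
  ultimately show "Fhomogeneous mdeg (frame_complex D n dg \<delta>) i (dgr (frame_complex D n dg \<delta>) (Suc i) j) (bdry (frame_complex D n dg \<delta>) (Suc i) j)"
    unfolding Fhomogeneous_def by (simp add: lookup_homogenize)
qed

lemma single_in_span_Var:
  assumes "m \<noteq> 0" shows "single m c \<in> ideal.span (range (Var :: _ \<Rightarrow> ('v, 'k::comm_ring_1) mpoly))"
proof -
  obtain v where v: "lookup m v \<noteq> 0" using assms poly_mapping_eqI[of m 0] by auto
  have "single v 1 \<unlhd> m" using v unfolding mdvd_def by (auto simp: lookup_single when_def)
  then have "single m c = single (m - single v 1) c * Var v"
    using mdvd_diff(2)[of "single v 1" m] by (simp add: Var_def monom_def mult_single del: One_nat_def)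
  then show ?thesis using ideal.span_scale[OF ideal.span_base[OF rangeI[of Var v]]] by simp
qed

lemma minimal_frame_complex:
  assumes fr: "frame L n dg \<delta>" and m: "minimal_frame L n dg \<delta>"
    and f: "f \<in> dmap (frame_complex (\<lambda>m. m) n dg \<delta>) (Suc i) ` Fmod (frame_complex (\<lambda>m. m) n dg \<delta>) (Suc i)"
  shows "lookup f b \<in> ideal.span (range Var)"
proof -
  let ?F = "frame_complex (\<lambda>m. m) n dg \<delta>"
  obtain y where y: "y \<in> Fmod ?F (Suc i)" "f = hom_of smult (bdry ?F (Suc i)) y"
    using f unfolding dmap_def by blast
  have "lookup (bdry ?F (Suc i) j) b \<in> ideal.span (range Var)" if "j \<in> keys y" for j
  proof -
    have j: "j < n (Suc i)" using FmodD[OF y(1) that] by simp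
    have l: "dg (Suc i) j \<in> L" using fr j by (simp add: frame_def)
    note k = frame_diff_ker[OF fr j]
    have m': "lookup (\<delta> (Suc i) j) j' = 0" if "j' < n i" "dg i j' = dg (Suc i) j" for j'
      using m l k that unfolding minimal_frame_def by blast
    show ?thesis
    proof (cases "b \<in> keys (\<delta> (Suc i) j)")
      case True
      then have b: "b < n i" "dg i b \<unlhd> dg (Suc i) j" using k(1) unfolding free_module_def below_def by auto
      have "dg (Suc i) j - dg i b \<noteq> 0"
      proof
        assume "dg (Suc i) j - dg i b = 0"
        then have "dg i b = dg (Suc i) j" using mdvd_diff(1)[OF b(2)] by simp
        then show False using m'[OF b(1)] True by (simp add: in_keys_iff)
      qed
      then show ?thesis by (simp add: lookup_homogenize single_in_span_Var)
    next
      case False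
      then show ?thesis by (simp add: lookup_homogenize in_keys_iff ideal.span_zero)
    qed
  qed
  then show ?thesis unfolding y(2) lookup_hom_of
    by (intro ideal.span_sum ideal.span_scale)
qed

section \<open>Minimal generators\<close>

definition minimal_monoms :: "'v monom set \<Rightarrow> 'v monom set" where
  "minimal_monoms U = {a\<in>U. \<forall>b\<in>U. b \<unlhd> a \<longrightarrow> b = a}"

lemma minimal_monoms_below:
  assumes "u \<in> U" shows "\<exists>a\<in>minimal_monoms U. a \<unlhd> (u :: 'v::finite monom)"
  using assms
proof (induction "\<Sum>v\<in>UNIV. lookup u v" arbitrary: u rule: less_induct)
  case less
  show ?case
  proof (cases "u \<in> minimal_monoms U")
    case False
    then obtain b where b: "b \<in> U" "b \<unlhd> u" "b \<noteq> u" using less.prems by (auto simp: minimal_monoms_def)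
    then obtain v where "lookup b v \<noteq> lookup u v" using poly_mapping_eqI[of b u] by auto
    moreover have "lookup b v \<le> lookup u v" using b(2) by (simp add: mdvd_def)
    ultimately have "lookup b v < lookup u v" by simp
    then have "(\<Sum>v\<in>UNIV. lookup b v) < (\<Sum>v\<in>UNIV. lookup u v)"
      using b(2) by (intro sum_strict_mono_ex1) (auto simp: mdvd_def)
    then show ?thesis using less.hyps[OF _ b(1)] b(2) mdvd_trans by blast
  qed (use mdvd_refl in blast)
qed

lemma span_minimal_monoms: "ideal.span (monom ` minimal_monoms U) = ideal.span (monom ` (U :: 'v::finite monom set))"
proof -
  have "(\<exists>u\<in>minimal_monoms U. u \<unlhd> m) \<longleftrightarrow> (\<exists>u\<in>U. u \<unlhd> m)" for m
  proof
    assume "\<exists>u\<in>U. u \<unlhd> m"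
    then obtain u where u: "u \<in> U" "u \<unlhd> m" by blast
    obtain a where "a \<in> minimal_monoms U" "a \<unlhd> u" using minimal_monoms_below[OF u(1)] by blast
    then show "\<exists>u\<in>minimal_monoms U. u \<unlhd> m" using mdvd_trans[OF _ u(2)] by blast
  qed (auto simp: minimal_monoms_def)
  then show ?thesis unfolding span_monom by simp
qed

lemma monom_in_span:
  "monom a \<in> ideal.span (monom ` U :: ('v, 'k::{comm_ring_1,zero_neq_one}) mpoly set) \<longleftrightarrow> (\<exists>u\<in>U. u \<unlhd> a)"
  unfolding span_monom by simp

text \<open>
  A minimal monomial generating set is unique: it consists of the monomials of the ideal that are minimal for
  divisibility.
\<close>

lemma minimal_generators_span:
  "minimal_generators (ideal.span (monom ` U) :: ('v::finite, 'k::field) mpoly set) = minimal_monoms U"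
  unfolding minimal_generators_def
proof (rule the_equality)
  let ?J = "ideal.span (monom ` U) :: ('v, 'k) mpoly set"
  show "minimally_generates (minimal_monoms U) ?J"
    unfolding minimally_generates_def
  proof (intro conjI allI impI notI)
    fix G' assume G': "G' \<subset> minimal_monoms U" "ideal.span (monom ` G') = ?J"
    then obtain a where a: "a \<in> minimal_monoms U" "a \<notin> G'" by blast
    have "monom a \<in> ?J" using a mdvd_refl[of a] unfolding monom_in_span minimal_monoms_def by blast
    then obtain g where "g \<in> G'" "g \<unlhd> a" unfolding G'(2)[symmetric] monom_in_span by blast
    then show False using a G'(1) unfolding minimal_monoms_def by blast
  qed (rule span_minimal_monoms)
  fix G assume G: "minimally_generates G ?J"
  then have GJ: "ideal.span (monom ` G) = ?J" by (simp add: minimally_generates_def)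
  have "minimal_monoms U \<subseteq> G"
  proof
    fix a assume a: "a \<in> minimal_monoms U"
    have "monom a \<in> ?J" using a mdvd_refl[of a] unfolding monom_in_span minimal_monoms_def by blast
    then obtain g where g: "g \<in> G" "g \<unlhd> a" unfolding GJ[symmetric] monom_in_span by blast
    have "monom g \<in> ?J" using g(1) mdvd_refl[of g] unfolding GJ[symmetric] monom_in_span by blast
    then obtain u where u: "u \<in> U" "u \<unlhd> g" unfolding monom_in_span by blast
    have "u = a" using a u mdvd_trans[OF u(2) g(2)] unfolding minimal_monoms_def by blast
    then show "a \<in> G" using g mdvd_antisym[OF g(2)] u(2) by simp
  qed
  moreover have "\<not> minimal_monoms U \<subset> G" using G span_minimal_monoms unfolding minimally_generates_def by blast
  ultimately show "G = minimal_monoms U" by blast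
qed

section \<open>Monomial homomorphisms that preserve lcms\<close>

lemma exact_res_cong:
  assumes F: "exact_res J F e"
    and b: "\<And>i. basis G i = basis F i"
    and d: "\<And>i b. b \<in> basis F (Suc i) \<Longrightarrow> bdry G (Suc i) b = bdry F (Suc i) b"
    and e: "\<And>b. b \<in> basis F 0 \<Longrightarrow> e' b = e b"
  shows "exact_res J G e'"
proof -
  have m: "Fmod G i = Fmod F i" for i by (simp add: Fmod_def b)
  have dm: "dmap G (Suc i) f = dmap F (Suc i) f" if "f \<in> Fmod F (Suc i)" for i f
    unfolding dmap_def by (rule hom_of_cong) (use d FmodD[OF that] in simp)
  have ee: "hom_of (*) e' f = hom_of (*) e f" if "f \<in> Fmod F 0" for f
    by (rule hom_of_cong) (use e FmodD[OF that] in simp)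
  have "cycles G e' i = cycles F e i" for i
    unfolding cycles_def m using dm ee by (cases i) auto
  moreover have "dmap G (Suc i) ` Fmod F (Suc i) = dmap F (Suc i) ` Fmod F (Suc i)" for i
    by (rule image_cong) (use dm in auto)
  moreover have "hom_of (*) e' ` Fmod F 0 = hom_of (*) e ` Fmod F 0"
    by (rule image_cong) (use ee in auto)
  ultimately show ?thesis
    using F unfolding exact_res_def m by (simp add: b d)
qed

locale monomial_hom =
  fixes \<psi> :: "('z::finite, 'k::field) mpoly \<Rightarrow> ('x::finite, 'k) mpoly" and D :: "'z monom \<Rightarrow> 'x monom"
  assumes hom: "algebra_hom \<psi>" and monom: "\<And>m. \<psi> (monom m) = monom (D m)"
begin

lemma D_add: "D (a + b) = D a + D b"
proof -
  have "(monom (D (a + b)) :: ('x, 'k) mpoly) = monom (D a + D b)"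
    using hom by (simp add: monom[symmetric] monom_add algebra_hom_def)
  then show ?thesis by simp
qed

lemma D_zero [simp]: "D 0 = 0"
  using D_add[of 0 0] by simp

lemma D_mono: "a \<unlhd> b \<Longrightarrow> D a \<unlhd> D b"
  unfolding mdvd_iff by (auto simp: D_add)

lemma D_diff: "a \<unlhd> b \<Longrightarrow> D (b - a) = D b - D a"
  using D_add[of "b - a" a] mdvd_diff(2)[of a b] by simp

lemma psi_single: "\<psi> (single m c) = single (D m) c"
  by (rule algebra_hom_single[OF hom monom])

lemma on_monom_eq: "on_monom \<psi> m = D m"
  unfolding on_monom_def monom by (rule the_equality) simp_all

lemma induced_deg_diff: "induced_deg \<psi> (a - b) = induced_deg \<psi> a - induced_deg \<psi> b"
  unfolding induced_deg_def by (rule frag_extend_diff)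

lemma induced_deg_mdeg: "induced_deg \<psi> (mdeg m) = mdeg (D m)"
proof -
  have add: "induced_deg \<psi> (mdeg (a + b)) = mdeg (D (a + b))"
    if "induced_deg \<psi> (mdeg a) = mdeg (D a)" "induced_deg \<psi> (mdeg b) = mdeg (D b)" for a b
    using that by (simp add: mdeg_add D_add) (simp add: induced_deg_def frag_extend_add)
  have zero: "induced_deg \<psi> (mdeg 0) = mdeg (D 0)"
    by (simp add: induced_deg_def)
  have one: "induced_deg \<psi> (mdeg (single v 1)) = mdeg (D (single v 1))" for v
  proof -
    have "mdeg (single v 1) = frag_of v"
      by (rule poly_mapping_eqI) (simp add: lookup_mdeg lookup_single when_def)
    then show ?thesis by (simp add: induced_deg_def on_monom_eq del: One_nat_def)
  qed
  have "induced_deg \<psi> (mdeg (single v c)) = mdeg (D (single v c))" for v c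
  proof (induction c)
    case 0 then show ?case using zero by simp
  next
    case (Suc c)
    have "single v (Suc c) = single v 1 + single v c" by (simp add: single_add[symmetric])
    then show ?case using add[OF one Suc] by simp
  qed
  then show ?thesis
    by (induction m rule: poly_mapping_single_induct) (use zero add in auto)
qed

text \<open>
  If some \<open>D l\<close> divides \<open>e\<close>, the largest such \<open>l\<close> is the lcm of all \<open>u\<close> in \<open>U\<close> with \<open>D u \<unlhd> e\<close>. That its image
  still divides \<open>e\<close> is exactly where the lcm condition enters.
\<close>

lemma lcm_closed_max:
  assumes U: "finite U" and lcm: "\<And>A. A \<subseteq> U \<Longrightarrow> A \<noteq> {} \<Longrightarrow> D (mlcm A) = mlcm (D ` A)"
  defines "L \<equiv> mlcm ` (Pow U - {{}})"
  shows "(\<forall>l\<in>L. \<not> D l \<unlhd> e) \<or> (\<exists>l0\<in>L. \<forall>l\<in>L. D l \<unlhd> e \<longleftrightarrow> l \<unlhd> l0)"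
proof -
  \<comment> \<open>The candidate for the largest element is the lcm of \<open>A0\<close>.\<close>
  define A0 where "A0 = {u\<in>U. D u \<unlhd> e}"
  have fA: "finite A" if "A \<subseteq> U" for A using U that finite_subset by blast
  have sub: "A \<subseteq> A0" if "A \<subseteq> U" "D (mlcm A) \<unlhd> e" for A
  proof
    fix u assume u: "u \<in> A"
    have "D u \<unlhd> D (mlcm A)" by (rule D_mono[OF mdvd_mlcm[OF fA[OF that(1)] u]])
    then show "u \<in> A0" using mdvd_trans[OF _ that(2)] u that(1) unfolding A0_def by blast
  qed
  show ?thesis
  proof (cases "A0 = {}")
    case True
    then show ?thesis using sub unfolding L_def by blast
  next
    case False
    have A0: "A0 \<subseteq> U" unfolding A0_def by blast
    have De: "D (mlcm A0) \<unlhd> e"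
      unfolding lcm[OF A0 False] using fA[OF A0] by (simp add: mlcm_mdvd_iff A0_def)
    have "D (mlcm A) \<unlhd> e \<longleftrightarrow> mlcm A \<unlhd> mlcm A0" if A: "A \<subseteq> U" for A
    proof
      assume "D (mlcm A) \<unlhd> e"
      then have "A \<subseteq> A0" by (rule sub[OF A])
      then show "mlcm A \<unlhd> mlcm A0"
        using mdvd_mlcm[OF fA[OF A0]] by (auto simp: mlcm_mdvd_iff[OF fA[OF A]])
    next
      assume "mlcm A \<unlhd> mlcm A0"
      then show "D (mlcm A) \<unlhd> e" using mdvd_trans[OF D_mono De] by blast
    qed
    moreover have "mlcm A0 \<in> L" using A0 False unfolding L_def by blast
    ultimately show ?thesis unfolding L_def by blast
  qed
qed

end

lemma span_monom_eqI:
  assumes "\<And>u. u \<in> U \<Longrightarrow> \<exists>v\<in>V. v \<unlhd> u" "\<And>v. v \<in> V \<Longrightarrow> \<exists>u\<in>U. u \<unlhd> v"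
  shows "ideal.span (monom ` U) = (ideal.span (monom ` V) :: ('v, 'k::comm_ring_1) mpoly set)"
proof -
  have "(\<exists>u\<in>U. u \<unlhd> m) \<longleftrightarrow> (\<exists>v\<in>V. v \<unlhd> m)" for m
  proof
    assume "\<exists>u\<in>U. u \<unlhd> m"
    then obtain u where u: "u \<in> U" "u \<unlhd> m" by blast
    obtain v where "v \<in> V" "v \<unlhd> u" using assms(1)[OF u(1)] by blast
    then show "\<exists>v\<in>V. v \<unlhd> m" using mdvd_trans[OF _ u(2)] by blast
  next
    assume "\<exists>v\<in>V. v \<unlhd> m"
    then obtain v where v: "v \<in> V" "v \<unlhd> m" by blast
    obtain u where "u \<in> U" "u \<unlhd> v" using assms(2)[OF v(1)] by blast
    then show "\<exists>u\<in>U. u \<unlhd> m" using mdvd_trans[OF _ v(2)] by blast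
  qed
  then show ?thesis unfolding span_monom by simp
qed

lemma span_monom_lcms:
fixes E :: "'z::finite monom \<Rightarrow> 'y monom"
assumes U: "finite U" and E: "\<And>a b. a \<unlhd> b \<Longrightarrow> E a \<unlhd> E b"
defines "L \<equiv> mlcm ` (Pow U - {{}})"
shows "ideal.span (monom ` E ` L) = (ideal.span (monom ` E ` U) :: ('y, 'k::comm_ring_1) mpoly set)"
proof (rule span_monom_eqI)
  fix x assume "x \<in> E ` L"
  then obtain A where A: "A \<subseteq> U" "A \<noteq> {}" "x = E (mlcm A)" unfolding L_def by blast
  then obtain u where u: "u \<in> A" by blast
  have "E u \<unlhd> x" unfolding A(3) by (rule E[OF mdvd_mlcm[OF finite_subset[OF A(1) U] u]])
  then show "\<exists>v\<in>E ` U. v \<unlhd> x" using u A(1) by blast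
next
  fix v assume "v \<in> E ` U"
  then obtain u where u: "u \<in> U" "v = E u" by blast
  have "mlcm {u} \<unlhd> u" by (simp add: mlcm_mdvd_iff)
  then have "E (mlcm {u}) \<unlhd> v" unfolding u(2) by (rule E)
  moreover have "mlcm {u} \<in> L" using u(1) unfolding L_def by blast
  ultimately show "\<exists>u\<in>E ` L. u \<unlhd> v" by blast
qed

lemma (in monomial_hom) monomial_resolution:
  assumes U: "finite U" and lcm: "\<And>A. A \<subseteq> U \<Longrightarrow> A \<noteq> {} \<Longrightarrow> D (mlcm A) = mlcm (D ` A)"
  shows "\<exists>(T :: (nat, 'z, 'z \<Rightarrow>\<^sub>0 int, 'k) free_complex) e.
     exact_res (ideal.span (monom ` U)) T e \<and> graded_at mdeg T e \<and>
     minimal_graded_free_resolution mdeg (ideal.span (monom ` U)) T \<and>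
     (\<forall>i. \<forall>b\<in>basis T i. \<exists>A\<subseteq>U. dgr T i b = mdeg (mlcm A)) \<and>
     exact_res (ideal.span (monom ` D ` U)) (base_change \<psi> T) (\<lambda>b. \<psi> (e b))"
proof -
  define L where "L = mlcm ` (Pow U - {{}})"
  have "finite L" using U by (simp add: L_def)
  then obtain n dg and \<delta> :: "nat \<Rightarrow> nat \<Rightarrow> nat \<Rightarrow>\<^sub>0 'k" where
    fr: "frame L n dg \<delta>" and mf: "minimal_frame L n dg \<delta>"
    using frame_exists by blast
  define T where "T = frame_complex (\<lambda>m. m) n dg \<delta>"
  define e where "e = frame_augmentation (\<lambda>m. m) dg \<delta>"
  interpret I: monomial_hom "\<lambda>p :: ('z, 'k) mpoly. p" "\<lambda>m. m"
    by unfold_locales (simp_all add: algebra_hom_def)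
  have ex: "exact_res (ideal.span (monom ` U)) T e"
    using exact_res_frame_complex[OF fr, of "\<lambda>m. m"] I.lcm_closed_max[OF U, folded L_def]
    unfolding T_def e_def by (simp add: span_monom_lcms[OF U, of "\<lambda>m. m", folded L_def, simplified])
  have gr: "graded_at mdeg T e"
    unfolding T_def e_def by (rule graded_at_frame_complex[OF fr])
  have "minimal_graded_free_resolution mdeg (ideal.span (monom ` U)) T"
    unfolding minimal_graded_free_resolution_def
  proof (intro conjI allI ballI)
    show "graded_free_resolution mdeg (ideal.span (monom ` U)) T"
      using graded_free_resolution_iff[OF grading_mdeg] ex gr by blast
  qed (use minimal_frame_complex[OF fr mf] in \<open>simp_all add: T_def\<close>)
  moreover have "\<exists>A\<subseteq>U. dgr T i b = mdeg (mlcm A)" if "b \<in> basis T i" for i b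
  proof -
    have "dg i b \<in> L" using fr that by (simp add: frame_def T_def)
    then show ?thesis unfolding L_def T_def by auto
  qed
  moreover have "exact_res (ideal.span (monom ` D ` U)) (base_change \<psi> T) (\<lambda>b. \<psi> (e b))"
  proof (rule exact_res_cong)
    show "exact_res (ideal.span (monom ` D ` U)) (frame_complex D n dg \<delta>) (frame_augmentation D dg \<delta>)"
    proof -
      have "ideal.span (monom ` D ` L) = (ideal.span (monom ` D ` U) :: ('x, 'k) mpoly set)"
        unfolding L_def by (rule span_monom_lcms[OF U]) (rule D_mono)
      moreover have "exact_res (ideal.span (monom ` D ` L)) (frame_complex D n dg \<delta>) (frame_augmentation D dg \<delta>)"
        by (rule exact_res_frame_complex[OF fr]) (fact D_mono, unfold L_def, rule lcm_closed_max[OF U lcm])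
      ultimately show ?thesis by simp
    qed
    show "basis (base_change \<psi> T) i = basis (frame_complex D n dg \<delta>) i" for i by (simp add: T_def)
    show "\<psi> (e b) = frame_augmentation D dg \<delta> b" for b
      by (simp add: e_def frame_augmentation_def psi_single)
    fix i b assume "b \<in> basis (frame_complex D n dg \<delta>) (Suc i)"
    then have k: "\<delta> (Suc i) b \<in> free_module (below (n i) (dg i) (dg (Suc i) b))"
      using frame_diff_ker(1)[OF fr] by simp
    show "bdry (base_change \<psi> T) (Suc i) b = bdry (frame_complex D n dg \<delta>) (Suc i) b"
    proof (rule poly_mapping_eqI)
      fix j
      show "lookup (bdry (base_change \<psi> T) (Suc i) b) j = lookup (bdry (frame_complex D n dg \<delta>) (Suc i) b) j"
      proof (cases "j \<in> keys (\<delta> (Suc i) b)")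
        case True
        then have "dg i j \<unlhd> dg (Suc i) b" using k unfolding free_module_def below_def by blast
        then show ?thesis
          by (simp add: T_def lookup_ext_scalars[OF hom] lookup_homogenize psi_single D_diff)
      next
        case False
        then show ?thesis
          by (simp add: T_def lookup_ext_scalars[OF hom] lookup_homogenize algebra_hom_0[OF hom] in_keys_iff)
      qed
    qed
  qed
  ultimately show ?thesis using ex gr by blast
qed

lemma minimal_resolution_exists:
  assumes "finite (U :: 'v::finite monom set)"
  shows "\<exists>T :: (nat, 'v, 'v \<Rightarrow>\<^sub>0 int, 'k::field) free_complex.
    minimal_graded_free_resolution mdeg (ideal.span (monom ` U)) T"
proof -
  interpret I: monomial_hom "\<lambda>p :: ('v, 'k) mpoly. p" "\<lambda>m. m"
    by unfold_locales (simp_all add: algebra_hom_def)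
  show ?thesis using I.monomial_resolution[OF assms] by auto
qed

lemma minimal_rank_unique:
  fixes M N :: "(nat, 'v, 'g::ab_group_add, 'k::field) free_complex"
  assumes "grading wt" "minimal_graded_free_resolution wt J M" "minimal_graded_free_resolution wt J N"
  shows "card {b \<in> basis M i. dgr M i b \<in> X} = card {b \<in> basis N i. dgr N i b \<in> X}"
  using assms minimal_rank_le[OF assms(1,2), of N i X] minimal_rank_le[OF assms(1,3), of M i X]
  by (simp add: minimal_graded_free_resolution_def)

text \<open>
  Two minimal resolutions have equally many basis elements in each degree, so the chosen one may be replaced by
  any other.
\<close>

lemma multigraded_betti_eq:
  assumes "minimal_graded_free_resolution mdeg J (M :: (nat, 'v, 'v \<Rightarrow>\<^sub>0 int, 'k::field) free_complex)"
  shows "multigraded_betti i u J = card {b \<in> basis M i. dgr M i b = mdeg u}"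
proof -
  define F where "F = (SOME F :: (nat, 'v, 'v \<Rightarrow>\<^sub>0 int, 'k) free_complex. minimal_graded_free_resolution mdeg J F)"
  have "minimal_graded_free_resolution mdeg J F" unfolding F_def using assms by (rule someI)
  from minimal_rank_unique[OF grading_mdeg this assms, of i "{mdeg u}"]
  show ?thesis by (simp add: multigraded_betti_def F_def[symmetric])
qed

text \<open>
  A multigraded minimal resolution is also minimal for the total degree; this gives access to the total Betti
  numbers.
\<close>

lemma minimal_tdeg:
  fixes M :: "('b, 'v::finite, 'v \<Rightarrow>\<^sub>0 int, 'k::field) free_complex"
  assumes "minimal_graded_free_resolution mdeg J M"
  shows "minimal_graded_free_resolution tdeg J (regrade (\<lambda>d. \<Sum>v\<in>UNIV. lookup d v) M)"
proof -
  let ?R = "regrade (\<lambda>d. \<Sum>v\<in>UNIV. lookup d v) M"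
  obtain e where e: "exact_res J M e" "graded_at mdeg M e"
    using assms graded_free_resolution_iff[OF grading_mdeg] unfolding minimal_graded_free_resolution_def by blast
  have "graded_at tdeg ?R e"
    by (rule graded_at_regrade[OF _ _ e(2)]) (simp_all add: tdeg_eq lookup_minus sum_subtractf)
  then have "graded_free_resolution tdeg J ?R"
    using e(1) unfolding graded_free_resolution_iff[OF grading_tdeg] by auto
  then show ?thesis
    using assms by (simp add: minimal_graded_free_resolution_def)
qed

lemma betti_eq:
  assumes "minimal_graded_free_resolution mdeg J (M :: (nat, 'v::finite, 'v \<Rightarrow>\<^sub>0 int, 'k::field) free_complex)"
  shows "betti i J = card (basis M i)"
proof -
  define F where "F = (SOME F :: (nat, 'v, int, 'k) free_complex. minimal_graded_free_resolution tdeg J F)"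
  have "minimal_graded_free_resolution tdeg J F" unfolding F_def using minimal_tdeg[OF assms] by (rule someI)
  from minimal_rank_unique[OF grading_tdeg this minimal_tdeg[OF assms], of i UNIV]
  show ?thesis by (simp add: betti_def F_def[symmetric])
qed

lemma base_change_regrade: "base_change \<psi> (regrade \<phi> F) = regrade \<phi> (base_change \<psi> F)"
  by (simp add: base_change_def regrade_def)

theorem (in monomial_hom) lcm_preserving_statements:
  assumes U: "finite U" and lcm: "\<And>A. A \<subseteq> U \<Longrightarrow> A \<noteq> {} \<Longrightarrow> D (mlcm A) = mlcm (D ` A)"
    and \<J>: "\<J> = ideal.span (monom ` U)" and J: "J = ideal.span (\<psi> ` \<J>)"
  shows "resolution_and_betti_statements TYPE('b) \<psi> \<J> J"
proof -
  define U0 where "U0 = minimal_monoms U"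
  have U0: "U0 \<subseteq> U" "finite U0" "\<J> = ideal.span (monom ` U0)"
    using U span_minimal_monoms[of U] unfolding U0_def \<J> by (auto simp: minimal_monoms_def)
  have lcm0: "D (mlcm A) = mlcm (D ` A)" if "A \<subseteq> U0" "A \<noteq> {}" for A
    using lcm that U0(1) by blast
  have JD: "J = ideal.span (monom ` D ` U0)"
    unfolding J U0(3) ideal_span_image[OF hom] by (simp add: image_image monom)
  have LCM: "LCM_lattice \<J> = mlcm ` Pow U0"
    unfolding LCM_lattice_def \<J> minimal_generators_span U0_def ..
  let ?\<phi> = "induced_deg \<psi>"
  obtain T :: "(nat, 'z, 'z \<Rightarrow>\<^sub>0 int, 'k) free_complex" and eT where
    T: "exact_res \<J> T eT" "graded_at mdeg T eT" "minimal_graded_free_resolution mdeg \<J> T"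
      "\<And>i b. b \<in> basis T i \<Longrightarrow> \<exists>A\<subseteq>U0. dgr T i b = mdeg (mlcm A)"
      "exact_res J (base_change \<psi> T) (\<lambda>b. \<psi> (eT b))"
    using monomial_resolution[OF U0(2) lcm0] unfolding U0(3)[symmetric] JD[symmetric] by blast
  obtain M :: "(nat, 'x, 'x \<Rightarrow>\<^sub>0 int, 'k) free_complex" where
    M: "minimal_graded_free_resolution mdeg J M"
    using minimal_resolution_exists[of "D ` U0"] U0(2) unfolding JD by blast
  have finT: "finite (basis T i)" for i using T(3) by (simp add: minimal_graded_free_resolution_def)
  have part1: "graded_free_resolution mdeg J (base_change \<psi> (regrade ?\<phi> F))"
    if F: "graded_free_resolution mdeg \<J> F" for F :: "('c, 'z, 'z \<Rightarrow>\<^sub>0 int, 'k) free_complex"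
  proof -
    obtain e where e: "exact_res \<J> F e" "graded_at mdeg F e"
      using F graded_free_resolution_iff[OF grading_mdeg] by blast
    obtain f where f: "chain_map F e T eT f"
      using comparison_map[OF grading_mdeg e T(1,2)] by blast
    obtain g where g: "chain_map T eT F e g"
      using comparison_map[OF grading_mdeg T(1,2) e] by blast
    have "exact_res J (base_change \<psi> F) (\<lambda>b. \<psi> (e b))"
      by (rule exact_res_base_change_transfer[OF hom e(1) T(5) f g J])
    then have "exact_res J (base_change \<psi> (regrade ?\<phi> F)) (\<lambda>b. \<psi> (e b))"
      by (simp add: base_change_regrade)
    moreover have "graded_at mdeg (base_change \<psi> (regrade ?\<phi> F)) (\<lambda>b. \<psi> (e b))"
      by (rule graded_at_base_change[OF hom monom _ induced_deg_diff e(2)])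
        (simp add: induced_deg_mdeg)
    ultimately show ?thesis using graded_free_resolution_iff[OF grading_mdeg] by blast
  qed
  let ?T = "base_change \<psi> (regrade ?\<phi> T)"
  have T': "graded_free_resolution mdeg J ?T"
    using part1 T(3) unfolding minimal_graded_free_resolution_def by blast
  have le: "card {b \<in> basis M i. dgr M i b \<in> X} \<le> card {b \<in> basis T i. ?\<phi> (dgr T i b) \<in> X}" for i X
    using minimal_rank_le[OF grading_mdeg M T', of i X] finT by simp
  have part2: "multigraded_betti i m J
      \<le> (\<Sum>u | u \<in> LCM_lattice \<J> \<and> \<psi> (monom u) = monom m. multigraded_betti i u \<J>)" for i m
  proof -
    let ?S = "{u. u \<in> LCM_lattice \<J> \<and> \<psi> (monom u) = monom m}"
    have finS: "finite ?S" using U0(2) unfolding LCM by simp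
    have "{b \<in> basis T i. ?\<phi> (dgr T i b) \<in> {mdeg m}} \<subseteq> (\<Union>u\<in>?S. {b \<in> basis T i. dgr T i b = mdeg u})"
    proof
      fix b assume "b \<in> {b \<in> basis T i. ?\<phi> (dgr T i b) \<in> {mdeg m}}"
      then have b: "b \<in> basis T i" "?\<phi> (dgr T i b) = mdeg m" by auto
      obtain A where A: "A \<subseteq> U0" "dgr T i b = mdeg (mlcm A)" using T(4)[OF b(1)] by blast
      have "D (mlcm A) = m" using b(2) unfolding A(2) induced_deg_mdeg by simp
      then have "mlcm A \<in> ?S" using A(1) unfolding LCM by (simp add: monom)
      then show "b \<in> (\<Union>u\<in>?S. {b \<in> basis T i. dgr T i b = mdeg u})" using b(1) A(2) by blast
    qed
    then have "card {b \<in> basis T i. ?\<phi> (dgr T i b) \<in> {mdeg m}}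
        \<le> card (\<Union>u\<in>?S. {b \<in> basis T i. dgr T i b = mdeg u})"
      using finS finT by (intro card_mono) auto
    also have "\<dots> \<le> (\<Sum>u\<in>?S. card {b \<in> basis T i. dgr T i b = mdeg u})"
      by (rule card_UN_le[OF finS])
    finally show ?thesis
      using le[of i "{mdeg m}"] by (simp add: multigraded_betti_eq[OF M] multigraded_betti_eq[OF T(3)])
  qed
  have part3: "betti i J \<le> betti i \<J>" for i
    using le[of i UNIV] by (simp add: betti_eq[OF M] betti_eq[OF T(3)])
  show ?thesis
    unfolding resolution_and_betti_statements_def using part1 part2 part3 by blast
qed

lemma monomial_hom_on_monom:
  fixes \<psi> :: "('z::finite, 'k::field) mpoly \<Rightarrow> ('x::finite, 'k) mpoly"
  assumes "algebra_hom \<psi>" "monomial_map \<psi>" shows "monomial_hom \<psi> (on_monom \<psi>)"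
proof
  fix m
  obtain m' where m': "\<psi> (monom m) = monom m'" using assms(2) unfolding monomial_map_def by blast
  then have "on_monom \<psi> m = m'" unfolding on_monom_def by (intro the_equality) auto
  then show "\<psi> (monom m) = monom (on_monom \<psi> m)" using m' by simp
qed (rule assms(1))

theorem statements_of_lcm_condition:
  fixes \<psi> :: "('z::finite, 'k::field) mpoly \<Rightarrow> ('x::finite, 'k) mpoly"
  assumes "algebra_hom \<psi>" "monomial_map \<psi>"
    and \<J>: "\<J> = ideal.span ((\<lambda>i. monom (u i)) ` {1..q::nat})" and J: "J = ideal.span (\<psi> ` \<J>)"
    and lcm: "\<And>A. A \<noteq> {} \<Longrightarrow> A \<subseteq> {1..q} \<Longrightarrow>
         \<psi> (monom (mlcm (u ` A))) = monom (mlcm ((\<lambda>i. on_monom \<psi> (u i)) ` A))"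
  shows "resolution_and_betti_statements TYPE('b) \<psi> \<J> J"
proof -
  interpret monomial_hom \<psi> "on_monom \<psi>" by (rule monomial_hom_on_monom[OF assms(1,2)])
  show ?thesis
  proof (rule lcm_preserving_statements)
    show "finite (u ` {1..q})" by simp
    show "\<J> = ideal.span (monom ` u ` {1..q})" by (simp add: \<J> image_image)
    show "J = ideal.span (\<psi> ` \<J>)" by (rule J)
    fix B assume B: "B \<subseteq> u ` {1..q}" "B \<noteq> {}"
    then obtain A where A: "A \<subseteq> {1..q}" "B = u ` A" by (meson subset_imageE)
    then show "on_monom \<psi> (mlcm B) = mlcm (on_monom \<psi> ` B)"
      using lcm[of A] B(2) by (simp add: monom image_image)
  qed
qed

section \<open>Dickson's lemma\<close>

lemma nat_seq_mono_subseq: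
  fixes s :: "nat \<Rightarrow> nat"
  shows "\<exists>r :: nat \<Rightarrow> nat. strict_mono r \<and> (\<forall>m n. m \<le> n \<longrightarrow> s (r m) \<le> s (r n))"
proof -
  obtain f :: "nat \<Rightarrow> nat" where f: "strict_mono f" "monoseq (\<lambda>n. s (f n))"
    using seq_monosub[of s] by blast
  show ?thesis
  proof (cases "\<forall>m n. m \<le> n \<longrightarrow> s (f m) \<le> s (f n)")
    case True
    then show ?thesis using f(1) by blast
  next
    case False
    then have dec: "s (f n) \<le> s (f m)" if "m \<le> n" for m n
      using f(2) that unfolding monoseq_def by blast
    define c where "c = (LEAST x. \<exists>n. s (f n) = x)"
    have "\<exists>n. s (f n) = c" unfolding c_def by (rule LeastI_ex) blast
    then obtain N where N: "s (f N) = c" by blast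
    have "s (f n) = c" if "N \<le> n" for n
      using dec[OF that] N Least_le[of "\<lambda>x. \<exists>n. s (f n) = x" "s (f n)"] unfolding c_def by (metis order_antisym)
    then have "\<forall>m n. m \<le> n \<longrightarrow> s (f (m + N)) \<le> s (f (n + N))" by simp
    moreover have "strict_mono (\<lambda>n. f (n + N))"
      using f(1) by (simp add: strict_mono_def)
    ultimately show ?thesis by (intro exI[of _ "\<lambda>n. f (n + N)"]) blast
  qed
qed

text \<open>
  Dickson's lemma in terms of subsequences, which are refined one coordinate at a time.
\<close>

lemma dickson_subseq:
  fixes g :: "nat \<Rightarrow> 'a \<Rightarrow> nat"
  assumes "finite S"
  shows "\<exists>r :: nat \<Rightarrow> nat. strict_mono r \<and> (\<forall>a\<in>S. \<forall>m n. m \<le> n \<longrightarrow> g (r m) a \<le> g (r n) a)"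
  using assms
proof induction
  case empty
  show ?case by (intro exI[of _ "\<lambda>n. n"]) (simp add: strict_mono_def)
next
  case (insert x S)
  then obtain r :: "nat \<Rightarrow> nat" where r: "strict_mono r" "\<And>a m n. a \<in> S \<Longrightarrow> m \<le> n \<Longrightarrow> g (r m) a \<le> g (r n) a"
    by blast
  obtain t :: "nat \<Rightarrow> nat" where t: "strict_mono t" "\<And>m n. m \<le> n \<Longrightarrow> g (r (t m)) x \<le> g (r (t n)) x"
    using nat_seq_mono_subseq[of "\<lambda>n. g (r n) x"] by blast
  have "t m \<le> t n" if "m \<le> n" for m n using t(1) that by (simp add: strict_mono_less_eq)
  then have "\<forall>a\<in>insert x S. \<forall>m n. m \<le> n \<longrightarrow> g (r (t m)) a \<le> g (r (t n)) a"
    using r(2) t(2) by simp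
  moreover have "strict_mono (\<lambda>n. r (t n))" using r(1) t(1) by (simp add: strict_mono_def)
  ultimately show ?case by (intro exI[of _ "\<lambda>n. r (t n)"] conjI)
qed

lemma dickson:
  fixes g :: "nat \<Rightarrow> 'a \<Rightarrow> nat"
  assumes "finite S"
  shows "\<exists>i j. i < j \<and> (\<forall>a\<in>S. g i a \<le> g j a)"
proof -
  obtain r :: "nat \<Rightarrow> nat" where r: "strict_mono r" "\<forall>a\<in>S. \<forall>m n. m \<le> n \<longrightarrow> g (r m) a \<le> g (r n) a"
    using dickson_subseq[OF assms] by blast
  have "r 0 < r 1" using r(1) by (simp add: strict_mono_def)
  then show ?thesis using r(2) by (intro exI[of _ "r 0"] exI[of _ "r 1"]) simp
qed

text \<open>
  An infinite antichain would contradict Dickson's lemma. Hence every monomial ideal, in particular an integral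
  closure or a symbolic power, has finitely many minimal generators.
\<close>

lemma finite_minimal_monoms: "finite (minimal_monoms (U :: 'v::finite monom set))"
proof (rule ccontr)
  assume "infinite (minimal_monoms U)"
  then obtain f :: "nat \<Rightarrow> 'v monom" where f: "inj f" "range f \<subseteq> minimal_monoms U"
    using infinite_countable_subset by blast
  obtain i j where ij: "i < j" "f i \<unlhd> f j"
    using dickson[of "UNIV :: 'v set" "\<lambda>n. lookup (f n)"] unfolding mdvd_def by auto
  have "f i \<in> U" "f j \<in> minimal_monoms U" using f(2) unfolding minimal_monoms_def by auto
  then have "f i = f j" using ij(2) unfolding minimal_monoms_def by blast
  then show False using f(1) ij(1) by (simp add: inj_eq)
qed

section \<open>Powers of ideals\<close>

text \<open>
  Exponents of the \<open>r\<close>-fold products of monomials in \<open>U\<close>.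
\<close>

primrec monom_sums :: "'v monom set \<Rightarrow> nat \<Rightarrow> 'v monom set" where
  "monom_sums U 0 = {0}"
| "monom_sums U (Suc r) = {a + b |a b. a \<in> U \<and> b \<in> monom_sums U r}"

lemma finite_monom_sums: "finite U \<Longrightarrow> finite (monom_sums U r)"
proof (induction r)
  case (Suc r)
  then have "finite ((\<lambda>(a, b). a + b) ` (U \<times> monom_sums U r))" by simp
  moreover have "monom_sums U (Suc r) = (\<lambda>(a, b). a + b) ` (U \<times> monom_sums U r)" by auto
  ultimately show ?case by simp
qed simp

lemma ideal_power_subspace: "ideal.subspace (ideal_power J r)"
  by (cases r) (simp_all add: ideal.subspace_span ideal.subspace_UNIV)

lemma zero_in_ideal_power: "0 \<in> ideal_power J r"
  by (rule ideal.subspace_0[OF ideal_power_subspace])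

lemma ideal_power_monom:
  "ideal_power (ideal.span (monom ` U)) r = (ideal.span (monom ` monom_sums U r) :: ('v, 'k::field) mpoly set)"
proof (induction r)
  case 0
  show ?case unfolding ideal_power.simps monom_sums.simps span_monom by simp
next
  case (Suc r)
  let ?N = "ideal.span (monom ` U) :: ('v, 'k) mpoly set" and ?M = "ideal.span (monom ` monom_sums U r) :: ('v, 'k) mpoly set"
  have "{a * b |a b. a \<in> ?N \<and> b \<in> ?M} \<subseteq> ideal.span (monom ` monom_sums U (Suc r))"
  proof clarify
    fix a b assume ab: "a \<in> ?N" "b \<in> ?M"
    show "a * b \<in> ideal.span (monom ` monom_sums U (Suc r))"
      unfolding span_monom
    proof (intro CollectI ballI)
      fix m assume "m \<in> keys (a * b)"
      then obtain x y where xy: "x \<in> keys a" "y \<in> keys b" "m = x + y" using keys_times by blast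
      obtain u s where "u \<in> U" "u \<unlhd> x" "s \<in> monom_sums U r" "s \<unlhd> y"
        using ab xy unfolding span_monom by blast
      then show "\<exists>u\<in>monom_sums U (Suc r). u \<unlhd> m"
        using mdvd_add[of u x s y] xy(3) by auto
    qed
  qed
  moreover have "monom ` monom_sums U (Suc r) \<subseteq> {a * b |a b. a \<in> ?N \<and> b \<in> ?M}"
  proof
    fix z :: "('v, 'k) mpoly" assume "z \<in> monom ` monom_sums U (Suc r)"
    then obtain a b where ab: "a \<in> U" "b \<in> monom_sums U r" "z = monom (a + b)" by auto
    then show "z \<in> {a * b |a b. a \<in> ?N \<and> b \<in> ?M}"
      using ideal.span_base[OF imageI[OF ab(1), of monom]] ideal.span_base[OF imageI[OF ab(2), of monom]]
      unfolding ab(3) monom_add by blast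
  qed
  ultimately have "ideal.span {a * b |a b. a \<in> ?N \<and> b \<in> ?M} = ideal.span (monom ` monom_sums U (Suc r))"
    by (intro subset_antisym ideal.span_minimal[OF _ ideal.subspace_span] ideal.span_mono)
  then show ?case unfolding ideal_power.simps Suc .
qed

lemma ideal_power_mult:
  fixes N :: "'a::comm_ring_1 set"
  assumes "a \<in> ideal_power N i" "b \<in> ideal_power N j"
  shows "a * b \<in> ideal_power N (i + j)"
  using assms(1)
proof (induction i arbitrary: a)
  case 0
  then show ?case using ideal.subspace_scale[OF ideal_power_subspace assms(2)] by simp
next
  case (Suc i)
  have "a \<in> ideal.span {a * b |a b. a \<in> N \<and> b \<in> ideal_power N i}" using Suc.prems by simp
  then show ?case
  proof (induction rule: ideal.span_induct_alt)
    case base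
    then show ?case by (simp only: mult_zero_left zero_in_ideal_power)
  next
    case (step c x y)
    obtain s t where st: "x = s * t" "s \<in> N" "t \<in> ideal_power N i" using step by blast
    have "s * (t * b) \<in> ideal_power N (Suc i + j)"
      using st(2) Suc.IH[OF st(3)] by (auto intro!: ideal.span_base)
    then have "c * (s * (t * b)) \<in> ideal_power N (Suc i + j)"
      by (rule ideal.subspace_scale[OF ideal_power_subspace])
    then have "c * (s * (t * b)) + y * b \<in> ideal_power N (Suc i + j)"
      using step by (intro ideal.subspace_add[OF ideal_power_subspace])
    then show ?case by (simp add: st(1) algebra_simps)
  qed
qed

lemma ideal_power_one:
  assumes "a \<in> N" shows "a \<in> ideal_power N 1"
proof -
  have "a * 1 \<in> {x * y |x y. x \<in> N \<and> y \<in> UNIV}" using assms by blast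
  then have "a * 1 \<in> ideal.span {x * y |x y. x \<in> N \<and> y \<in> UNIV}" by (rule ideal.span_base)
  then show ?thesis by (simp only: mult_1_right One_nat_def ideal_power.simps)
qed

lemma ideal_power_sub:
  fixes N :: "'a::comm_ring_1 set"
  assumes "ideal.subspace N" shows "ideal_power N (Suc i) \<subseteq> ideal_power N i"
proof -
  have "x * y \<in> ideal_power N i" if "y \<in> ideal_power N i" for x y
    by (rule ideal.subspace_scale[OF ideal_power_subspace that])
  then show ?thesis unfolding ideal_power.simps
    by (intro ideal.span_minimal ideal_power_subspace) blast
qed

lemma ideal_power_antimono:
  fixes N :: "'a::comm_ring_1 set"
  assumes "ideal.subspace N" "i \<le> j" shows "ideal_power N j \<subseteq> ideal_power N i"
  using assms(2)
proof (induction j rule: dec_induct)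
  case (step n)
  then show ?case using ideal_power_sub[OF assms(1), of n] by blast
qed simp

section \<open>Integral dependence\<close>

text \<open>
  The lower-order terms of a candidate integral equation of degree \<open>e\<close> for \<open>f\<close> over \<open>N\<close>: sums of products
  \<open>a * f ^ (e - i)\<close> with \<open>a\<close> in \<open>N ^ i\<close> and \<open>i \<ge> 1\<close>. So \<open>f\<close> is integral iff \<open>f ^ n\<close> is itself such a sum for
  some \<open>n \<ge> 1\<close>.
\<close>

definition lower_terms :: "'a::comm_ring_1 set \<Rightarrow> 'a \<Rightarrow> nat \<Rightarrow> 'a set" where
  "lower_terms N f e = ideal.span {a * f ^ (e - i) |a i. 1 \<le> i \<and> i \<le> e \<and> a \<in> ideal_power N i}"

lemma lower_terms_base: "1 \<le> i \<Longrightarrow> i \<le> e \<Longrightarrow> a \<in> ideal_power N i \<Longrightarrow> a * f ^ (e - i) \<in> lower_terms N f e"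
  unfolding lower_terms_def by (rule ideal.span_base) blast

lemma lower_terms_add_scale: "x \<in> lower_terms N f e \<Longrightarrow> y \<in> lower_terms N f e \<Longrightarrow> c * x + y \<in> lower_terms N f e"
  unfolding lower_terms_def by (rule ideal.span_add[OF ideal.span_scale])

lemma lower_terms_mult:
  assumes "x \<in> lower_terms N f e" "y \<in> lower_terms N f e'"
  shows "x * y \<in> lower_terms N f (e + e')"
  using assms(1) unfolding lower_terms_def[of N f e]
proof (induction rule: ideal.span_induct_alt)
  case base
  then show ?case by (simp add: lower_terms_def ideal.span_zero)
next
  case (step c x1 x2)
  obtain a i where x1: "x1 = a * f ^ (e - i)" "1 \<le> i" "i \<le> e" "a \<in> ideal_power N i" using step by blast
  have "x1 * y \<in> lower_terms N f (e + e')"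
    using assms(2) unfolding lower_terms_def[of N f e']
  proof (induction rule: ideal.span_induct_alt)
    case base
    then show ?case by (simp add: lower_terms_def ideal.span_zero)
  next
    case (step d y1 y2)
    obtain b j where y1: "y1 = b * f ^ (e' - j)" "1 \<le> j" "j \<le> e'" "b \<in> ideal_power N j" using step by blast
    have "(a * b) * f ^ ((e + e') - (i + j)) \<in> lower_terms N f (e + e')"
      using x1 y1 by (intro lower_terms_base ideal_power_mult) auto
    moreover have "(e + e') - (i + j) = (e - i) + (e' - j)" using x1 y1 by simp
    ultimately have "x1 * y1 \<in> lower_terms N f (e + e')"
      unfolding x1(1) y1(1) by (simp add: power_add algebra_simps)
    then have "d * (x1 * y1) + x1 * y2 \<in> lower_terms N f (e + e')"
      by (rule lower_terms_add_scale) (rule step(2))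
    then show ?case by (simp add: algebra_simps)
  qed
  then have "c * (x1 * y) + x2 * y \<in> lower_terms N f (e + e')"
    by (rule lower_terms_add_scale) (rule step(2))
  then show ?case by (simp add: algebra_simps)
qed

lemma lower_terms_power:
  assumes "y \<in> lower_terms N f e'" shows "f ^ e * y \<in> lower_terms N f (e + e')"
  using assms unfolding lower_terms_def[of N f e']
proof (induction rule: ideal.span_induct_alt)
  case base
  then show ?case by (simp add: lower_terms_def ideal.span_zero)
next
  case (step d y1 y2)
  obtain b j where y1: "y1 = b * f ^ (e' - j)" "1 \<le> j" "j \<le> e'" "b \<in> ideal_power N j" using step by blast
  have "b * f ^ ((e + e') - j) \<in> lower_terms N f (e + e')"
    using y1 by (intro lower_terms_base) auto
  moreover have "(e + e') - j = e + (e' - j)" using y1 by simp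
  ultimately have "f ^ e * y1 \<in> lower_terms N f (e + e')"
    unfolding y1(1) by (simp add: power_add algebra_simps)
  then have "d * (f ^ e * y1) + f ^ e * y2 \<in> lower_terms N f (e + e')"
    by (rule lower_terms_add_scale) (rule step(2))
  then show ?case by (simp add: algebra_simps)
qed

lemma lower_terms_explicit:
  assumes "x \<in> lower_terms N f e"
  shows "\<exists>a. (\<forall>i\<in>{1..e}. a i \<in> ideal_power N i) \<and> x = (\<Sum>i=1..e. a i * f ^ (e - i))"
  using assms unfolding lower_terms_def
proof (induction rule: ideal.span_induct_alt)
  case base
  show ?case by (intro exI[of _ "\<lambda>i. 0"]) (simp add: zero_in_ideal_power)
next
  case (step c x y)
  obtain a where a: "\<forall>i\<in>{1..e}. a i \<in> ideal_power N i" "y = (\<Sum>i=1..e. a i * f ^ (e - i))" using step by blast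
  obtain b j where x: "x = b * f ^ (e - j)" "1 \<le> j" "j \<le> e" "b \<in> ideal_power N j" using step by blast
  define a' where "a' i = a i + (if i = j then c * b else 0)" for i
  have cb: "c * b \<in> ideal_power N j"
    by (rule ideal.subspace_scale[OF ideal_power_subspace x(4)])
  have "\<forall>i\<in>{1..e}. a' i \<in> ideal_power N i"
  proof
    fix i assume "i \<in> {1..e}"
    then have "a i \<in> ideal_power N i" using a(1) by blast
    then show "a' i \<in> ideal_power N i"
      using ideal.subspace_add[OF ideal_power_subspace _ cb] unfolding a'_def by (cases "i = j") simp_all
  qed
  moreover have "(\<Sum>i=1..e. a' i * f ^ (e - i)) = y + (\<Sum>i=1..e. if i = j then c * b * f ^ (e - i) else 0)"
    unfolding a'_def a(2) sum.distrib[symmetric] by (intro sum.cong) (auto simp: algebra_simps)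
  then have "c * x + y = (\<Sum>i=1..e. a' i * f ^ (e - i))"
    using x by (simp add: algebra_simps)
  ultimately show ?case by blast
qed

lemma lower_terms_integral:
  assumes "f ^ n \<in> lower_terms N f n" "n \<ge> 1" shows "f \<in> integral_closure N"
proof -
  have "- (f ^ n) \<in> lower_terms N f n" using assms(1) unfolding lower_terms_def by (rule ideal.span_neg)
  then obtain a where "\<forall>i\<in>{1..n}. a i \<in> ideal_power N i" "- (f ^ n) = (\<Sum>i=1..n. a i * f ^ (n - i))"
    using lower_terms_explicit by blast
  then show ?thesis using assms(2) unfolding integral_closure_def
    by (intro CollectI exI[of _ n] conjI exI[of _ a]) (auto simp: eq_neg_iff_add_eq_0[symmetric] minus_equation_iff[of "f ^ n"])
qed

text \<open>
  A square linear system for \<open>v\<close> is reduced to a single equation for \<open>v j0\<close> by Gaussian elimination without division.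
  The invariant is that diagonal entries are monic of degree \<open>e\<close> in \<open>f\<close> up to lower terms, and off-diagonal
  entries are lower terms; eliminating one unknown doubles \<open>e\<close>. This replaces the expansion of the
  determinant in the Cayley-Hamilton argument.
\<close>

lemma elimination:
  fixes P :: "'i \<Rightarrow> 'i \<Rightarrow> 'a::comm_ring_1"
  assumes "finite I" "j0 \<in> I" "e \<ge> 1"
    and "\<And>j. j \<in> I \<Longrightarrow> P j j - f ^ e \<in> lower_terms N f e"
    and "\<And>j l. j \<in> I \<Longrightarrow> l \<in> I \<Longrightarrow> j \<noteq> l \<Longrightarrow> P j l \<in> lower_terms N f e"
    and "\<And>j. j \<in> I \<Longrightarrow> (\<Sum>l\<in>I. P j l * v l) = 0"
  shows "\<exists>n\<ge>1. \<exists>p. p - f ^ n \<in> lower_terms N f n \<and> p * v j0 = 0"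
  using assms
proof (induction "card I" arbitrary: I P e rule: less_induct)
  case less
  show ?case
  proof (cases "I = {j0}")
    case True
    then show ?thesis using less.prems(3) less.prems(4,6)[of j0] by (intro exI[of _ e]) auto
  next
    case False
    then obtain m where m: "m \<in> I" "m \<noteq> j0" using less.prems(2) by blast
    define I' where "I' = I - {m}"
    \<comment> \<open>The unknown \<open>v m\<close> is eliminated: row \<open>m\<close> times \<open>P j m\<close> is subtracted from row \<open>j\<close> times \<open>P m m\<close>.\<close>
    define P' where "P' j l = P m m * P j l - P j m * P m l" for j l
    have lowadd: "x - y \<in> lower_terms N f k" "x + y \<in> lower_terms N f k" if "x \<in> lower_terms N f k" "y \<in> lower_terms N f k" for x y k
      using that unfolding lower_terms_def by (simp_all add: ideal.span_diff ideal.span_add)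
    have mon: "x * y \<in> lower_terms N f (e + e)" if "x - f ^ e \<in> lower_terms N f e" "y \<in> lower_terms N f e" for x y
    proof -
      have "(x - f ^ e) * y + f ^ e * y \<in> lower_terms N f (e + e)"
        by (rule lowadd(2)[OF lower_terms_mult[OF that] lower_terms_power[OF that(2)]])
      then show ?thesis by (simp add: algebra_simps)
    qed
    have "card I' < card I" using m(1) less.prems(1) unfolding I'_def by (simp add: card_Diff1_less del: card_Diff_insert)
    moreover have "finite I'" "j0 \<in> I'" "e + e \<ge> 1" using less.prems m unfolding I'_def by auto
    moreover have "P' j j - f ^ (e + e) \<in> lower_terms N f (e + e)" if "j \<in> I'" for j
    proof -
      have j: "j \<in> I" "j \<noteq> m" using that unfolding I'_def by auto
      have 1: "P m m * (P j j - f ^ e) \<in> lower_terms N f (e + e)"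
        by (rule mon[OF less.prems(4)[OF m(1)] less.prems(4)[OF j(1)]])
      have 2: "f ^ e * (P m m - f ^ e) \<in> lower_terms N f (e + e)"
        by (rule lower_terms_power[OF less.prems(4)[OF m(1)]])
      have 3: "P j m * P m j \<in> lower_terms N f (e + e)"
        by (rule lower_terms_mult) (use less.prems(5) j m in auto)
      have "P' j j - f ^ (e + e) = P m m * (P j j - f ^ e) + f ^ e * (P m m - f ^ e) - P j m * P m j"
        unfolding P'_def by (simp add: power_add algebra_simps)
      then show ?thesis using lowadd(1)[OF lowadd(2)[OF 1 2] 3] by simp
    qed
    moreover have "P' j l \<in> lower_terms N f (e + e)" if "j \<in> I'" "l \<in> I'" "j \<noteq> l" for j l
    proof -
      have j: "j \<in> I" "j \<noteq> m" "l \<in> I" "l \<noteq> m" using that unfolding I'_def by auto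
      have 1: "P m m * P j l \<in> lower_terms N f (e + e)"
        by (rule mon[OF less.prems(4)[OF m(1)] less.prems(5)[OF j(1,3) that(3)]])
      have 2: "P j m * P m l \<in> lower_terms N f (e + e)"
        by (rule lower_terms_mult) (use less.prems(5) j m in auto)
      show ?thesis unfolding P'_def by (rule lowadd(1)[OF 1 2])
    qed
    moreover have "(\<Sum>l\<in>I'. P' j l * v l) = 0" if "j \<in> I'" for j
    proof -
      have s: "(\<Sum>l\<in>I'. P i l * v l) = - (P i m * v m)" if "i \<in> I" for i
        using less.prems(6)[OF that] sum.remove[OF less.prems(1) m(1), of "\<lambda>l. P i l * v l"]
        unfolding I'_def by (simp add: eq_neg_iff_add_eq_0 add.commute)
      have j: "j \<in> I" using that unfolding I'_def by auto
      have "(\<Sum>l\<in>I'. P' j l * v l) = P m m * (\<Sum>l\<in>I'. P j l * v l) - P j m * (\<Sum>l\<in>I'. P m l * v l)"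
        unfolding P'_def sum_distrib_left sum_subtractf[symmetric] by (intro sum.cong) (simp_all add: algebra_simps)
      then show ?thesis unfolding s[OF j] s[OF m(1)] by (simp add: algebra_simps)
    qed
    ultimately show ?thesis by (rule less.hyps)
  qed
qed

text \<open>
  Let \<open>V\<close> generate a module with \<open>f V \<subseteq> N V\<close>. Eliminating all generators but \<open>v0\<close> leaves \<open>p * v0 = 0\<close> with
  \<open>p\<close> monic in \<open>f\<close> up to lower terms, and \<open>p = 0\<close> is an integral equation.
\<close>

lemma determinant_trick:
  fixes V :: "'a::comm_ring_1 set"
  assumes "finite V" "v0 \<in> V" "\<And>p. p * v0 = 0 \<Longrightarrow> p = 0"
    and b: "\<And>v. v \<in> V \<Longrightarrow> \<exists>b. (\<forall>w\<in>V. b w \<in> N) \<and> f * v = (\<Sum>w\<in>V. b w * w)"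
  shows "f \<in> integral_closure N"
proof -
  obtain b where b: "\<And>v w. v \<in> V \<Longrightarrow> w \<in> V \<Longrightarrow> b v w \<in> N" "\<And>v. v \<in> V \<Longrightarrow> f * v = (\<Sum>w\<in>V. b v w * w)"
    using b by metis
  \<comment> \<open>The system \<open>f * v = (\<Sum>w. b v w * w)\<close>, with everything on one side.\<close>
  define P where "P v w = (if v = w then f else 0) - b v w" for v w
  have bl: "- b v w \<in> lower_terms N f 1" if "v \<in> V" "w \<in> V" for v w
    using lower_terms_base[of 1 1 "b v w" N f] ideal_power_one[OF b(1)[OF that]]
    unfolding lower_terms_def by (simp add: ideal.span_neg)
  have "\<exists>n\<ge>1. \<exists>p. p - f ^ n \<in> lower_terms N f n \<and> p * v0 = 0"
  proof (rule elimination[OF assms(1,2), of 1 P])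
    fix v assume v: "v \<in> V"
    show "P v v - f ^ 1 \<in> lower_terms N f 1" using bl[OF v v] by (simp add: P_def)
    have "(\<Sum>w\<in>V. P v w * w) = (\<Sum>w\<in>V. (if v = w then f * w else 0)) - (\<Sum>w\<in>V. b v w * w)"
      unfolding P_def sum_subtractf[symmetric] by (intro sum.cong) (auto simp: algebra_simps)
    then show "(\<Sum>w\<in>V. P v w * w) = 0" using b(2)[OF v] v assms(1) by simp
  next
    fix v w assume "v \<in> V" "w \<in> V" "v \<noteq> w"
    then show "P v w \<in> lower_terms N f 1" using bl[of v w] by (simp add: P_def)
  qed simp
  then obtain n p where np: "n \<ge> 1" "p - f ^ n \<in> lower_terms N f n" "p * v0 = 0" by blast
  have "p = 0" by (rule assms(3)[OF np(3)])
  then have "f ^ n \<in> lower_terms N f n" using np(2) ideal.span_neg[of "- (f ^ n)"] unfolding lower_terms_def by simp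
  then show ?thesis using np(1) by (rule lower_terms_integral)
qed

section \<open>Integral closures of monomial ideals\<close>

lemma monom_sums_nonempty: "U \<noteq> {} \<Longrightarrow> monom_sums U r \<noteq> {}"
  by (induction r) auto

lemma monom_regular:
  fixes p :: "('v, 'k::comm_ring_1) mpoly"
  assumes "p * monom s = 0" shows "p = 0"
proof (rule poly_mapping_eqI)
  fix m
  have "lookup (p * monom s) (m + s) = lookup p m"
    by (simp add: monom_def lookup_times_single)
  then show "lookup p m = lookup 0 m" using assms by simp
qed

lemma span_products_explicit:
  fixes V :: "'a::comm_ring_1 set"
  assumes "finite V" "z \<in> ideal.span {a * w |a w. a \<in> N \<and> w \<in> V}" "ideal.subspace N"
  shows "\<exists>b. (\<forall>w\<in>V. b w \<in> N) \<and> z = (\<Sum>w\<in>V. b w * w)"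
  using assms(2)
proof (induction rule: ideal.span_induct_alt)
  case base
  show ?case using ideal.subspace_0[OF assms(3)] by (intro exI[of _ "\<lambda>w. 0"]) simp
next
  case (step c x y)
  obtain b where b: "\<forall>w\<in>V. b w \<in> N" "y = (\<Sum>w\<in>V. b w * w)" using step by blast
  obtain a w0 where x: "x = a * w0" "a \<in> N" "w0 \<in> V" using step by blast
  define b' where "b' w = b w + (if w = w0 then c * a else 0)" for w
  have ca: "c * a \<in> N" by (rule ideal.subspace_scale[OF assms(3) x(2)])
  have "\<forall>w\<in>V. b' w \<in> N"
  proof
    fix w assume "w \<in> V"
    then have "b w \<in> N" using b(1) by blast
    then show "b' w \<in> N"
      using ideal.subspace_add[OF assms(3) _ ca] unfolding b'_def by (cases "w = w0") simp_all
  qed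
  moreover have "(\<Sum>w\<in>V. b' w * w) = y + (\<Sum>w\<in>V. if w = w0 then c * a * w else 0)"
    unfolding b'_def b(2) sum.distrib[symmetric] by (intro sum.cong) (auto simp: algebra_simps)
  then have "c * x + y = (\<Sum>w\<in>V. b' w * w)"
    using x assms(1) by (simp add: algebra_simps)
  ultimately show ?case by blast
qed

lemma integral_equation:
  assumes "x \<in> integral_closure N"
  shows "\<exists>n\<ge>1. \<exists>a. (\<forall>i\<in>{1..n}. a i \<in> ideal_power N i) \<and> x ^ n = (\<Sum>i=1..n. - a i * x ^ (n - i))"
proof -
  obtain n a where "n \<ge> 1" "\<forall>i\<in>{1..n}. a i \<in> ideal_power N i" "x ^ n + (\<Sum>i=1..n. a i * x ^ (n - i)) = 0"
    using assms unfolding integral_closure_def by blast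
  then show ?thesis
    by (intro exI[of _ n] conjI exI[of _ a]) (simp_all add: sum_negf eq_neg_iff_add_eq_0)
qed

text \<open>
  The determinant trick is applied to the products \<open>s * x ^ i * y ^ j\<close> of total degree \<open>p\<close>, where \<open>s\<close> is a product of
  generators of the ideal. A product of degree \<open>p + 1\<close> either contains such a generator, or a power of \<open>x\<close> or \<open>y\<close> large
  enough to be rewritten by its integral equation; in all cases it is a combination of products of
  degree \<open>p\<close> with coefficients in the ideal.
\<close>

lemma integral_closure_add:
  fixes U :: "'v monom set" and x y :: "('v, 'k::field) mpoly"
  assumes U: "finite U" "U \<noteq> {}" and x: "x \<in> integral_closure (ideal.span (monom ` U))"
    and y: "y \<in> integral_closure (ideal.span (monom ` U))"
  shows "x + y \<in> integral_closure (ideal.span (monom ` U))"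
proof -
  let ?N = "ideal.span (monom ` U) :: ('v, 'k) mpoly set"
  obtain n a where n: "n \<ge> 1" "\<forall>i\<in>{1..n}. a i \<in> ideal_power ?N i" "x ^ n = (\<Sum>i=1..n. - a i * x ^ (n - i))"
    using integral_equation[OF x] by blast
  obtain m b where m: "m \<ge> 1" "\<forall>i\<in>{1..m}. b i \<in> ideal_power ?N i" "y ^ m = (\<Sum>i=1..m. - b i * y ^ (m - i))"
    using integral_equation[OF y] by blast
  \<comment> \<open>Products of degree \<open>p + 1\<close> with no factor from the ideal contain \<open>x ^ n\<close> or \<open>y ^ m\<close>.\<close>
  define p where "p = n + m"
  define V where "V = {monom s * (x ^ i * y ^ j) |s i j c. s \<in> monom_sums U c \<and> i + j + c = p}"
  have "V \<subseteq> (\<lambda>(s, i, j). monom s * (x ^ i * y ^ j)) ` ((\<Union>c\<in>{..p}. monom_sums U c) \<times> {..p} \<times> {..p})"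
  proof
    fix v assume "v \<in> V"
    then obtain s i j c where v: "v = monom s * (x ^ i * y ^ j)" "s \<in> monom_sums U c" "i + j + c = p"
      unfolding V_def by blast
    then have "(s, i, j) \<in> (\<Union>c\<in>{..p}. monom_sums U c) \<times> {..p} \<times> {..p}" by auto
    then show "v \<in> (\<lambda>(s, i, j). monom s * (x ^ i * y ^ j)) ` ((\<Union>c\<in>{..p}. monom_sums U c) \<times> {..p} \<times> {..p})"
      unfolding v(1) by (rule rev_image_eqI) simp
  qed
  then have finV: "finite V"
    by (rule finite_subset) (intro finite_imageI finite_cartesian_product finite_UN_I finite_monom_sums U(1) finite_atMost)
  define W where "W = ideal.span {a * w |a w. a \<in> ?N \<and> w \<in> V}"
  have H: "\<nu> * (x ^ i * y ^ j) \<in> W" if \<nu>: "\<nu> \<in> ideal_power ?N l" and l1: "1 \<le> l" and ijl: "i + j + l = Suc p" for \<nu> i j l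
    using \<nu> unfolding ideal_power_monom
  proof (induction rule: ideal.span_induct_alt)
    case base
    then show ?case by (simp add: W_def ideal.span_zero)
  next
    case (step c z z')
    obtain l' where l': "l = Suc l'" using l1 by (cases l) auto
    obtain u s where us: "u \<in> U" "s \<in> monom_sums U l'" "z = monom (u + s)" using step l' by auto
    have "monom s * (x ^ i * y ^ j) \<in> V"
      unfolding V_def using us(2) ijl l' by (intro CollectI exI[of _ s] exI[of _ i] exI[of _ j] exI[of _ l']) simp
    moreover have "monom u \<in> ?N" using us(1) by (intro ideal.span_base) simp
    ultimately have "monom u * (monom s * (x ^ i * y ^ j)) \<in> W"
      unfolding W_def by (intro ideal.span_base) blast
    then have "z * (x ^ i * y ^ j) \<in> W" unfolding us(3) monom_add by (simp only: mult.assoc)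
    then have "c * (z * (x ^ i * y ^ j)) + z' * (x ^ i * y ^ j) \<in> W"
      using step(2) unfolding W_def by (simp add: ideal.span_add ideal.span_scale)
    then show ?case by (simp only: distrib_right mult.assoc)
  qed
  have pow_split: "z ^ i = z ^ k * z ^ (i - k)" if "k \<le> i" for z :: "('v, 'k) mpoly" and i k
    using that by (simp add: power_add[symmetric])
  have K: "monom s * (x ^ i * y ^ j) \<in> W" if s: "s \<in> monom_sums U c" "i + j + c = Suc p" for s i j c
  proof (cases "c = 0")
    case False
    have "monom s \<in> ideal_power ?N c"
      unfolding ideal_power_monom by (intro ideal.span_base imageI s)
    then show ?thesis using H[of "monom s" c i j] False s(2) by simp
  next
    case True
    then have s0: "s = 0" and ij: "i + j = Suc (n + m)" using s by (simp_all add: p_def)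
    show ?thesis
    proof (cases "n \<le> i")
      case True
      have "x ^ i * y ^ j = (\<Sum>l=1..n. - a l * (x ^ (n - l) * x ^ (i - n) * y ^ j))"
        unfolding pow_split[OF True] n(3) by (simp add: sum_distrib_right mult.assoc)
      also have "\<dots> = (\<Sum>l=1..n. - (a l * (x ^ (i - l) * y ^ j)))"
        using True by (intro sum.cong) (auto simp: power_add[symmetric] mult.assoc)
      also have "\<dots> \<in> W"
        unfolding W_def
      proof (intro ideal.span_sum ideal.span_neg)
        fix l assume l: "l \<in> {1..n}"
        then have "a l * (x ^ (i - l) * y ^ j) \<in> W"
          using n(2) True ij by (intro H[of _ l]) (auto simp: p_def)
        then show "a l * (x ^ (i - l) * y ^ j) \<in> ideal.span {a * w |a w. a \<in> ?N \<and> w \<in> V}"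
          unfolding W_def .
      qed
      finally show ?thesis using s0 by simp
    next
      case False
      then have mj: "m \<le> j" using ij by simp
      have "x ^ i * y ^ j = (\<Sum>l=1..m. - b l * (x ^ i * (y ^ (m - l) * y ^ (j - m))))"
        unfolding pow_split[OF mj, of y] m(3) by (simp add: sum_distrib_right sum_distrib_left mult_ac)
      also have "\<dots> = (\<Sum>l=1..m. - (b l * (x ^ i * y ^ (j - l))))"
        using mj by (intro sum.cong) (auto simp: power_add[symmetric])
      also have "\<dots> \<in> W"
        unfolding W_def
      proof (intro ideal.span_sum ideal.span_neg)
        fix l assume l: "l \<in> {1..m}"
        then have "b l * (x ^ i * y ^ (j - l)) \<in> W"
          using m(2) mj ij by (intro H[of _ l]) (auto simp: p_def)
        then show "b l * (x ^ i * y ^ (j - l)) \<in> ideal.span {a * w |a w. a \<in> ?N \<and> w \<in> V}"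
          unfolding W_def .
      qed
      finally show ?thesis using s0 by simp
    qed
  qed
  obtain s0 where s0: "s0 \<in> monom_sums U p" using monom_sums_nonempty[OF U(2), of p] by blast
  show ?thesis
  proof (rule determinant_trick[OF finV])
    show "monom s0 \<in> V"
      unfolding V_def using s0 by (intro CollectI exI[of _ s0] exI[of _ 0] exI[of _ p]) simp
    show "q = 0" if "q * monom s0 = 0" for q :: "('v, 'k) mpoly" using monom_regular[OF that] .
    fix v assume "v \<in> V"
    then obtain s i j c where v: "v = monom s * (x ^ i * y ^ j)" "s \<in> monom_sums U c" "i + j + c = p"
      unfolding V_def by blast
    have "monom s * (x ^ Suc i * y ^ j) + monom s * (x ^ i * y ^ Suc j) \<in> W"
      using K[OF v(2), of "Suc i" j] K[OF v(2), of i "Suc j"] v(3) unfolding W_def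
      by (intro ideal.span_add) auto
    moreover have "(x + y) * v = monom s * (x ^ Suc i * y ^ j) + monom s * (x ^ i * y ^ Suc j)"
      unfolding v(1) by (simp add: algebra_simps)
    ultimately have "(x + y) * v \<in> W" by simp
    then show "\<exists>b. (\<forall>w\<in>V. b w \<in> ?N) \<and> (x + y) * v = (\<Sum>w\<in>V. b w * w)"
      unfolding W_def by (rule span_products_explicit[OF finV _ ideal.subspace_span])
  qed
qed

definition mtimes :: "nat \<Rightarrow> 'v monom \<Rightarrow> 'v monom" where
  "mtimes n a = Poly_Mapping.map ((*) n) a"

lemma lookup_mtimes [simp]: "lookup (mtimes n a) v = n * lookup a v"
  by (simp add: mtimes_def map.rep_eq when_def)

lemma mtimes_0 [simp]: "mtimes 0 a = 0"
  by (rule poly_mapping_eqI) simp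

lemma mtimes_Suc: "mtimes (Suc n) a = a + mtimes n a"
  by (rule poly_mapping_eqI) (simp add: lookup_add)

lemma single_power: "single a c ^ n = single (mtimes n a) (c ^ n :: 'k::comm_ring_1)"
  by (induction n) (simp_all add: mtimes_Suc mult_single)

text \<open>
  Monomials \<open>a\<close> with \<open>a ^ n\<close> in \<open>N ^ n\<close> for some \<open>n \<ge> 1\<close>, where \<open>N\<close> is the ideal generated by \<open>U\<close>.
\<close>

definition integral_monoms :: "'v monom set \<Rightarrow> 'v monom set" where
  "integral_monoms U = {a. \<exists>n\<ge>1. \<exists>s\<in>monom_sums U n. s \<unlhd> mtimes n a}"

lemma integral_monoms_upclosed:
  assumes "a \<in> integral_monoms U" "a \<unlhd> b" shows "b \<in> integral_monoms U"
proof -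
  obtain n s where s: "n \<ge> 1" "s \<in> monom_sums U n" "s \<unlhd> mtimes n a" using assms(1) unfolding integral_monoms_def by blast
  have "mtimes n a \<unlhd> mtimes n b" using assms(2) by (simp add: mdvd_def)
  then show ?thesis using s mdvd_trans[OF s(3)] unfolding integral_monoms_def by blast
qed

lemma single_integral:
  fixes c :: "'k::field"
  assumes "a \<in> integral_monoms U"
  shows "single a c \<in> integral_closure (ideal.span (monom ` U))"
proof -
  obtain n s where s: "n \<ge> 1" "s \<in> monom_sums U n" "s \<unlhd> mtimes n a" using assms unfolding integral_monoms_def by blast
  have "single a c ^ n \<in> ideal_power (ideal.span (monom ` U)) n"
    unfolding single_power ideal_power_monom unfolding span_monom using s(2,3) by auto
  then have "single a c ^ n * single a c ^ (n - n) \<in> lower_terms (ideal.span (monom ` U)) (single a c) n"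
    using s(1) by (intro lower_terms_base) auto
  then show ?thesis using s(1) by (intro lower_terms_integral[of _ n]) simp_all
qed

text \<open>
  The weight \<open>w\<close> has a strict maximum at \<open>a\<close> among the monomials of \<open>f\<close>: \<open>a\<close> is an exposed vertex of the Newton
  polytope.
\<close>

definition top_monom :: "('v monom \<Rightarrow> nat) \<Rightarrow> ('v, 'k::zero) mpoly \<Rightarrow> 'v monom \<Rightarrow> bool" where
  "top_monom w f a \<longleftrightarrow> a \<in> keys f \<and> (\<forall>m\<in>keys f. m \<noteq> a \<longrightarrow> w m < w a)"

text \<open>
  No cancellation is possible at a monomial that arises from only one pair of terms.
\<close>

lemma lookup_times_unique:
  fixes f g :: "('v, 'k::field) mpoly"
  assumes "a \<in> keys f" "b \<in> keys g"
    and uniq: "\<And>x y. x \<in> keys f \<Longrightarrow> y \<in> keys g \<Longrightarrow> x + y = a + b \<Longrightarrow> x = a \<and> y = b"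
  shows "a + b \<in> keys (f * g)"
proof -
  have "lookup (f * g) (a + b) = (\<Sum>x\<in>keys f. \<Sum>y\<in>keys g. if x + y = a + b then lookup f x * lookup g y else 0)"
    by (rule lookup_times) simp_all
  also have "\<dots> = (\<Sum>x\<in>keys f. \<Sum>y\<in>keys g. if y = b then (if x = a then lookup f a * lookup g b else 0) else 0)"
  proof (intro sum.cong refl)
    fix x y assume "x \<in> keys f" "y \<in> keys g"
    then show "(if x + y = a + b then lookup f x * lookup g y else 0)
        = (if y = b then (if x = a then lookup f a * lookup g b else 0) else 0)"
      using uniq[of x y] by auto
  qed
  also have "\<dots> = lookup f a * lookup g b" using assms(1,2) by simp
  finally show ?thesis using assms(1,2) by (simp add: in_keys_iff)
qed

lemma top_monom_mult:
  fixes f g :: "('v, 'k::field) mpoly"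
  assumes w: "\<And>a b. w (a + b) = w a + w b" and f: "top_monom w f a" and g: "top_monom w g b"
  shows "top_monom w (f * g) (a + b)"
proof -
  have le: "x = a \<and> y = b \<or> w (x + y) < w (a + b)" if "x \<in> keys f" "y \<in> keys g" for x y
    using f g that unfolding top_monom_def w by (metis add_less_le_mono add_le_less_mono less_or_eq_imp_le order_refl)
  have "a + b \<in> keys (f * g)"
    by (rule lookup_times_unique) (use f g le in \<open>fastforce simp: top_monom_def\<close>)+
  moreover have "w m < w (a + b)" if "m \<in> keys (f * g)" "m \<noteq> a + b" for m
    using keys_times[OF that(1)] le that(2) by blast
  ultimately show ?thesis unfolding top_monom_def by blast
qed

lemma top_monom_power:
  fixes f :: "('v, 'k::field) mpoly"
  assumes w: "\<And>a b. w (a + b) = w a + w b" and f: "top_monom w f a"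
  shows "top_monom w (f ^ n) (mtimes n a)"
proof (induction n)
  case 0
  show ?case by (simp add: top_monom_def)
next
  case (Suc n)
  show ?case unfolding power_Suc mtimes_Suc by (rule top_monom_mult[OF w f Suc])
qed

text \<open>
  A monomial of maximal Euclidean norm is exposed, the weight being the inner product with itself: among vectors
  of norm at most that of \<open>a\<close>, the inner product with \<open>a\<close> is largest only at \<open>a\<close>.
\<close>

lemma exposed_monom:
  fixes f :: "('v::finite, 'k::zero) mpoly"
  assumes "f \<noteq> 0"
  shows "\<exists>w a. (\<forall>a b. w (a + b) = w a + w b) \<and> top_monom w f a"
proof -
  define nrm where "nrm a = (\<Sum>v\<in>UNIV. lookup a v * lookup a v)" for a :: "'v monom"
  have ne: "keys f \<noteq> {}" using assms poly_mapping_eqI[of f 0] by (auto simp: in_keys_iff)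
  then have "Max (nrm ` keys f) \<in> nrm ` keys f" by (intro Max_in) auto
  then obtain a where a: "a \<in> keys f" "nrm a = Max (nrm ` keys f)" by auto
  have amax: "nrm m \<le> nrm a" if "m \<in> keys f" for m unfolding a(2) using that by (intro Max_ge) auto
  \<comment> \<open>The inner product with \<open>a\<close>.\<close>
  define w where "w m = (\<Sum>v\<in>UNIV. lookup a v * lookup m v)" for m
  have "w m < w a" if m: "m \<in> keys f" "m \<noteq> a" for m
  proof -
    obtain v0 where v0: "lookup m v0 \<noteq> lookup a v0" using m(2) poly_mapping_eqI[of m a] by auto
    \<comment> \<open>Expanding the squared distance of \<open>a\<close> and \<open>m\<close>.\<close>
    have "0 < (\<Sum>v\<in>UNIV. (int (lookup a v) - int (lookup m v)) ^ 2)"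
      using v0 by (intro sum_pos2[of _ v0]) auto
    also have "\<dots> = (\<Sum>v\<in>UNIV. int (lookup a v * lookup a v) + int (lookup m v * lookup m v) - 2 * int (lookup a v * lookup m v))"
      by (intro sum.cong) (simp_all add: power2_eq_square algebra_simps)
    also have "\<dots> = int (nrm a) + int (nrm m) - 2 * int (w m)"
      unfolding nrm_def w_def by (simp add: sum.distrib sum_subtractf sum_distrib_left)
    finally have "2 * w m < nrm a + nrm m" by simp
    moreover have "w a = nrm a" by (simp add: w_def nrm_def)
    ultimately show ?thesis using amax[OF m(1)] by simp
  qed
  then have "top_monom w f a" using a(1) by (simp add: top_monom_def)
  moreover have "\<forall>a b. w (a + b) = w a + w b" by (simp add: w_def lookup_add sum.distrib algebra_simps)
  ultimately show ?thesis by blast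
qed

text \<open>
  Repeated use of the integral equation writes each power \<open>f ^ p\<close> as a combination of \<open>f ^ j\<close> with \<open>j < n\<close> and
  coefficients in \<open>N ^ (p - j)\<close>, so \<open>f ^ (p + n)\<close> lies in \<open>N ^ p\<close>.
\<close>

lemma integral_power_mem:
  fixes N :: "'a::comm_ring_1 set"
  assumes N: "ideal.subspace N" and f: "f \<in> integral_closure N"
  shows "\<exists>n. \<forall>p. f ^ (p + n) \<in> ideal_power N p"
proof -
  obtain n a where n: "n \<ge> 1" "\<forall>i\<in>{1..n}. a i \<in> ideal_power N i" "f ^ n = (\<Sum>i=1..n. - a i * f ^ (n - i))"
    using integral_equation[OF f] by blast
  define Q where "Q p = ideal.span {\<nu> * f ^ j |\<nu> i j. j < n \<and> i + j = p \<and> \<nu> \<in> ideal_power N i}" for p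
  have Qbase: "\<nu> * f ^ j \<in> Q p" if "j < n" "i + j = p" "\<nu> \<in> ideal_power N i" for \<nu> i j p
    unfolding Q_def using that by (intro ideal.span_base) blast
  have step: "f * z \<in> Q (Suc p)" if "z \<in> Q p" for z p
    using that unfolding Q_def[of p]
  proof (induction rule: ideal.span_induct_alt)
    case base
    then show ?case by (simp add: Q_def ideal.span_zero)
  next
    case (step c x y)
    obtain \<nu> i j where x: "x = \<nu> * f ^ j" "j < n" "i + j = p" "\<nu> \<in> ideal_power N i" using step by blast
    have "f * x \<in> Q (Suc p)"
    proof (cases "Suc j < n")
      case True
      have "\<nu> * f ^ Suc j \<in> Q (Suc p)" by (rule Qbase[OF True _ x(4)]) (use x(3) in simp)
      then show ?thesis unfolding x(1) by (simp add: algebra_simps)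
    next
      case False
      then have j: "Suc j = n" using x(2) by simp
      have "f * x = \<nu> * f ^ n" unfolding x(1) j[symmetric] by (simp add: algebra_simps)
      also have "\<dots> = (\<Sum>l=1..n. - ((\<nu> * a l) * f ^ (n - l)))"
        unfolding n(3) by (simp add: sum_distrib_left mult.assoc)
      also have "\<dots> \<in> Q (Suc p)"
      proof -
        have "(\<nu> * a l) * f ^ (n - l) \<in> Q (Suc p)" if "l \<in> {1..n}" for l
          by (rule Qbase[of _ "i + l"]) (use that x j n(2) in \<open>auto intro: ideal_power_mult\<close>)
        then show ?thesis unfolding Q_def by (intro ideal.span_sum ideal.span_neg)
      qed
      finally show ?thesis .
    qed
    then have "c * (f * x) + f * y \<in> Q (Suc p)"
      using step(2) unfolding Q_def by (simp add: ideal.span_add ideal.span_scale)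
    then show ?case by (simp add: algebra_simps)
  qed
  have fQ: "f ^ p \<in> Q p" for p
  proof (induction p)
    case 0
    show ?case using Qbase[of 0 0 0 1] n(1) by simp
  next
    case (Suc p)
    then show ?case using step by simp
  qed
  have "Q (p + n) \<subseteq> ideal_power N p" for p
    unfolding Q_def
  proof (intro ideal.span_minimal ideal_power_subspace subsetI)
    fix z assume "z \<in> {\<nu> * f ^ j |\<nu> i j. j < n \<and> i + j = p + n \<and> \<nu> \<in> ideal_power N i}"
    then obtain \<nu> i j where z: "z = \<nu> * f ^ j" "j < n" "i + j = p + n" "\<nu> \<in> ideal_power N i" by blast
    have "\<nu> \<in> ideal_power N p" using ideal_power_antimono[OF N, of p i] z by auto
    then show "z \<in> ideal_power N p"
      unfolding z(1) using ideal.subspace_scale[OF ideal_power_subspace, of \<nu> N p "f ^ j"] by (simp add: mult.commute)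
  qed
  then show ?thesis using fQ by blast
qed

text \<open>
  A product of generators is recorded by the multiplicity of each generator; this is the form to which Dickson's
  lemma applies.
\<close>

lemma monom_sums_counts:
  assumes "finite U"
  shows "s \<in> monom_sums U t \<longleftrightarrow> (\<exists>k. (\<Sum>u\<in>U. k u) = t \<and> (\<forall>v. lookup s v = (\<Sum>u\<in>U. k u * lookup u v)))"
proof (induction t arbitrary: s)
  case 0
  show ?case
  proof
    assume "s \<in> monom_sums U 0"
    then show "\<exists>k. (\<Sum>u\<in>U. k u) = 0 \<and> (\<forall>v. lookup s v = (\<Sum>u\<in>U. k u * lookup u v))"
      by (intro exI[of _ "\<lambda>u. 0"]) simp
  next
    assume "\<exists>k. (\<Sum>u\<in>U. k u) = 0 \<and> (\<forall>v. lookup s v = (\<Sum>u\<in>U. k u * lookup u v))"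
    then have "\<forall>v. lookup s v = 0" using assms by auto
    then have "s = 0" by (intro poly_mapping_eqI) simp
    then show "s \<in> monom_sums U 0" by simp
  qed
next
  case (Suc t)
  show ?case
  proof
    assume "s \<in> monom_sums U (Suc t)"
    then obtain u b where u: "u \<in> U" "b \<in> monom_sums U t" "s = u + b" by auto
    obtain k where k: "(\<Sum>u\<in>U. k u) = t" "\<forall>v. lookup b v = (\<Sum>u\<in>U. k u * lookup u v)"
      using u(2) Suc by blast
    define k' where "k' x = k x + (if x = u then 1 else 0)" for x
    have "(\<Sum>x\<in>U. k' x) = Suc t" using k(1) u(1) assms by (simp add: k'_def sum.distrib)
    moreover have "lookup s v = (\<Sum>x\<in>U. k' x * lookup x v)" for v
    proof -
      have "(\<Sum>x\<in>U. k' x * lookup x v) = (\<Sum>x\<in>U. k x * lookup x v) + (\<Sum>x\<in>U. if x = u then lookup x v else 0)"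
        unfolding k'_def sum.distrib[symmetric] by (intro sum.cong) (auto simp: algebra_simps)
      then show ?thesis using k(2) u assms by (simp add: lookup_add)
    qed
    ultimately show "\<exists>k. (\<Sum>u\<in>U. k u) = Suc t \<and> (\<forall>v. lookup s v = (\<Sum>u\<in>U. k u * lookup u v))" by blast
  next
    assume "\<exists>k. (\<Sum>u\<in>U. k u) = Suc t \<and> (\<forall>v. lookup s v = (\<Sum>u\<in>U. k u * lookup u v))"
    then obtain k where k: "(\<Sum>u\<in>U. k u) = Suc t" "\<And>v. lookup s v = (\<Sum>u\<in>U. k u * lookup u v)" by blast
    have "\<exists>u\<in>U. k u \<noteq> 0"
    proof (rule ccontr)
      assume "\<not> (\<exists>u\<in>U. k u \<noteq> 0)"
      then have "(\<Sum>u\<in>U. k u) = 0" by simp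
      then show False using k(1) by simp
    qed
    then obtain u where u: "u \<in> U" "k u \<noteq> 0" by blast
    define k' where "k' x = (if x = u then k u - 1 else k x)" for x
    have kk: "k x = k' x + (if x = u then 1 else 0)" for x using u(2) by (simp add: k'_def)
    have "Suc t = (\<Sum>x\<in>U. k' x) + (\<Sum>x\<in>U. if x = u then 1 else 0)"
      unfolding k(1)[symmetric] sum.distrib[symmetric] by (intro sum.cong) (auto simp: kk)
    then have 1: "(\<Sum>x\<in>U. k' x) = t" using u(1) assms by simp
    have 2: "lookup s v = (\<Sum>x\<in>U. k' x * lookup x v) + lookup u v" for v
    proof -
      have "lookup s v = (\<Sum>x\<in>U. k' x * lookup x v) + (\<Sum>x\<in>U. if x = u then lookup x v else 0)"
        unfolding k(2) sum.distrib[symmetric] by (intro sum.cong) (auto simp: kk algebra_simps)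
      then show ?thesis using u(1) assms by simp
    qed
    have "lookup (s - u) v = (\<Sum>x\<in>U. k' x * lookup x v)" for v using 2 by (simp add: lookup_minus)
    then have "s - u \<in> monom_sums U t" using 1 Suc by blast
    moreover have "u \<unlhd> s" using 2 by (simp add: mdvd_def)
    then have "s = u + (s - u)" by (simp add: mdvd_diff)
    ultimately show "s \<in> monom_sums U (Suc t)" using u(1) unfolding monom_sums.simps by blast
  qed
qed

text \<open>
  For every \<open>t\<close> the monomial \<open>a ^ (t + n)\<close> occurs in \<open>f ^ (t + n)\<close>, hence is divisible by a product of \<open>t\<close> generators. By
  Dickson's lemma there are \<open>i < j\<close> such that both the multiplicities of the generators and the cofactors grow
  from \<open>i\<close> to \<open>j\<close>; the quotient of the two divisibilities shows that \<open>a ^ (j - i)\<close> is divisible by a product of \<open>j - i\<close>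
  generators.
\<close>

lemma exposed_in_integral_monoms:
  fixes f :: "('v::finite, 'k::field) mpoly"
  assumes U: "finite U" and w: "\<And>a b. w (a + b) = w a + w b" and f: "top_monom w f a"
    and N: "\<And>p. f ^ (p + n) \<in> ideal_power (ideal.span (monom ` U)) p"
  shows "a \<in> integral_monoms U"
proof -
  have "\<exists>k. (\<Sum>u\<in>U. k u) = t \<and> (\<forall>v. (\<Sum>u\<in>U. k u * lookup u v) \<le> (t + n) * lookup a v)" for t
  proof -
    have "mtimes (t + n) a \<in> keys (f ^ (t + n))"
      using top_monom_power[OF w f] by (simp add: top_monom_def)
    then obtain s where s: "s \<in> monom_sums U t" "s \<unlhd> mtimes (t + n) a"
      using N[of t] unfolding ideal_power_monom unfolding span_monom by blast
    obtain k where "(\<Sum>u\<in>U. k u) = t" "\<forall>v. lookup s v = (\<Sum>u\<in>U. k u * lookup u v)"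
      using s(1) unfolding monom_sums_counts[OF U] by blast
    then show ?thesis using s(2) unfolding mdvd_def by (intro exI[of _ k]) simp
  qed
  then obtain k where k: "\<And>t. (\<Sum>u\<in>U. k t u) = t"
    "\<And>t v. (\<Sum>u\<in>U. k t u * lookup u v) \<le> (t + n) * lookup a v" by metis
  \<comment> \<open>The exponents of the cofactor; the subtraction does not truncate by the choice of \<open>k\<close>.\<close>
  define sl where "sl t v = (t + n) * lookup a v - (\<Sum>u\<in>U. k t u * lookup u v)" for t v
  have "finite (Inl ` U \<union> Inr ` (UNIV :: 'v set))" using U by simp
  then obtain i j where ij: "i < j" "\<forall>x\<in>Inl ` U \<union> Inr ` (UNIV :: 'v set). case_sum (k i) (sl i) x \<le> case_sum (k j) (sl j) x"
    using dickson[of "Inl ` U \<union> Inr ` (UNIV :: 'v set)" "\<lambda>t. case_sum (k t) (sl t)"] by blast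
  have kle: "k i u \<le> k j u" if "u \<in> U" for u
  proof -
    have "case_sum (k i) (sl i) (Inl u) \<le> case_sum (k j) (sl j) (Inl u)" using ij(2) that by blast
    then show ?thesis by simp
  qed
  have sle: "sl i v \<le> sl j v" for v
  proof -
    have "case_sum (k i) (sl i) (Inr v) \<le> case_sum (k j) (sl j) (Inr v)" using ij(2) by blast
    then show ?thesis by simp
  qed
  define s where "s = (\<Sum>u\<in>U. mtimes (k j u - k i u) u)"
  have ls: "lookup s v = (\<Sum>u\<in>U. (k j u - k i u) * lookup u v)" for v
    by (simp add: s_def lookup_sum)
  have sm: "(\<Sum>u\<in>U. k j u - k i u) = j - i"
    using sum_subtractf_nat[of U "k i" "k j"] kle k(1) by simp
  have "s \<in> monom_sums U (j - i)" unfolding monom_sums_counts[OF U] using ls sm by blast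
  moreover have "s \<unlhd> mtimes (j - i) a"
    unfolding mdvd_def
  proof
    fix v
    have "lookup s v + (\<Sum>u\<in>U. k i u * lookup u v) = (\<Sum>u\<in>U. k j u * lookup u v)"
      unfolding ls sum.distrib[symmetric] by (intro sum.cong) (auto simp: kle diff_mult_distrib mult_le_mono1)
    moreover have "(i + n) * lookup a v - (\<Sum>u\<in>U. k i u * lookup u v) \<le> (j + n) * lookup a v - (\<Sum>u\<in>U. k j u * lookup u v)"
      using sle[of v] by (simp add: sl_def)
    moreover have "(j + n) * lookup a v = (i + n) * lookup a v + (j - i) * lookup a v"
      using ij(1) by (simp add: add_mult_distrib[symmetric])
    ultimately have "lookup s v \<le> (j - i) * lookup a v"
      using k(2)[of i v] k(2)[of j v] by linarith
    then show "lookup s v \<le> lookup (mtimes (j - i) a) v" by simp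
  qed
  ultimately show ?thesis unfolding integral_monoms_def using ij(1) by (intro CollectI exI[of _ "j - i"]) auto
qed

text \<open>
  For the harder inclusion, an exposed monomial of an integral \<open>f\<close> is integral by the previous lemma; its term is
  subtracted, which keeps \<open>f\<close> integral, and the argument is repeated with fewer terms.
\<close>

theorem integral_closure_monomial:
  fixes U :: "'v::finite monom set"
  assumes U: "finite U"
  shows "integral_closure (ideal.span (monom ` U)) = (ideal.span (monom ` integral_monoms U) :: ('v, 'k::field) mpoly set)"
proof
  let ?N = "ideal.span (monom ` U) :: ('v, 'k) mpoly set"
  have zero: "0 \<in> integral_closure ?N"
    by (rule lower_terms_integral[of _ 1]) (simp_all add: lower_terms_def ideal.span_zero)
  have add: "x + y \<in> integral_closure ?N" if "x \<in> integral_closure ?N" "y \<in> integral_closure ?N" "U \<noteq> {}" for x y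
    using integral_closure_add[OF U that(3,1,2)] .
  have ne: "U \<noteq> {}" if "integral_monoms U \<noteq> {}"
  proof
    assume "U = {}"
    then have "monom_sums U n = {}" if "n \<ge> 1" for n using that by (cases n) auto
    then show False using that unfolding integral_monoms_def by auto
  qed
  have keys_integral_monoms: "f \<in> ideal.span (monom ` integral_monoms U) \<longleftrightarrow> keys f \<subseteq> integral_monoms U" for f :: "('v, 'k) mpoly"
    unfolding span_monom using integral_monoms_upclosed mdvd_refl by blast
  show "ideal.span (monom ` integral_monoms U) \<subseteq> integral_closure ?N"
  proof
    fix f :: "('v, 'k) mpoly" assume "f \<in> ideal.span (monom ` integral_monoms U)"
    then have f: "keys f \<subseteq> integral_monoms U" unfolding keys_integral_monoms .
    have "(\<Sum>a\<in>A. single a (lookup f a)) \<in> integral_closure ?N" if "finite A" "A \<subseteq> integral_monoms U" for A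
      using that
    proof induction
      case empty
      show ?case using zero by simp
    next
      case (insert a A)
      then show ?case using add[OF single_integral[of a U "lookup f a"]] ne by auto
    qed
    from this[OF finite_keys f] show "f \<in> integral_closure ?N"
      by (simp add: poly_mapping_sum_single[OF finite_keys order_refl, of f, symmetric])
  qed
  show "integral_closure ?N \<subseteq> ideal.span (monom ` integral_monoms U)"
  proof
    fix f assume "f \<in> integral_closure ?N"
    then have "keys f \<subseteq> integral_monoms U"
    proof (induction "card (keys f)" arbitrary: f rule: less_induct)
      case less
      show ?case
      proof (cases "f = 0")
        case False
        obtain w a where w: "\<And>a b. w (a + b) = w a + w b" and a: "top_monom w f a"
          using exposed_monom[OF False] by blast
        obtain n where n: "\<And>p. f ^ (p + n) \<in> ideal_power ?N p"
          using integral_power_mem[OF ideal.subspace_span less.prems] by blast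
        have ai: "a \<in> integral_monoms U" by (rule exposed_in_integral_monoms[OF U w a n])
        then have U': "U \<noteq> {}" using ne by blast
        \<comment> \<open>The polynomial \<open>f\<close> without its term at \<open>a\<close>.\<close>
        define g where "g = f + single a (- lookup f a)"
        have kg: "keys g = keys f - {a}"
          unfolding g_def by (auto simp: in_keys_iff lookup_add lookup_single when_def split: if_splits)
        have "card (keys g) < card (keys f)"
          unfolding kg using a by (intro psubset_card_mono) (auto simp: top_monom_def)
        moreover have "g \<in> integral_closure ?N"
          unfolding g_def by (rule add[OF less.prems single_integral[OF ai] U'])
        ultimately have "keys g \<subseteq> integral_monoms U" by (rule less.hyps)
        then show ?thesis using kg ai by blast
      qed simp
    qed
    then show "f \<in> ideal.span (monom ` integral_monoms U)" unfolding keys_integral_monoms .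
  qed
qed

section \<open>Symbolic powers of squarefree monomial ideals\<close>

definition deg_on :: "'v set \<Rightarrow> 'v monom \<Rightarrow> nat" where
  "deg_on C m = (\<Sum>v\<in>C. lookup m v)"

definition cover :: "'v set \<Rightarrow> 'v monom set \<Rightarrow> bool" where
  "cover C U \<longleftrightarrow> (\<forall>u\<in>U. \<exists>v\<in>C. 0 < lookup u v)"

definition minimal_cover :: "'v set \<Rightarrow> 'v monom set \<Rightarrow> bool" where
  "minimal_cover C U \<longleftrightarrow> cover C U \<and> (\<forall>C'. C' \<subset> C \<longrightarrow> \<not> cover C' U)"

text \<open>
  The polynomials all of whose monomials have degree at least \<open>r\<close> in the variables \<open>C\<close>. For \<open>r = 1\<close> this is the ideal
  generated by these variables, and in general its \<open>r\<close>-th power.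
\<close>

definition deg_ideal :: "nat \<Rightarrow> 'v set \<Rightarrow> ('v, 'k::zero) mpoly set" where
  "deg_ideal r C = {f. \<forall>m\<in>keys f. r \<le> deg_on C m}"

lemma deg_on_add: "deg_on C (a + b) = deg_on C a + deg_on C b"
  by (simp add: deg_on_def lookup_add sum.distrib)

lemma deg_on_mono: "a \<unlhd> b \<Longrightarrow> deg_on C a \<le> deg_on C b"
  unfolding deg_on_def mdvd_def by (simp add: sum_mono)

lemma deg_on_pos:
  assumes "finite C" shows "0 < deg_on C m \<longleftrightarrow> (\<exists>v\<in>C. 0 < lookup m v)"
proof -
  have "deg_on C m = 0 \<longleftrightarrow> (\<forall>v\<in>C. lookup m v = 0)"
    unfolding deg_on_def using assms by (rule sum_eq_0_iff)
  then show ?thesis by auto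
qed

lemma deg_ideal_subspace: "ideal.subspace (deg_ideal r C :: ('v, 'k::comm_ring_1) mpoly set)"
proof (rule ideal.subspaceI)
  show "0 \<in> deg_ideal r C" by (simp add: deg_ideal_def)
  fix x y :: "('v, 'k) mpoly" assume "x \<in> deg_ideal r C" "y \<in> deg_ideal r C"
  then show "x + y \<in> deg_ideal r C" unfolding deg_ideal_def using Poly_Mapping.keys_add[of x y] by blast
next
  fix c x :: "('v, 'k) mpoly" assume x: "x \<in> deg_ideal r C"
  show "c * x \<in> deg_ideal r C"
    unfolding deg_ideal_def
  proof (intro CollectI ballI)
    fix m assume "m \<in> keys (c * x)"
    then obtain a b where ab: "b \<in> keys x" "m = a + b" using keys_times by blast
    then have "r \<le> deg_on C b" using x by (simp add: deg_ideal_def)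
    then show "r \<le> deg_on C m" unfolding ab(2) deg_on_add by simp
  qed
qed

text \<open>
  Among the monomials of lowest degree on \<open>C\<close>, choose \<open>a\<close> in \<open>f\<close> and \<open>b\<close> in \<open>g\<close> such that \<open>a + b\<close> has maximal Euclidean
  norm. If also \<open>a + b = x + y\<close>, then \<open>a + y\<close> and \<open>x + b\<close> have midpoint \<open>a + b\<close>, so by the parallelogram law one of
  them would be longer unless \<open>x = a\<close>. Hence \<open>a + b\<close> survives in the product. For empty \<open>C\<close> this says that
  the polynomial ring is a domain.
\<close>

lemma lowest_degree_mult:
  fixes f g :: "('v::finite, 'k::field) mpoly"
  assumes "f \<noteq> 0" "g \<noteq> 0"
  shows "\<exists>a\<in>keys f. \<exists>b\<in>keys g. a + b \<in> keys (f * g) \<and>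
    (\<forall>x\<in>keys f. deg_on C a \<le> deg_on C x) \<and> (\<forall>y\<in>keys g. deg_on C b \<le> deg_on C y)"
proof -
  define nrm where "nrm a = (\<Sum>v\<in>UNIV. lookup a v * lookup a v)" for a :: "'v monom"
  define lowest where "lowest h = {a\<in>keys h. \<forall>x\<in>keys h. deg_on C a \<le> deg_on C x}" for h :: "('v, 'k) mpoly"
  have lowest_ne: "lowest h \<noteq> {}" if "h \<noteq> 0" for h
  proof -
    have ne: "keys h \<noteq> {}" using that poly_mapping_eqI[of h 0] by (auto simp: in_keys_iff)
    have "Min (deg_on C ` keys h) \<in> deg_on C ` keys h" using ne by (intro Min_in) auto
    then obtain a where a: "a \<in> keys h" "deg_on C a = Min (deg_on C ` keys h)" by auto
    have "deg_on C a \<le> deg_on C x" if "x \<in> keys h" for x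
      unfolding a(2) using that by (intro Min_le) auto
    then show ?thesis using a(1) unfolding lowest_def by blast
  qed
  define Z where "Z = lowest f \<times> lowest g"
  have finZ: "finite Z" "Z \<noteq> {}"
    using lowest_ne[OF assms(1)] lowest_ne[OF assms(2)] unfolding Z_def lowest_def by auto
  have "Max ((\<lambda>(a, b). nrm (a + b)) ` Z) \<in> (\<lambda>(a, b). nrm (a + b)) ` Z" using finZ by (intro Max_in) auto
  then obtain a b where ab: "(a, b) \<in> Z" "nrm (a + b) = Max ((\<lambda>(a, b). nrm (a + b)) ` Z)" by auto
  have abmax: "nrm (x + y) \<le> nrm (a + b)" if "(x, y) \<in> Z" for x y
    unfolding ab(2) using finZ(1) that by (intro Max_ge) auto
  have a: "a \<in> keys f" "\<forall>x\<in>keys f. deg_on C a \<le> deg_on C x" and b: "b \<in> keys g" "\<forall>y\<in>keys g. deg_on C b \<le> deg_on C y"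
    using ab(1) unfolding Z_def lowest_def by auto
  have uniq: "x = a \<and> y = b" if x: "x \<in> keys f" and y: "y \<in> keys g" and eq: "x + y = a + b" for x y
  proof -
    have "deg_on C x + deg_on C y = deg_on C a + deg_on C b" using eq by (simp add: deg_on_add[symmetric])
    moreover have "deg_on C a \<le> deg_on C x" "deg_on C b \<le> deg_on C y" using a(2) b(2) x y by auto
    ultimately have "deg_on C x = deg_on C a" "deg_on C y = deg_on C b" by linarith+
    then have "(a, y) \<in> Z" "(x, b) \<in> Z"
      using a b x y unfolding Z_def lowest_def by auto
    then have le: "nrm (a + y) \<le> nrm (a + b)" "nrm (x + b) \<le> nrm (a + b)" using abmax by auto
    have xa: "x = a"
    proof (rule ccontr)
      assume "x \<noteq> a"
      then obtain v0 where v0: "lookup x v0 \<noteq> lookup a v0" using poly_mapping_eqI[of x a] by auto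
      have eqv: "int (lookup x v) + int (lookup y v) = int (lookup a v) + int (lookup b v)" for v
        using eq by (metis lookup_add of_nat_add)
      have "0 < (\<Sum>v\<in>UNIV. 2 * (int (lookup x v) - int (lookup a v)) ^ 2)"
        using v0 by (intro sum_pos2[of _ v0]) auto
      also have "\<dots> = (\<Sum>v\<in>UNIV. int (lookup (a + y) v * lookup (a + y) v) + int (lookup (x + b) v * lookup (x + b) v)
          - 2 * int (lookup (a + b) v * lookup (a + b) v))"
      proof (rule sum.cong[OF refl])
        fix v
        have yv: "int (lookup y v) = int (lookup a v) + int (lookup b v) - int (lookup x v)" using eqv[of v] by simp
        show "2 * (int (lookup x v) - int (lookup a v)) ^ 2 = int (lookup (a + y) v * lookup (a + y) v)
            + int (lookup (x + b) v * lookup (x + b) v) - 2 * int (lookup (a + b) v * lookup (a + b) v)"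
          by (simp add: lookup_add yv power2_eq_square algebra_simps)
      qed
      also have "\<dots> = int (nrm (a + y)) + int (nrm (x + b)) - 2 * int (nrm (a + b))"
        unfolding nrm_def by (simp add: sum.distrib sum_subtractf sum_distrib_left)
      finally show False using le by linarith
    qed
    then show ?thesis using eq by simp
  qed
  have "a + b \<in> keys (f * g)"
    by (rule lookup_times_unique[OF a(1) b(1) uniq])
  then show ?thesis using a b by blast
qed

lemma lowest_degree_zero:
  fixes t f :: "('v::finite, 'k::field) mpoly"
  assumes "t \<notin> deg_ideal 1 C" "t * f \<in> deg_ideal r C" shows "f \<in> deg_ideal r C"
proof (cases "f = 0")
  case False
  obtain m0 where m0: "m0 \<in> keys t" "deg_on C m0 = 0" using assms(1) unfolding deg_ideal_def by auto
  have "t \<noteq> 0" using m0 by auto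
  from lowest_degree_mult[OF this False, of C] obtain a b where
    ab: "a + b \<in> keys (t * f)" "deg_on C a \<le> deg_on C m0" "\<forall>y\<in>keys f. deg_on C b \<le> deg_on C y"
    using m0(1) by blast
  have "r \<le> deg_on C (a + b)" using assms(2) ab(1) by (simp add: deg_ideal_def)
  then have "r \<le> deg_on C b" using ab(2) m0(2) by (simp add: deg_on_add)
  then show ?thesis using ab(3) unfolding deg_ideal_def by (intro CollectI ballI) (meson order_trans)
qed (simp add: deg_ideal_def)

lemma one_notin_deg_ideal: "(1 :: ('v, 'k::comm_ring_1) mpoly) \<notin> deg_ideal 1 C"
  by (simp add: deg_ideal_def deg_on_def)

lemma prime_deg_ideal: "prime_ideal (deg_ideal 1 C :: ('v::finite, 'k::field) mpoly set)"
  unfolding prime_ideal_def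
  using lowest_degree_zero[of _ C _ 1] deg_ideal_subspace one_notin_deg_ideal by blast

lemma Var_in_deg_ideal: "Var v \<in> (deg_ideal 1 C :: ('v::finite, 'k::field) mpoly set) \<longleftrightarrow> v \<in> C"
proof -
  have "deg_on C (single v 1) = (if v \<in> C then 1 else 0)"
    unfolding deg_on_def by (simp add: lookup_single when_def)
  then show ?thesis by (simp add: deg_ideal_def Var_def del: One_nat_def)
qed

lemma single_eq_times_Var:
  assumes "0 < lookup m v"
  shows "single m c = single (m - single v 1) c * (Var v :: ('v, 'k::comm_ring_1) mpoly)"
proof -
  have "single v 1 \<unlhd> m" using assms unfolding mdvd_def by (auto simp: lookup_single when_def)
  then show ?thesis
    using mdvd_diff(2)[of "single v 1" m] by (simp add: Var_def monom_def mult_single del: One_nat_def)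
qed

lemma deg_ideal_subset_prime:
  fixes P :: "('v::finite, 'k::field) mpoly set"
  assumes P: "ideal.subspace P" "\<And>v. v \<in> C \<Longrightarrow> Var v \<in> P"
  shows "deg_ideal 1 C \<subseteq> P"
proof
  fix f :: "('v, 'k) mpoly" assume f: "f \<in> deg_ideal 1 C"
  have "single m (lookup f m) \<in> P" if "m \<in> keys f" for m
  proof -
    have "0 < deg_on C m" using f that by (auto simp: deg_ideal_def)
    then obtain v where v: "v \<in> C" "0 < lookup m v" using deg_on_pos[of C m] by auto
    show ?thesis
      unfolding single_eq_times_Var[OF v(2)] by (rule ideal.subspace_scale[OF P(1) P(2)[OF v(1)]])
  qed
  then have "(\<Sum>m\<in>keys f. single m (lookup f m)) \<in> P" by (rule ideal.subspace_sum[OF P(1)])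
  then show "f \<in> P" by (simp add: poly_mapping_sum_single[OF finite_keys order_refl, of f, symmetric])
qed

lemma prime_monom:
  fixes P :: "('v::finite, 'k::field) mpoly set"
  assumes P: "prime_ideal P" and u: "monom u \<in> P"
  shows "\<exists>v. 0 < lookup u v \<and> Var v \<in> P"
  using u
proof (induction "\<Sum>v\<in>UNIV. lookup u v" arbitrary: u rule: less_induct)
  case less
  show ?case
  proof (cases "u = 0")
    case True
    then have "1 \<in> P" using less.prems by simp
    then have "x \<in> P" for x using ideal.subspace_scale[of P 1 x] P by (simp add: prime_ideal_def)
    then show ?thesis using P by (auto simp: prime_ideal_def)
  next
    case False
    then obtain v where v: "0 < lookup u v" using poly_mapping_eqI[of u 0] by auto
    have "monom u = monom (u - single v 1) * Var v"
      unfolding monom_def[of u] single_eq_times_Var[OF v] by (simp add: monom_def)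
    then have "monom (u - single v 1) \<in> P \<or> Var v \<in> P"
      using less.prems P unfolding prime_ideal_def by metis
    then show ?thesis
    proof
      assume *: "monom (u - single v 1) \<in> P"
      have "(\<Sum>w\<in>UNIV. lookup (u - single v 1) w) < (\<Sum>w\<in>UNIV. lookup u w)"
        using v by (intro sum_strict_mono_ex1) (auto simp: lookup_minus lookup_single when_def)
      from less.hyps[OF this *] obtain w where w: "0 < lookup (u - single v 1) w" "Var w \<in> P" by blast
      have "lookup (u - single v 1) w \<le> lookup u w" by (simp add: lookup_minus)
      then show ?thesis using w by (intro exI[of _ w]) linarith
    qed (use v in blast)
  qed
qed

lemma span_subset_deg_ideal:
  "cover C U \<longleftrightarrow> ideal.span (monom ` U) \<subseteq> (deg_ideal 1 C :: ('v::finite, 'k::field) mpoly set)"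
proof
  assume c: "cover C U"
  show "ideal.span (monom ` U) \<subseteq> (deg_ideal 1 C :: ('v, 'k) mpoly set)"
  proof (rule ideal.span_minimal[OF _ deg_ideal_subspace], rule image_subsetI)
    fix u assume "u \<in> U"
    then have "0 < deg_on C u" using c deg_on_pos[of C u] by (simp add: cover_def)
    then show "monom u \<in> (deg_ideal 1 C :: ('v, 'k) mpoly set)" by (simp add: deg_ideal_def)
  qed
next
  assume s: "ideal.span (monom ` U) \<subseteq> (deg_ideal 1 C :: ('v, 'k) mpoly set)"
  show "cover C U"
    unfolding cover_def
  proof
    fix u assume "u \<in> U"
    then have "monom u \<in> (deg_ideal 1 C :: ('v, 'k) mpoly set)" using s ideal.span_base by blast
    then have "0 < deg_on C u" by (simp add: deg_ideal_def)
    then show "\<exists>v\<in>C. 0 < lookup u v" using deg_on_pos[of C u] by simp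
  qed
qed

lemma prime_cover:
  fixes P :: "('v::finite, 'k::field) mpoly set"
  assumes "prime_ideal P" "ideal.span (monom ` U) \<subseteq> P"
  shows "cover {v. Var v \<in> P} U" "deg_ideal 1 {v. Var v \<in> P} \<subseteq> P"
proof -
  show "cover {v. Var v \<in> P} U"
    unfolding cover_def
  proof
    fix u assume "u \<in> U"
    then have "monom u \<in> P" using assms(2) ideal.span_base by blast
    then show "\<exists>v\<in>{v. Var v \<in> P}. 0 < lookup u v" using prime_monom[OF assms(1)] by blast
  qed
  show "deg_ideal 1 {v. Var v \<in> P} \<subseteq> P"
    using assms(1) by (intro deg_ideal_subset_prime) (auto simp: prime_ideal_def)
qed

text \<open>
  The variables in a prime containing \<open>U\<close> form a vertex cover of \<open>U\<close>, and the variables of a vertex cover generate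
  such a prime.
\<close>

lemma minimal_primes_monomial:
  "minimal_primes (ideal.span (monom ` U)) = (deg_ideal 1 ` {C. minimal_cover C U} :: ('v::finite, 'k::field) mpoly set set)"
proof (intro equalityI subsetI)
  let ?N = "ideal.span (monom ` U) :: ('v, 'k) mpoly set"
  fix P :: "('v, 'k) mpoly set" assume "P \<in> minimal_primes ?N"
  then have P: "prime_ideal P" "?N \<subseteq> P" and min: "\<And>Q. prime_ideal Q \<Longrightarrow> ?N \<subseteq> Q \<Longrightarrow> Q \<subseteq> P \<Longrightarrow> Q = P"
    unfolding minimal_primes_def by auto
  define C where "C = {v. Var v \<in> P}"
  have c: "cover C U" "deg_ideal 1 C \<subseteq> P" using prime_cover[OF P] unfolding C_def by auto
  have PC: "deg_ideal 1 C = P" by (rule min[OF prime_deg_ideal _ c(2)]) (use c(1) span_subset_deg_ideal in blast)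
  have "\<not> cover C' U" if C': "C' \<subset> C" for C'
  proof
    assume "cover C' U"
    then have "?N \<subseteq> deg_ideal 1 C'" using span_subset_deg_ideal by blast
    moreover have "(deg_ideal 1 C' :: ('v, 'k) mpoly set) \<subseteq> P"
      using C' P(1) by (intro deg_ideal_subset_prime) (auto simp: prime_ideal_def C_def)
    ultimately have "deg_ideal 1 C' = P" by (intro min prime_deg_ideal)
    then have "(deg_ideal 1 C' :: ('v, 'k) mpoly set) = deg_ideal 1 C" using PC by simp
    then have "v \<in> C' \<longleftrightarrow> v \<in> C" for v using Var_in_deg_ideal by metis
    then show False using C' by blast
  qed
  then have "minimal_cover C U" using c(1) by (simp add: minimal_cover_def)
  then show "P \<in> deg_ideal 1 ` {C. minimal_cover C U}" using PC by blast
next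
  let ?N = "ideal.span (monom ` U) :: ('v, 'k) mpoly set"
  fix P :: "('v, 'k) mpoly set" assume "P \<in> deg_ideal 1 ` {C. minimal_cover C U}"
  then obtain C where C: "minimal_cover C U" "P = deg_ideal 1 C" by blast
  have "Q = deg_ideal 1 C" if Q: "prime_ideal Q" "?N \<subseteq> Q" "Q \<subseteq> deg_ideal 1 C" for Q
  proof -
    have c: "cover {v. Var v \<in> Q} U" "deg_ideal 1 {v. Var v \<in> Q} \<subseteq> Q" using prime_cover[OF Q(1,2)] by auto
    have "{v. Var v \<in> Q} \<subseteq> C" using Q(3) Var_in_deg_ideal by blast
    then have "{v. Var v \<in> Q} = C" using C(1) c(1) unfolding minimal_cover_def by blast
    then show ?thesis using c(2) Q(3) by auto
  qed
  moreover have "?N \<subseteq> deg_ideal 1 C" using C(1) span_subset_deg_ideal unfolding minimal_cover_def by blast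
  ultimately show "P \<in> minimal_primes ?N"
    unfolding minimal_primes_def C(2) using prime_deg_ideal by blast
qed

lemma deg_on_monom_sums:
  assumes "cover C U" "s \<in> monom_sums U r" "finite C" shows "r \<le> deg_on C s"
  using assms(2)
proof (induction r arbitrary: s)
  case (Suc r)
  then obtain a b where ab: "a \<in> U" "b \<in> monom_sums U r" "s = a + b" by auto
  have "0 < deg_on C a" using assms(1,3) ab(1) by (simp add: deg_on_pos cover_def)
  then show ?case using Suc.IH[OF ab(2)] by (simp add: ab(3) deg_on_add)
qed simp

text \<open>
  By minimality of \<open>C\<close> each of its variables \<open>v\<close> lies in some \<open>u\<close> in \<open>U\<close> that contains no other variable of \<open>C\<close>. Choosing
  such \<open>u\<close> for \<open>r\<close> variables occurring in \<open>b\<close>, counted with multiplicity, gives a product bounded by \<open>b\<close> on \<open>C\<close>, and by \<open>r\<close>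
  elsewhere because \<open>U\<close> is squarefree.
\<close>

lemma minimal_cover_monom_sums:
  fixes U :: "'v::finite monom set"
  assumes C: "minimal_cover C U" and sq: "\<And>u. u \<in> U \<Longrightarrow> squarefree_monom u"
    and r: "r \<le> deg_on C b"
  shows "\<exists>s\<in>monom_sums U r. \<forall>v. lookup s v \<le> (if v \<in> C then lookup b v else r)"
  using r
proof (induction r arbitrary: b)
  case (Suc r)
  then have "0 < deg_on C b" by simp
  then obtain v where v: "v \<in> C" "0 < lookup b v" using deg_on_pos[of C b] by auto
  define b' where "b' = b - single v 1"
  have "single v 1 \<unlhd> b" using v unfolding mdvd_def by (auto simp: lookup_single when_def)
  then have "b = b' + single v 1" unfolding b'_def by (simp add: mdvd_diff)
  moreover have "deg_on C (single v 1) = 1" using v(1) unfolding deg_on_def by (simp add: lookup_single when_def)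
  ultimately have "r \<le> deg_on C b'" using Suc.prems by (simp add: deg_on_add)
  then obtain s where s: "s \<in> monom_sums U r" "\<And>x. lookup s x \<le> (if x \<in> C then lookup b' x else r)"
    using Suc.IH by blast
  have "\<not> cover (C - {v}) U" using C v(1) unfolding minimal_cover_def by blast
  then obtain u where u: "u \<in> U" "\<forall>x\<in>C - {v}. lookup u x = 0" unfolding cover_def by auto
  have "lookup (u + s) x \<le> (if x \<in> C then lookup b x else Suc r)" for x
  proof -
    have "lookup u x \<le> 1" using sq[OF u(1)] by (simp add: squarefree_monom_def)
    moreover have "lookup u x = 0" if "x \<in> C" "x \<noteq> v" using u(2) that by blast
    moreover have "lookup b' x = (if x = v then lookup b x - 1 else lookup b x)"
      by (simp add: b'_def lookup_minus lookup_single when_def)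
    ultimately show ?thesis using s(2)[of x] v by (auto simp: lookup_add split: if_splits)
  qed
  moreover have "u + s \<in> monom_sums U (Suc r)" using u(1) s(1) by auto
  ultimately show ?case by blast
qed simp

text \<open>
  Multiplying by \<open>r\<close>-th powers of all variables outside \<open>C\<close>, which are units in the localization, moves a polynomial
  of degree at least \<open>r\<close> on \<open>C\<close> into the \<open>r\<close>-th power of the ideal.
\<close>

lemma localization_contraction_monomial:
  fixes U :: "'v::finite monom set"
  assumes C: "minimal_cover C U" and sq: "\<And>u. u \<in> U \<Longrightarrow> squarefree_monom u"
  shows "localization_contraction (ideal_power (ideal.span (monom ` U)) r) (deg_ideal 1 C) = (deg_ideal r C :: ('v, 'k::field) mpoly set)"
proof (intro equalityI subsetI)
  let ?Nr = "ideal_power (ideal.span (monom ` U)) r :: ('v, 'k) mpoly set"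
  have NW: "?Nr \<subseteq> deg_ideal r C"
    unfolding ideal_power_monom
  proof (rule ideal.span_minimal[OF _ deg_ideal_subspace], rule image_subsetI)
    fix s assume "s \<in> monom_sums U r"
    then have "r \<le> deg_on C s" using C by (intro deg_on_monom_sums) (auto simp: minimal_cover_def)
    then show "monom s \<in> (deg_ideal r C :: ('v, 'k) mpoly set)" by (simp add: deg_ideal_def)
  qed
  {
    fix f assume "f \<in> localization_contraction ?Nr (deg_ideal 1 C)"
    then obtain x s w where xsw: "x \<in> ?Nr" "s \<notin> deg_ideal 1 C" "w \<notin> deg_ideal 1 C" "w * (f * s - x * 1) = 0"
      unfolding localization_contraction_def frac_eq_def by auto
    have "w * s \<notin> deg_ideal 1 C" using prime_deg_ideal[of C] xsw(2,3) unfolding prime_ideal_def by blast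
    moreover have "(w * s) * f = w * x" using xsw(4) by (simp add: algebra_simps)
    moreover have "w * x \<in> deg_ideal r C" using ideal.subspace_scale[OF deg_ideal_subspace] NW xsw(1) by blast
    ultimately show "f \<in> deg_ideal r C" using lowest_degree_zero[of "w * s" C f r] by simp
  }
  fix f :: "('v, 'k) mpoly" assume f: "f \<in> deg_ideal r C"
  \<comment> \<open>The product of the \<open>r\<close>-th powers of all variables outside \<open>C\<close>.\<close>
  define T where "T = Abs_poly_mapping (\<lambda>v. if v \<in> C then 0 else r)"
  have T: "lookup T v = (if v \<in> C then 0 else r)" for v
    unfolding T_def by (subst lookup_Abs_poly_mapping) auto
  define t where "t = (monom T :: ('v, 'k) mpoly)"
  have "deg_on C T = 0" unfolding deg_on_def by (simp add: T)
  then have tC: "t \<notin> deg_ideal 1 C" by (simp add: t_def deg_ideal_def)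
  have "t * f \<in> ?Nr"
    unfolding ideal_power_monom unfolding span_monom
  proof (intro CollectI ballI)
    fix m assume "m \<in> keys (t * f)"
    then obtain b where b: "b \<in> keys f" "m = T + b" using keys_times[of m t f] by (auto simp: t_def)
    have "r \<le> deg_on C b" using f b(1) by (simp add: deg_ideal_def)
    then obtain s where s: "s \<in> monom_sums U r" "\<And>v. lookup s v \<le> (if v \<in> C then lookup b v else r)"
      using minimal_cover_monom_sums[OF C sq] by blast
    have "lookup s v \<le> lookup m v" for v
      using s(2)[of v] unfolding b(2) by (simp add: lookup_add T split: if_splits)
    then show "\<exists>s\<in>monom_sums U r. s \<unlhd> m" using s(1) unfolding mdvd_def by blast
  qed
  moreover have "frac_eq (deg_ideal 1 C) (f, 1) (t * f, t)"
    unfolding frac_eq_def using one_notin_deg_ideal[of C] by (intro exI[of _ 1]) (simp add: algebra_simps)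
  ultimately show "f \<in> localization_contraction ?Nr (deg_ideal 1 C)"
    unfolding localization_contraction_def using tC by blast
qed

lemma minimal_cover_below:
  fixes C :: "'v::finite set"
  assumes "cover C U" shows "\<exists>C0\<subseteq>C. minimal_cover C0 U"
  using assms
proof (induction "card C" arbitrary: C rule: less_induct)
  case less
  show ?case
  proof (cases "minimal_cover C U")
    case False
    then obtain C' where C': "C' \<subset> C" "cover C' U" using less.prems unfolding minimal_cover_def by blast
    have "card C' < card C" using C'(1) by (intro psubset_card_mono) auto
    then show ?thesis using less.hyps[OF _ C'(2)] C'(1) by blast
  qed blast
qed

text \<open>
  All covers are allowed here, not only the minimal ones; this gives the same set and makes it easier to transport
  covers along \<open>\<psi>\<close>.
\<close>

definition symbolic_monoms :: "'v monom set \<Rightarrow> nat \<Rightarrow> 'v monom set" where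
  "symbolic_monoms U r = {m. \<forall>C. cover C U \<longrightarrow> r \<le> deg_on C m}"

theorem symbolic_power_monomial:
  fixes U :: "'v::finite monom set"
  assumes sq: "\<And>u. u \<in> U \<Longrightarrow> squarefree_monom u"
  shows "symbolic_power (ideal.span (monom ` U)) r = (ideal.span (monom ` symbolic_monoms U r) :: ('v, 'k::field) mpoly set)"
proof -
  have "symbolic_power (ideal.span (monom ` U)) r = ((\<Inter>C\<in>{C. minimal_cover C U}. deg_ideal r C) :: ('v, 'k) mpoly set)"
    unfolding symbolic_power_def minimal_primes_monomial image_image
    by (intro arg_cong[where f = Inter] image_cong refl)
      (simp only: mem_Collect_eq localization_contraction_monomial[OF _ sq])
  also have "\<dots> = {f. keys f \<subseteq> symbolic_monoms U r}"
  proof (intro equalityI subsetI)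
    fix f :: "('v, 'k) mpoly" assume f: "f \<in> (\<Inter>C\<in>{C. minimal_cover C U}. deg_ideal r C)"
    have "r \<le> deg_on C m" if m: "m \<in> keys f" and c: "cover C U" for m C
    proof -
      obtain C0 where C0: "C0 \<subseteq> C" "minimal_cover C0 U" using minimal_cover_below[OF c] by blast
      have "r \<le> deg_on C0 m" using f C0(2) m by (auto simp: deg_ideal_def)
      also have "\<dots> \<le> deg_on C m" unfolding deg_on_def using C0(1) by (intro sum_mono2) auto
      finally show ?thesis .
    qed
    then show "f \<in> {f. keys f \<subseteq> symbolic_monoms U r}" by (auto simp: symbolic_monoms_def)
  qed (auto simp: symbolic_monoms_def deg_ideal_def minimal_cover_def)
  also have "\<dots> = ideal.span (monom ` symbolic_monoms U r)"
  proof -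
    have "m \<in> symbolic_monoms U r" if "u \<in> symbolic_monoms U r" "u \<unlhd> m" for u m
      using that deg_on_mono[OF that(2)] unfolding symbolic_monoms_def by (auto intro: order_trans)
    then show ?thesis unfolding span_monom using mdvd_refl by blast
  qed
  finally show ?thesis .
qed

section \<open>Extremal ideals\<close>

context monomial_hom
begin

lemma D_monom_sums: "D ` monom_sums U r = monom_sums (D ` U) r"
proof (induction r)
  case (Suc r)
  have "D ` monom_sums U (Suc r) = {D (a + b) |a b. a \<in> U \<and> b \<in> monom_sums U r}"
    unfolding monom_sums.simps by blast
  also have "\<dots> = {D a + D b |a b. a \<in> U \<and> b \<in> monom_sums U r}" unfolding D_add ..
  also have "\<dots> = {a + b |a b. a \<in> D ` U \<and> b \<in> D ` monom_sums U r}" by blast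
  finally show ?case unfolding Suc by simp
qed simp

lemma D_mtimes: "D (mtimes n a) = mtimes n (D a)"
  by (induction n) (simp_all add: mtimes_Suc D_add)

end

locale extremal =
  fixes m :: "'q::finite \<Rightarrow> 'x::finite monom" and \<psi> :: "('q nonempty_subset, 'k::field) mpoly \<Rightarrow> ('x, 'k) mpoly"
  assumes sq: "\<And>j. squarefree_monom (m j)" and psi: "is_psi m \<psi>"
begin

text \<open>
  The subset of \<open>[q]\<close> recorded by the variable \<open>k\<close>: it is the unique \<open>A\<close> with \<open>x\<^sub>k\<close> dividing \<open>\<psi> (y\<^sub>A)\<close>, if it is
  nonempty.
\<close>

definition index_set :: "'x \<Rightarrow> 'q set" where
  "index_set k = {j. 0 < lookup (m j) k}"

definition D :: "'q nonempty_subset monom \<Rightarrow> 'x monom" where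
  "D a = Abs_poly_mapping (\<lambda>k. if index_set k = {} then 0 else lookup a (Abs_nonempty_subset (index_set k)))"

lemma lookup_D: "lookup (D a) k = (if index_set k = {} then 0 else lookup a (Abs_nonempty_subset (index_set k)))"
  unfolding D_def by (subst lookup_Abs_poly_mapping) auto

lemma Rep_ne: "Rep_nonempty_subset A \<noteq> {}"
  using Rep_nonempty_subset by blast

lemma Abs_index_set: "index_set k \<noteq> {} \<Longrightarrow> Abs_nonempty_subset (index_set k) = A \<longleftrightarrow> index_set k = Rep_nonempty_subset A"
  by (metis Abs_nonempty_subset_inverse Rep_nonempty_subset_inverse mem_Collect_eq)

lemma prod_Var: "finite K \<Longrightarrow> (\<Prod>k\<in>K. Var k) = (monom (\<Sum>k\<in>K. single k 1) :: ('y, 'k) mpoly)"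
  by (induction K rule: finite_induct) (simp_all add: monom_add Var_def)

lemma D_additive: "D (a + b) = D a + D b"
  by (rule poly_mapping_eqI) (simp add: lookup_D lookup_add)

sublocale monomial_hom \<psi> D
proof
  show hom: "algebra_hom \<psi>" using psi by (simp add: is_psi_def)
  have D0: "D 0 = 0" by (rule poly_mapping_eqI) (simp add: lookup_D)
  have mult: "\<psi> (monom (a + b)) = monom (D (a + b))"
    if "\<psi> (monom a) = monom (D a)" "\<psi> (monom b) = monom (D b)" for a b
    using hom that by (simp add: monom_add D_additive algebra_hom_def)
  have zero: "\<psi> (monom 0) = monom (D 0)" using hom by (simp add: D0 algebra_hom_def)
  have one: "\<psi> (monom (single A 1)) = monom (D (single A 1))" for A
  proof -
    define K where "K = {k. \<forall>j. 0 < lookup (m j) k \<longleftrightarrow> j \<in> Rep_nonempty_subset A}"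
    have K: "k \<in> K \<longleftrightarrow> index_set k = Rep_nonempty_subset A" for k unfolding index_set_def K_def by auto
    have "D (single A 1) = (\<Sum>k\<in>K. single k 1)"
    proof (rule poly_mapping_eqI)
      fix k
      have "lookup (\<Sum>k\<in>K. single k 1) k = (if k \<in> K then 1 else (0::nat))"
        by (simp add: lookup_sum lookup_single when_def)
      also have "\<dots> = lookup (D (single A 1)) k"
      proof (cases "index_set k = {}")
        case True
        then have "k \<notin> K" using K[of k] Rep_ne[of A] by simp
        then show ?thesis using True by (simp add: lookup_D)
      next
        case False
        have "Abs_nonempty_subset (index_set k) = A \<longleftrightarrow> k \<in> K" unfolding K by (rule Abs_index_set[OF False])
        then show ?thesis using False by (auto simp: lookup_D lookup_single when_def)
      qed
      finally show "lookup (D (single A 1)) k = lookup (\<Sum>k\<in>K. single k 1) k" by simp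
    qed
    moreover have "\<psi> (Var A) = (\<Prod>k\<in>K. Var k)" using psi by (simp add: is_psi_def K_def)
    then have "\<psi> (Var A) = monom (\<Sum>k\<in>K. single k 1)" by (simp only: prod_Var[OF finite])
    ultimately show ?thesis by (simp only: Var_def)
  qed
  have "\<psi> (monom (single A c)) = monom (D (single A c))" for A c
  proof (induction c)
    case 0 then show ?case using zero by simp
  next
    case (Suc c)
    have "single A (Suc c) = single A 1 + single A c" by (simp add: single_add[symmetric])
    then show ?case using mult[OF one Suc] by simp
  qed
  then show "\<psi> (monom a) = monom (D a)" for a
    by (induction a rule: poly_mapping_single_induct) (use zero mult in auto)
qed

text \<open>
  Each exponent of \<open>D a\<close> is zero or a copy of an exponent of \<open>a\<close>, so maxima are preserved.
\<close>

lemma D_mlcm: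
  assumes "finite A" "A \<noteq> {}" shows "D (mlcm A) = mlcm (D ` A)"
proof (rule poly_mapping_eqI)
  fix k
  show "lookup (D (mlcm A)) k = lookup (mlcm (D ` A)) k"
    using assms by (simp add: lookup_D lookup_mlcm image_image image_constant_conv)
qed

text \<open>
  The set \<open>G\<close> may be infinite; passing to its minimal elements makes the general result applicable.
\<close>

lemma monomial_pair_statements:
  assumes \<J>: "\<J> = ideal.span (monom ` G)" and J: "J = ideal.span (monom ` H)"
    and GH: "\<And>g. g \<in> G \<Longrightarrow> D g \<in> H" and HG: "\<And>h. h \<in> H \<Longrightarrow> \<exists>g\<in>G. D g \<unlhd> h"
  shows "resolution_and_betti_statements TYPE('b) \<psi> \<J> J"
proof (rule lcm_preserving_statements)
  show "finite (minimal_monoms G)" by (rule finite_minimal_monoms)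
  show "D (mlcm A) = mlcm (D ` A)" if "A \<subseteq> minimal_monoms G" "A \<noteq> {}" for A
    using that finite_minimal_monoms finite_subset by (intro D_mlcm) blast+
  show "\<J> = ideal.span (monom ` minimal_monoms G)" unfolding \<J> span_minimal_monoms ..
  have "J = ideal.span (monom ` D ` G)"
    unfolding J
  proof (rule span_monom_eqI)
    show "\<exists>v\<in>D ` G. v \<unlhd> h" if "h \<in> H" for h using HG[OF that] by blast
    show "\<exists>u\<in>H. u \<unlhd> v" if "v \<in> D ` G" for v using that GH mdvd_refl by blast
  qed
  then show "J = ideal.span (\<psi> ` \<J>)"
    unfolding \<J> ideal_span_image[OF hom] by (simp add: image_image monom)
qed

definition eps :: "'q \<Rightarrow> 'q nonempty_subset monom" where
  "eps i = (\<Sum>A | i \<in> Rep_nonempty_subset A. single A 1)"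

lemma lookup_eps: "lookup (eps i) A = (if i \<in> Rep_nonempty_subset A then 1 else 0)"
  by (simp add: eps_def lookup_sum lookup_single when_def)

lemma extremal_ideal_eq: "(extremal_ideal :: ('q nonempty_subset, 'k) mpoly set) = ideal.span (monom ` range eps)"
  unfolding extremal_ideal_def image_image eps_def by (simp add: prod_Var)

lemma D_eps: "D (eps i) = m i"
proof (rule poly_mapping_eqI)
  fix k
  show "lookup (D (eps i)) k = lookup (m i) k"
  proof (cases "index_set k = {}")
    case True
    then have "i \<notin> index_set k" by simp
    then have "lookup (m i) k = 0" by (simp add: index_set_def)
    then show ?thesis using True by (simp add: lookup_D)
  next
    case False
    then have "lookup (D (eps i)) k = (if i \<in> index_set k then 1 else 0)"
      by (simp add: lookup_D lookup_eps Abs_nonempty_subset_inverse)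
    also have "\<dots> = lookup (m i) k"
    proof -
      have "lookup (m i) k \<le> 1" using sq[of i] by (simp add: squarefree_monom_def)
      then show ?thesis unfolding index_set_def by (cases "lookup (m i) k") auto
    qed
    finally show ?thesis .
  qed
qed

lemma D_range_eps: "D ` range eps = range m"
  unfolding image_image D_eps ..

lemma D_powers: "D ` monom_sums (range eps) r = monom_sums (range m) r"
  unfolding D_monom_sums D_range_eps ..

lemma power_statements:
  "resolution_and_betti_statements TYPE('b) \<psi> (ideal_power extremal_ideal r)
     (ideal_power (ideal.span (monom ` range m)) r)"
proof (rule monomial_pair_statements)
  show "ideal_power extremal_ideal r = (ideal.span (monom ` monom_sums (range eps) r) :: ('q nonempty_subset, 'k) mpoly set)"
    unfolding extremal_ideal_eq by (rule ideal_power_monom)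
  show "ideal_power (ideal.span (monom ` range m)) r = (ideal.span (monom ` monom_sums (range m) r) :: ('x, 'k) mpoly set)"
    by (rule ideal_power_monom)
  show "D g \<in> monom_sums (range m) r" if "g \<in> monom_sums (range eps) r" for g
    using that D_powers by blast
  show "\<exists>g\<in>monom_sums (range eps) r. D g \<unlhd> h" if "h \<in> monom_sums (range m) r" for h
    using that mdvd_refl unfolding D_powers[symmetric] by blast
qed

text \<open>
  If \<open>n\<close> times \<open>h\<close> is divisible by \<open>D s\<close>, then \<open>h\<close> is divisible by \<open>D g\<close>, where the exponents of \<open>g\<close> are those of \<open>s\<close> divided
  by \<open>n\<close> and rounded up.
\<close>

lemma integral_closure_statements:
  "resolution_and_betti_statements TYPE('b) \<psi> (integral_closure (ideal_power extremal_ideal r))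
     (integral_closure (ideal_power (ideal.span (monom ` range m)) r))"
proof (rule monomial_pair_statements)
  let ?E = "monom_sums (range eps) r" and ?M = "monom_sums (range m) r"
  show "integral_closure (ideal_power extremal_ideal r) = (ideal.span (monom ` integral_monoms ?E) :: ('q nonempty_subset, 'k) mpoly set)"
    unfolding extremal_ideal_eq ideal_power_monom by (intro integral_closure_monomial finite_monom_sums) simp
  show "integral_closure (ideal_power (ideal.span (monom ` range m)) r) = (ideal.span (monom ` integral_monoms ?M) :: ('x, 'k) mpoly set)"
    unfolding ideal_power_monom by (intro integral_closure_monomial finite_monom_sums) simp
  show "D g \<in> integral_monoms ?M" if "g \<in> integral_monoms ?E" for g
  proof -
    obtain n s where s: "n \<ge> 1" "s \<in> monom_sums ?E n" "s \<unlhd> mtimes n g" using \<open>g \<in> integral_monoms ?E\<close> unfolding integral_monoms_def by blast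
    have "D s \<in> monom_sums ?M n" using s(2) unfolding D_powers[symmetric] D_monom_sums[symmetric] by (rule imageI)
    moreover have "D s \<unlhd> mtimes n (D g)" using D_mono[OF s(3)] unfolding D_mtimes .
    ultimately show ?thesis using s(1) unfolding integral_monoms_def by blast
  qed
  show "\<exists>g\<in>integral_monoms ?E. D g \<unlhd> h" if "h \<in> integral_monoms ?M" for h
  proof -
    obtain n s' where s': "n \<ge> 1" "s' \<in> monom_sums ?M n" "s' \<unlhd> mtimes n h" using \<open>h \<in> integral_monoms ?M\<close> unfolding integral_monoms_def by blast
    then obtain s where s: "s \<in> monom_sums ?E n" "s' = D s"
      unfolding D_powers[symmetric] D_monom_sums[symmetric] by blast
    \<comment> \<open>Division by \<open>n\<close>, rounded up.\<close>
    define g where "g = Abs_poly_mapping (\<lambda>A. (lookup s A + n - 1) div n)"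
    have g: "lookup g A = (lookup s A + n - 1) div n" for A
      unfolding g_def by (subst lookup_Abs_poly_mapping) auto
    have "lookup s A \<le> n * lookup g A" for A
    proof -
      have "lookup s A + n - 1 < n * ((lookup s A + n - 1) div n) + n"
        using s'(1) mult_div_mod_eq[of n "lookup s A + n - 1"] mod_less_divisor[of n "lookup s A + n - 1"] by linarith
      then show ?thesis unfolding g by linarith
    qed
    then have "s \<unlhd> mtimes n g" unfolding mdvd_def by simp
    then have "g \<in> integral_monoms ?E" using s(1) s'(1) unfolding integral_monoms_def by blast
    moreover have "D g \<unlhd> h"
      unfolding mdvd_def
    proof
      fix k
      show "lookup (D g) k \<le> lookup h k"
      proof (cases "index_set k = {}")
        case False
        let ?x = "lookup s (Abs_nonempty_subset (index_set k))"
        have "lookup (D s) k \<le> n * lookup h k" using s'(3) unfolding s(2) mdvd_def by simp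
        then have "?x \<le> n * lookup h k" using False by (simp add: lookup_D)
        then have "?x + n - 1 < n * Suc (lookup h k)" using s'(1) by (simp add: algebra_simps)
        then have "(?x + n - 1) div n < Suc (lookup h k)" using s'(1) by (simp add: div_less_iff_less_mult mult.commute)
        then show ?thesis using False by (simp add: lookup_D g)
      qed (simp add: lookup_D)
    qed
    ultimately show ?thesis by blast
  qed
qed

text \<open>
  A cover of the \<open>m j\<close> induces one of the extremal generators by \<open>index_set\<close>. Conversely, a cover of the extremal
  generators all of whose variables occur as index sets is lifted by choosing, for each variable, a \<open>k\<close> in
  its fibre with the smallest exponent in \<open>h\<close>.
\<close>

lemma symbolic_power_statements:
  "resolution_and_betti_statements TYPE('b) \<psi> (symbolic_power extremal_ideal r)
     (symbolic_power (ideal.span (monom ` range m)) r)"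
proof (rule monomial_pair_statements)
  show "symbolic_power extremal_ideal r = (ideal.span (monom ` symbolic_monoms (range eps) r) :: ('q nonempty_subset, 'k) mpoly set)"
    unfolding extremal_ideal_eq
    by (rule symbolic_power_monomial) (auto simp: squarefree_monom_def lookup_eps)
  show "symbolic_power (ideal.span (monom ` range m)) r = (ideal.span (monom ` symbolic_monoms (range m) r) :: ('x, 'k) mpoly set)"
    by (rule symbolic_power_monomial) (use sq in auto)
  show "D g \<in> symbolic_monoms (range m) r" if g: "g \<in> symbolic_monoms (range eps) r" for g
    unfolding symbolic_monoms_def
  proof (intro CollectI allI impI)
    fix C assume C: "cover C (range m)"
    \<comment> \<open>Variables of \<open>C\<close> outside all \<open>m j\<close> contribute nothing to the cover.\<close>
    define C1 where "C1 = {k\<in>C. index_set k \<noteq> {}}"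
    have "cover ((\<lambda>k. Abs_nonempty_subset (index_set k)) ` C1) (range eps)"
      unfolding cover_def
    proof
      fix u assume "u \<in> range eps"
      then obtain i where i: "u = eps i" by blast
      obtain k where k: "k \<in> C" "0 < lookup (m i) k" using C unfolding cover_def by blast
      then have "i \<in> index_set k" by (simp add: index_set_def)
      then have "index_set k \<noteq> {}" "Rep_nonempty_subset (Abs_nonempty_subset (index_set k)) = index_set k"
        by (auto intro!: Abs_nonempty_subset_inverse)
      then have "k \<in> C1" "0 < lookup u (Abs_nonempty_subset (index_set k))"
        using k(1) \<open>i \<in> index_set k\<close> unfolding C1_def i lookup_eps by simp_all
      then show "\<exists>v\<in>(\<lambda>k. Abs_nonempty_subset (index_set k)) ` C1. 0 < lookup u v" by blast
    qed
    then have "r \<le> deg_on ((\<lambda>k. Abs_nonempty_subset (index_set k)) ` C1) g" using g unfolding symbolic_monoms_def by blast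
    also have "\<dots> \<le> (\<Sum>k\<in>C1. lookup g (Abs_nonempty_subset (index_set k)))"
      unfolding deg_on_def using sum_image_le[of C1 "lookup g" "\<lambda>k. Abs_nonempty_subset (index_set k)"] by (simp add: o_def)
    also have "\<dots> = (\<Sum>k\<in>C1. lookup (D g) k)" by (intro sum.cong) (auto simp: lookup_D C1_def)
    also have "\<dots> \<le> deg_on C (D g)" unfolding deg_on_def C1_def by (intro sum_mono2) auto
    finally show "r \<le> deg_on C (D g)" .
  qed
  show "\<exists>g\<in>symbolic_monoms (range eps) r. D g \<unlhd> h" if h: "h \<in> symbolic_monoms (range m) r" for h
  proof -
    define K where "K A = {k. index_set k = Rep_nonempty_subset A}" for A
    \<comment> \<open>Variables with empty fibre are sent to \<open>1\<close>, and the value \<open>r\<close> makes every cover that uses them large enough.\<close>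
    define g where "g = Abs_poly_mapping (\<lambda>A. if K A = {} then r else Min (lookup h ` K A))"
    have g: "lookup g A = (if K A = {} then r else Min (lookup h ` K A))" for A
      unfolding g_def by (subst lookup_Abs_poly_mapping) auto
    have "D g \<unlhd> h"
      unfolding mdvd_def
    proof
      fix k
      show "lookup (D g) k \<le> lookup h k"
      proof (cases "index_set k = {}")
        case False
        then have "k \<in> K (Abs_nonempty_subset (index_set k))" unfolding K_def by (simp add: Abs_nonempty_subset_inverse)
        then show ?thesis using False unfolding lookup_D g by auto
      qed (simp add: lookup_D)
    qed
    moreover have "g \<in> symbolic_monoms (range eps) r"
      unfolding symbolic_monoms_def
    proof (intro CollectI allI impI)
      fix C assume C: "cover C (range eps)"
      show "r \<le> deg_on C g"
      proof (cases "\<exists>A\<in>C. K A = {}")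
        case True
        then obtain A where A: "A \<in> C" "lookup g A = r" by (auto simp: g)
        then show ?thesis unfolding deg_on_def using member_le_sum[of A C "lookup g"] by simp
      next
        case False
        have "\<exists>k. k \<in> K A \<and> lookup h k = lookup g A" if "A \<in> C" for A
        proof -
          have "K A \<noteq> {}" using False that by blast
          moreover have "Min (lookup h ` K A) \<in> lookup h ` K A" using \<open>K A \<noteq> {}\<close> by (intro Min_in) auto
          then obtain k where "k \<in> K A" "lookup h k = Min (lookup h ` K A)" by (metis imageE)
          ultimately show ?thesis unfolding g by (intro exI[of _ k]) simp
        qed
        then obtain \<kappa> where \<kappa>: "\<And>A. A \<in> C \<Longrightarrow> \<kappa> A \<in> K A \<and> lookup h (\<kappa> A) = lookup g A" by metis
        have "cover (\<kappa> ` C) (range m)"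
          unfolding cover_def
        proof
          fix u assume "u \<in> range m"
          then obtain i where i: "u = m i" by blast
          obtain A where A: "A \<in> C" "0 < lookup (eps i) A" using C unfolding cover_def by blast
          then have "i \<in> index_set (\<kappa> A)" using \<kappa>[OF A(1)] by (simp add: K_def lookup_eps split: if_splits)
          then show "\<exists>v\<in>\<kappa> ` C. 0 < lookup u v" using A(1) unfolding i index_set_def by blast
        qed
        then have "r \<le> deg_on (\<kappa> ` C) h" using h unfolding symbolic_monoms_def by blast
        also have "\<dots> \<le> (\<Sum>A\<in>C. lookup h (\<kappa> A))"
          unfolding deg_on_def using sum_image_le[of C "lookup h" \<kappa>] by (simp add: o_def)
        also have "\<dots> = deg_on C g" unfolding deg_on_def using \<kappa> by (intro sum.cong) auto
        finally show ?thesis .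
      qed
    qed
    ultimately show ?thesis by blast
  qed
qed

end

theorem theorem6p1:
  fixes \<psi> :: "('z::finite, 'k::field) mpoly \<Rightarrow> ('x::finite, 'k) mpoly"
    and u :: "nat \<Rightarrow> 'z monom" and q :: nat
    and \<J> :: "('z, 'k) mpoly set" and J :: "('x, 'k) mpoly set"
    and m :: "'q::finite \<Rightarrow> 'x monom" and I :: "('x, 'k) mpoly set"
    and \<psi>\<^sub>I :: "('q nonempty_subset, 'k) mpoly \<Rightarrow> ('x, 'k) mpoly" and r :: nat
  shows
    "(algebra_hom \<psi> \<and> monomial_map \<psi> \<and>
      \<J> = ideal.span ((\<lambda>i. monom (u i)) ` {1..q}) \<and>
      J = ideal.span (\<psi> ` \<J>) \<and>
      (\<forall>A. A \<noteq> {} \<and> A \<subseteq> {1..q} \<longrightarrow>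
         \<psi> (monom (mlcm (u ` A))) = monom (mlcm ((\<lambda>i. on_monom \<psi> (u i)) ` A)))
      \<longrightarrow> resolution_and_betti_statements TYPE('b) \<psi> \<J> J)
    \<and>
     (inj m \<and> (\<forall>j. squarefree_monom (m j)) \<and> minimally_generates (range m) I \<and>
      is_psi m \<psi>\<^sub>I \<and> r \<ge> 1
      \<longrightarrow>
        resolution_and_betti_statements TYPE('b) \<psi>\<^sub>I
          (ideal_power extremal_ideal r) (ideal_power I r) \<and>
        resolution_and_betti_statements TYPE('b) \<psi>\<^sub>I
          (integral_closure (ideal_power extremal_ideal r)) (integral_closure (ideal_power I r)) \<and>
        resolution_and_betti_statements TYPE('b) \<psi>\<^sub>I
          (symbolic_power extremal_ideal r) (symbolic_power I r))"
proof (intro conjI impI, goal_cases)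
  case 1
  then show ?case by (intro statements_of_lcm_condition[of \<psi> \<J> u q J]) auto
next
  case 2
  then interpret extremal m \<psi>\<^sub>I by unfold_locales auto
  have I: "I = ideal.span (monom ` range m)" using 2 by (simp add: minimally_generates_def)
  show ?case unfolding I by (rule power_statements)
next
  case 3
  then interpret extremal m \<psi>\<^sub>I by unfold_locales auto
  have I: "I = ideal.span (monom ` range m)" using 3 by (simp add: minimally_generates_def)
  show ?case unfolding I by (rule integral_closure_statements)
next
  case 4
  then interpret extremal m \<psi>\<^sub>I by unfold_locales auto
  have I: "I = ideal.span (monom ` range m)" using 4 by (simp add: minimally_generates_def)
  show ?case unfolding I by (rule symbolic_power_statements)
qed

end
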